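(* Let $d\ge 1$, $a\in[0,1]$, $\alpha>0$, and let $(\tau_x)_{x\in\mathbb{Z}^d}$ be i.i.d. random variables with law $\mathbb{P}$ such that $\tau_0\ge 1$ and such that $F(y)=\mathbb{P}[\tau_0>y]$ varies regularly at infinity with index $-\alpha$. Let $\lambda_n$ be the principal Dirichlet eigenvalue on $B_n=\{-n,\dots,n\}^d$ for the parameter $a$, and $\lambda_n^\circ$ the one for $a=0$ (see context), and let $h(x)=\inf\{y: 1/F(y)\ge x\}$. Then the following hold. (1) For almost every environment, $$\lim_{n\to\infty}-\frac{\ln(\lambda_n)}{\ln(n)}=\begin{cases}\max\left(2,1+\frac1\alpha\right)&\text{if } d=1,\\[2pt] \max\left(2,\frac d\alpha\right)&\text{if } d\ge 2.\end{cases}$$ (2) If $d\ge 2$ and $\alpha>d/2$, or if $d=1$ and $\alpha>1$, then there exist constants $k_1,k_2>0$ such that for almost every environment and all $n$ large enough, $$\frac{k_1}{n^2}\le\lambda_n\le\frac{k_2}{n^2}.$$ (3) If $\alpha<1$ and $d\ne 2$, then for any $\varepsilon>0$ there exist $\eta,M>0$ such that for all $n$ large enough, $$\mathbb{P}[\eta\le a_n\lambda_n\le M]\ge 1-\varepsilon,\qquad\text{where } a_n=\begin{cases} n\,h(n)&\text{if } d=1,\\ h(n^d)&\text{if } d\ge 3.\end{cases}$$ (4) If $d=2$ and $\alpha<1$, let $a_n=\ln(n)\,h(n^2)$. Then for any $\varepsilon>0$ there exist $\eta,M>0$ such that for all $n$ large enough, $$\mathbb{P}[\eta\le a_n\lambda_n^\circ\le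 M]\ge 1-\varepsilon\quad\text{and}\quad \mathbb{P}[\eta\le a_n\lambda_n\le \ln(n)\,M]\ge 1-\varepsilon.$$
   Context: The family $\tau=(\tau_x)_{x\in\mathbb{Z}^d}$ is called the environment; "for almost every environment" means $\mathbb{P}$-almost surely. Write $x\sim y$ when $x,y\in\mathbb{Z}^d$ are nearest neighbours ($\|x-y\|=1$). A function $f$ varies regularly with index $\rho$ at infinity if $f(\kappa x)/f(x)\to\kappa^\rho$ as $x\to+\infty$ for every $\kappa>0$. For $a\in[0,1]$ and an environment $\tau$, the generator is $\mathcal{L}f(x)=\sum_{y\sim x}\tau_x^{-(1-a)}\tau_y^{a}\,(f(y)-f(x))$. Let $B_n=\{-n,\dots,n\}^d$. The Dirichlet restriction $\mathcal{L}_n$ is defined by $\mathcal{L}_nf=\mathbf{1}_{B_n}\mathcal{L}f$ for functions $f:\mathbb{Z}^d\to\mathbb{R}$ vanishing outside $B_n$. $\lambda_n$ is the smallest eigenvalue of $-\mathcal{L}_n$, and $\lambda_n^\circ$ denotes this eigenvalue in the particular case $a=0$. (The operator $\mathcal{L}_n$ is self-adjoint for the scalar product $(f,g)=\sum_x f(x)g(x)\tau_x$.) *)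

theory Defs
  imports "HOL-Probability.Probability"
begin

text \<open>The lattice is \<open>int ^ 'd\<close>, so the dimension is \<open>CARD('d)\<close>. There is no norm on
  \<open>int ^ 'd\<close>; the Euclidean norm is taken after embedding into \<open>real ^ 'd\<close>.\<close>

definition nearest_nbr :: "int ^ 'd \<Rightarrow> int ^ 'd \<Rightarrow> bool"  (infix "\<sim>\<^sub>Z" 50)
  where "x \<sim>\<^sub>Z y \<longleftrightarrow> norm (\<chi> i. real_of_int (x $ i - y $ i)) = 1"

lemma finite_nearest_nbr: "finite {y :: int ^ 'd. y \<sim>\<^sub>Z x}"
proof -
  have "{y :: int ^ 'd. y \<sim>\<^sub>Z x}
      \<subseteq> vec_lambda ` (\<Pi>\<^sub>E i\<in>UNIV. {x $ i - 1 .. x $ i + 1})"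
  proof
    fix y :: "int ^ 'd"
    assume "y \<in> {y. y \<sim>\<^sub>Z x}"
    then have n: "norm (\<chi> i. real_of_int (y $ i - x $ i)) = 1"
      by (simp add: nearest_nbr_def)
    have "y $ i \<in> {x $ i - 1 .. x $ i + 1}" for i
    proof -
      have "\<bar>real_of_int (y $ i - x $ i)\<bar> \<le> 1"
        using component_le_norm_cart[of "\<chi> i. real_of_int (y $ i - x $ i)" i] n by simp
      then have "\<bar>y $ i - x $ i\<bar> \<le> 1" by linarith
      then show ?thesis by auto
    qed
    then have "vec_nth y \<in> (\<Pi>\<^sub>E i\<in>UNIV. {x $ i - 1 .. x $ i + 1})" by auto
    then show "y \<in> vec_lambda ` (\<Pi>\<^sub>E i\<in>UNIV. {x $ i - 1 .. x $ i + 1})"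
      by (metis image_eqI vec_nth_inverse)
  qed
  then show ?thesis
    by (rule finite_subset) (intro finite_imageI finite_PiE, auto)
qed

definition lattice_box :: "nat \<Rightarrow> (int ^ 'd) set"
  where "lattice_box n = {x. \<forall>i. x $ i \<in> {- int n .. int n}}"

definition generator ::
    "real \<Rightarrow> (int ^ 'd \<Rightarrow> real) \<Rightarrow> (int ^ 'd \<Rightarrow> real) \<Rightarrow> int ^ 'd \<Rightarrow> real"
  where "generator a \<tau> f x =
    (\<Sum>y | y \<sim>\<^sub>Z x. \<tau> x powr (- (1 - a)) * \<tau> y powr a * (f y - f x))"

definition dirichlet_generator ::
    "real \<Rightarrow> (int ^ 'd \<Rightarrow> real) \<Rightarrow> nat \<Rightarrow> (int ^ 'd \<Rightarrow> real) \<Rightarrow> int ^ 'd \<Rightarrow> real"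
  where "dirichlet_generator a \<tau> n f x = indicator (lattice_box n) x * generator a \<tau> f x"

text \<open>The operator acts on the functions vanishing outside the box, so eigenfunctions are
  required to do so. For a positive environment it is self-adjoint for a weighted scalar product,
  so all its eigenvalues are real and nothing is lost by using real eigenfunctions.\<close>

definition neg_dirichlet_eigenvalue ::
    "real \<Rightarrow> (int ^ 'd \<Rightarrow> real) \<Rightarrow> nat \<Rightarrow> real \<Rightarrow> bool"
  where "neg_dirichlet_eigenvalue a \<tau> n \<mu> \<longleftrightarrow>
    (\<exists>f. (\<exists>x. f x \<noteq> 0) \<and> (\<forall>x. x \<notin> lattice_box n \<longrightarrow> f x = 0) \<and>
         (\<forall>x. - dirichlet_generator a \<tau> n f x = \<mu> * f x))"

definition principal_dirichlet_eigenvalue :: "real \<Rightarrow> (int ^ 'd \<Rightarrow> real) \<Rightarrow> nat \<Rightarrow> real"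
  where "principal_dirichlet_eigenvalue a \<tau> n = (LEAST \<mu>. neg_dirichlet_eigenvalue a \<tau> n \<mu>)"

definition regularly_varying :: "(real \<Rightarrow> real) \<Rightarrow> real \<Rightarrow> bool"
  where "regularly_varying f \<rho> \<longleftrightarrow>
    (\<forall>\<kappa>>0. ((\<lambda>x. f (\<kappa> * x) / f x) \<longlongrightarrow> \<kappa> powr \<rho>) at_top)"

definition tail_prob :: "'w measure \<Rightarrow> ('w \<Rightarrow> real) \<Rightarrow> real \<Rightarrow> real"
  where "tail_prob M X y = \<P>(\<omega> in M. X \<omega> > y)"

text \<open>For \<open>x \<le> 1\<close> and a variable that is at least 1 the set below is not bounded below and the
  real infimum is a junk value; only large \<open>x\<close> matter. A regularly varying tail never vanishes
  (as \<open>z / 0 = 0\<close>), so the division is harmless.\<close>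

definition tail_quantile :: "(real \<Rightarrow> real) \<Rightarrow> real \<Rightarrow> real"
  where "tail_quantile F x = Inf {y. 1 / F y \<ge> x}"

end

theory Submission
  imports Defs "HOL-Real_Asymp.Real_Asymp"
begin

text \<open>
  For \<open>f\<close> vanishing outside the box, the eigenvalue is the minimum of
  \<open>E(f) / \<Sum>\<^sub>x \<tau>\<^sub>x f(x)\<^sup>2\<close>, where \<open>E(f)\<close> sums \<open>\<tau>\<^sub>x\<^sup>a \<tau>\<^sub>y\<^sup>a (f(x) - f(y))\<^sup>2\<close> over the edges.
  Two mechanisms compete for a small quotient: spreading over the whole box, which costs
  \<open>n\<^sup>-\<^sup>2\<close>, and sitting on the deepest trap, whose depth is of order \<open>h(n\<^sup>d)\<close> and around which
  the energy is of order \<open>1/n\<close>, \<open>1/ln n\<close> or \<open>1\<close> in dimension 1, 2 or at least 3. The theorem says that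
  the cheaper of the two gives the right order (for \<open>d = 2\<close> and \<open>a > 0\<close> up to a factor \<open>ln n\<close>).

  \<^emph>\<open>Lower bounds.\<close> As \<open>\<tau> \<ge> 1\<close>, the energy dominates that of simple random walk, so all \<open>a\<close>
  can be treated together. Barta's method (\<open>barta_lower_bound\<close>) gives \<open>1 / max u\<close> as a lower bound for every
  \<open>u > 0\<close> with \<open>- \<Delta> u \<ge> \<tau>\<close> on the box. Such a \<open>u\<close> is the potential
  \<open>\<Sum>\<^sub>y \<tau>\<^sub>y v(x - y)\<close> of an explicit function \<open>v\<close> with \<open>- \<Delta> v \<ge> 1\<^sub>0\<close>, which replaces the
  Green function of the box (\<open>exists_green_majorant\<close>); only \<open>max v\<close>, of order \<open>n\<close>, \<open>ln n\<close> or \<open>1\<close>, and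
  \<open>\<Sum> v\<close>, of order \<open>n\<^sup>2\<close>, matter. For \<open>\<alpha> < 1\<close> the total depth of the box is dominated by its
  deepest traps and is of order \<open>h(n\<^sup>d)\<close>, which bounds the potential in probability. For the almost sure
  statements the traps are truncated slightly above their typical maximum; the potential at a point
  is then a sum of bounded independent variables, and an exponential Markov inequality is strong
  enough for a union bound over all points of the box (\<open>eigenvalue_lower_prob\<close>). Since the
  eigenvalue decreases in \<open>n\<close>, Borel-Cantelli is only needed along the powers of 2.

  \<^emph>\<open>Upper bounds.\<close> All test functions are functions of the distance to a point in the maximum norm.
  (i) In dimension at least 2, the indicator of a ball of radius 1 around a deep trap: the trap
  does not enter the energy at all, and among the many deep traps one can choose one with shallow
  surroundings. (ii) A function equal to 1 on half of the box which decreases only across shells of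
  typical conductance. Such shells have positive density, so the energy is of order \<open>n\<^sup>d\<^sup>-\<^sup>2\<close>. This is
  used for the diffusive bound, and together with the deepest trap in dimension 1.
  (iii) For \<open>d = 2\<close>, \<open>a = 0\<close>, a logarithmic profile around the deepest trap.
\<close>

section \<open>The lattice and the maximum norm\<close>

definition sup_norm :: "int ^ 'd \<Rightarrow> nat" where
  "sup_norm x = Max (range (\<lambda>i. nat \<bar>x $ i\<bar>))"

lemma sup_norm_le_iff: "sup_norm x \<le> n \<longleftrightarrow> (\<forall>i. \<bar>x $ i\<bar> \<le> int n)"
  unfolding sup_norm_def by (subst Max_le_iff) (auto simp: nat_le_iff)

lemma component_le_sup_norm: "\<bar>x $ i\<bar> \<le> int (sup_norm x)"
  using sup_norm_le_iff by blast

lemma sup_norm_attained: "\<exists>i. \<bar>x $ i\<bar> = int (sup_norm x)"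
proof -
  have "sup_norm x \<in> range (\<lambda>i. nat \<bar>x $ i\<bar>)"
    unfolding sup_norm_def by (rule Max_in) auto
  then show ?thesis by auto
qed

lemma sup_norm_eq_0_iff [simp]: "sup_norm x = 0 \<longleftrightarrow> x = 0"
  using sup_norm_le_iff[of x 0] by (auto simp: vec_eq_iff)

lemma lattice_box_iff: "x \<in> lattice_box n \<longleftrightarrow> sup_norm x \<le> n"
  unfolding lattice_box_def sup_norm_le_iff by (auto simp: abs_le_iff) (metis minus_le_iff)+

lemma lattice_box_mono: "m \<le> n \<Longrightarrow> lattice_box m \<subseteq> lattice_box n"
  by (auto simp: lattice_box_iff)

lemma sup_norm_diff_le: "sup_norm (x - y) \<le> sup_norm x + sup_norm y"
  unfolding sup_norm_le_iff
proof
  fix i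
  show "\<bar>(x - y) $ i\<bar> \<le> int (sup_norm x + sup_norm y)"
    using component_le_sup_norm[of x i] component_le_sup_norm[of y i] by simp
qed

lemma sup_norm_add_le: "sup_norm (x + y) \<le> sup_norm x + sup_norm y"
  unfolding sup_norm_le_iff
proof
  fix i
  show "\<bar>(x + y) $ i\<bar> \<le> int (sup_norm x + sup_norm y)"
    using component_le_sup_norm[of x i] component_le_sup_norm[of y i] by simp
qed

lemma nearest_nbr_sym: "x \<sim>\<^sub>Z y \<longleftrightarrow> y \<sim>\<^sub>Z x"
proof -
  have "(\<chi> i. real_of_int (x $ i - y $ i)) = - (\<chi> i. real_of_int (y $ i - x $ i))"
    by (simp add: vec_eq_iff)
  then have "norm (\<chi> i. real_of_int (x $ i - y $ i)) = norm (\<chi> i. real_of_int (y $ i - x $ i))"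
    by (simp only: norm_minus_cancel)
  then show ?thesis unfolding nearest_nbr_def by simp
qed

lemma nearest_nbr_iff: "y \<sim>\<^sub>Z x \<longleftrightarrow> (\<exists>i. y = x + axis i 1 \<or> y = x - axis i 1)"
proof
  assume "y \<sim>\<^sub>Z x"
  then have "norm (\<chi> i. real_of_int (y $ i - x $ i)) = 1" by (simp add: nearest_nbr_def)
  then have "(\<Sum>i\<in>UNIV. (real_of_int (y $ i - x $ i))\<^sup>2) = 1"
    by (simp add: norm_eq_1 inner_vec_def power2_eq_square)
  then have "real_of_int (\<Sum>i\<in>UNIV. (y $ i - x $ i)\<^sup>2) = real_of_int 1"
    by simp
  then have s: "(\<Sum>i\<in>UNIV. (y $ i - x $ i)\<^sup>2) = 1" by (simp only: of_int_eq_iff)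
  obtain i where i: "y $ i - x $ i \<noteq> 0"
  proof (rule ccontr)
    assume "\<not> thesis"
    then have "\<And>i. y $ i - x $ i = 0" using that by blast
    then show False using s by simp
  qed
  have "(y $ i - x $ i)\<^sup>2 + (\<Sum>j\<in>UNIV - {i}. (y $ j - x $ j)\<^sup>2) = 1"
    using s by (subst (asm) sum.remove[of _ i]) auto
  moreover have "(\<Sum>j\<in>UNIV - {i}. (y $ j - x $ j)\<^sup>2) \<ge> 0" by (intro sum_nonneg) auto
  moreover have "(y $ i - x $ i)\<^sup>2 \<ge> 1" using i by (simp add: int_one_le_iff_zero_less)
  ultimately have 1: "(y $ i - x $ i)\<^sup>2 = 1" and 2: "(\<Sum>j\<in>UNIV - {i}. (y $ j - x $ j)\<^sup>2) = 0"
    by linarith+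
  have o: "y $ j = x $ j" if "j \<noteq> i" for j
    using 2 that by (subst (asm) sum_nonneg_eq_0_iff) auto
  have "y $ i - x $ i = 1 \<or> y $ i - x $ i = -1" using 1 power2_eq_1_iff by blast
  then have "y = x + axis i 1 \<or> y = x - axis i 1"
    using o by (auto simp: vec_eq_iff axis_def)
  then show "\<exists>i. y = x + axis i 1 \<or> y = x - axis i 1" by blast
next
  assume "\<exists>i. y = x + axis i 1 \<or> y = x - axis i 1"
  then obtain i where i: "y = x + axis i 1 \<or> y = x - axis i 1" by blast
  define s :: int where "s = (if y = x + axis i 1 then 1 else -1)"
  have s: "y = x + axis i s" "s = 1 \<or> s = -1"
    using i by (auto simp: s_def vec_eq_iff axis_def)
  have "(\<chi> j. real_of_int (y $ j - x $ j)) = axis i (real_of_int s)"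
    using s by (auto simp: vec_eq_iff axis_def)
  then show "y \<sim>\<^sub>Z x" using s unfolding nearest_nbr_def by (auto simp: norm_eq_1 inner_axis_axis)
qed

lemma nearest_nbr_set:
  "{y. y \<sim>\<^sub>Z x} = range (\<lambda>i. x + axis i 1) \<union> range (\<lambda>i. x - axis i 1)"
  by (auto simp: nearest_nbr_iff)

text \<open>Writing sums over neighbours as sums over coordinate directions makes translation invariance of
  the lattice immediate and lets the discrete Laplacian of a radial function be computed coordinate
  by coordinate.\<close>

lemma sum_nearest_nbr:
  fixes g :: "int ^ 'd \<Rightarrow> 'b::comm_monoid_add"
  shows "(\<Sum>y | y \<sim>\<^sub>Z x. g y) = (\<Sum>i\<in>UNIV. g (x + axis i 1) + g (x - axis i 1))"
proof -
  have inj1: "inj (\<lambda>i. x + axis i (1::int))"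
    by (rule injI) (simp add: axis_eq_axis)
  have inj2: "inj (\<lambda>i. x - axis i (1::int))"
    by (rule injI) (simp add: axis_eq_axis)
  have "x + axis i 1 \<noteq> x - axis j (1::int)" for i j
  proof
    assume "x + axis i 1 = x - axis j (1::int)"
    then have "(x + axis i 1) $ i = (x - axis j (1::int)) $ i" by simp
    then show False by (simp add: axis_def split: if_splits)
  qed
  then have disj: "range (\<lambda>i. x + axis i (1::int)) \<inter> range (\<lambda>i. x - axis i 1) = {}" by blast
  show ?thesis
    unfolding nearest_nbr_set
    by (subst sum.union_disjoint) (use disj inj1 inj2 in \<open>auto simp: sum.reindex sum.distrib\<close>)
qed

lemma card_nearest_nbr: "card {y. y \<sim>\<^sub>Z (x :: int ^ 'd)} = 2 * CARD('d)"
  using sum_nearest_nbr[of "\<lambda>_. 1::nat" x] by simp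

lemma sup_norm_nearest_nbr:
  assumes "y \<sim>\<^sub>Z x" shows "sup_norm y \<le> Suc (sup_norm x)"
proof -
  have "sup_norm (axis i (1::int)) \<le> 1" for i :: 'a
    unfolding sup_norm_le_iff by (auto simp: axis_def)
  then show ?thesis
    using assms sup_norm_add_le sup_norm_diff_le unfolding nearest_nbr_iff
    by (metis add.commute add_le_cancel_left le_trans plus_1_eq_Suc)
qed

lemma card_vec_box:
  fixes S :: "'d::finite \<Rightarrow> int set"
  assumes "\<And>i. finite (S i)"
  shows "finite {x :: int ^ 'd. \<forall>i. x $ i \<in> S i}"
    and "card {x :: int ^ 'd. \<forall>i. x $ i \<in> S i} = (\<Prod>i\<in>UNIV. card (S i))"
proof -
  have eq: "{x :: int ^ 'd. \<forall>i. x $ i \<in> S i} = vec_lambda ` (PiE UNIV S)"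
  proof (intro set_eqI iffI)
    fix x :: "int ^ 'd" assume "x \<in> {x. \<forall>i. x $ i \<in> S i}"
    then have "vec_nth x \<in> PiE UNIV S" by auto
    then show "x \<in> vec_lambda ` (PiE UNIV S)" by (metis image_eqI vec_nth_inverse)
  qed auto
  have inj: "inj_on vec_lambda (PiE UNIV S)"
    by (rule inj_onI) (metis vec_lambda_inverse UNIV_I)
  show "finite {x :: int ^ 'd. \<forall>i. x $ i \<in> S i}"
    unfolding eq by (intro finite_imageI finite_PiE) (auto simp: assms)
  show "card {x :: int ^ 'd. \<forall>i. x $ i \<in> S i} = (\<Prod>i\<in>UNIV. card (S i))"
    unfolding eq by (simp add: card_image[OF inj] card_PiE)
qed

lemma finite_lattice_box [simp]: "finite (lattice_box n)"
  unfolding lattice_box_def by (rule card_vec_box) auto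

lemma card_lattice_box: "card (lattice_box n :: (int ^ 'd) set) = (2 * n + 1) ^ CARD('d)"
proof -
  have "nat (1 + int n + int n) = 2 * n + 1" by simp
  then show ?thesis
    unfolding lattice_box_def by (subst card_vec_box) (auto simp: prod_constant)
qed

text \<open>Some coordinate of a point of the sphere is \<open>\<plusminus> k\<close>, and the others are free in a box of one
  dimension less.\<close>

lemma card_sphere_le:
  shows "finite {x :: int ^ 'd. sup_norm x = k}"
    and "card {x :: int ^ 'd. sup_norm x = k} \<le> 2 * CARD('d) * (2 * k + 1) ^ (CARD('d) - 1)"
proof -
  define S where "S i s = {x :: int ^ 'd. \<forall>j. x $ j \<in> (if j = i then {s} else {- int k..int k})}"
    for i s
  have fin: "finite (S i s)" for i s
    unfolding S_def by (rule card_vec_box) auto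
  have card: "card (S i s) = (2 * k + 1) ^ (CARD('d) - 1)" for i s
  proof -
    have "card (S i s) = (\<Prod>j\<in>UNIV. card (if j = i then {s} else {- int k..int k}))"
      unfolding S_def by (rule card_vec_box) auto
    also have "\<dots> = (\<Prod>j\<in>UNIV - {i}. card (if j = i then {s} else {- int k..int k}))"
      by (subst prod.remove[of _ i]) auto
    also have "\<dots> = (\<Prod>j\<in>UNIV - {i}. 2 * k + 1)" by (intro prod.cong) auto
    finally show ?thesis by (simp add: card_Diff_singleton)
  qed
  have sub: "{x :: int ^ 'd. sup_norm x = k} \<subseteq> (\<Union>i. \<Union>s\<in>{int k, - int k}. S i s)"
  proof
    fix x :: "int ^ 'd" assume "x \<in> {x. sup_norm x = k}"
    then have k: "sup_norm x = k" by simp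
    obtain i where i: "\<bar>x $ i\<bar> = int k" using sup_norm_attained[of x] k by auto
    have j: "x $ j \<in> {- int k..int k}" for j
      using component_le_sup_norm[of x j] k by auto
    have "x \<in> S i (x $ i)" unfolding S_def using j by auto
    moreover have "x $ i \<in> {int k, - int k}" using i by auto
    ultimately show "x \<in> (\<Union>i. \<Union>s\<in>{int k, - int k}. S i s)" by blast
  qed
  show "finite {x :: int ^ 'd. sup_norm x = k}" by (rule finite_subset[OF sub]) (auto simp: fin)
  have "card {x :: int ^ 'd. sup_norm x = k} \<le> card (\<Union>i. \<Union>s\<in>{int k, - int k}. S i s)"
    by (rule card_mono[OF _ sub]) (auto simp: fin)
  also have "\<dots> \<le> (\<Sum>i\<in>UNIV. card (\<Union>s\<in>{int k, - int k}. S i s))"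
    by (rule card_UN_le) auto
  also have "\<dots> \<le> (\<Sum>i\<in>(UNIV::'d set). \<Sum>s\<in>{int k, - int k}. card (S i s))"
    by (intro sum_mono card_UN_le) auto
  also have "\<dots> \<le> (\<Sum>i\<in>(UNIV::'d set). 2 * (2 * k + 1) ^ (CARD('d) - 1))"
  proof (rule sum_mono)
    fix i :: 'd
    have "card {int k, - int k} \<le> 2" by (simp add: card_insert_if)
    then show "(\<Sum>s\<in>{int k, - int k}. card (S i s)) \<le> 2 * (2 * k + 1) ^ (CARD('d) - 1)"
      by (simp only: card sum_constant) (simp add: mult_right_mono)
  qed
  finally show "card {x :: int ^ 'd. sup_norm x = k} \<le> 2 * CARD('d) * (2 * k + 1) ^ (CARD('d) - 1)"
    by simp
qed

section \<open>The variational principle\<close>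

text \<open>Ordered pairs, so that every edge occurs twice; this makes the summation by parts below a mere
  exchange of the two endpoints.\<close>

definition box_edges :: "nat \<Rightarrow> ((int ^ 'd) \<times> (int ^ 'd)) set" where
  "box_edges n = {(x, y). y \<sim>\<^sub>Z x \<and> (x \<in> lattice_box n \<or> y \<in> lattice_box n)}"

definition conductance :: "real \<Rightarrow> (int ^ 'd \<Rightarrow> real) \<Rightarrow> int ^ 'd \<Rightarrow> int ^ 'd \<Rightarrow> real" where
  "conductance a \<tau> x y = \<tau> x powr a * \<tau> y powr a"

definition dirichlet_form ::
    "real \<Rightarrow> (int ^ 'd \<Rightarrow> real) \<Rightarrow> nat \<Rightarrow> (int ^ 'd \<Rightarrow> real) \<Rightarrow> (int ^ 'd \<Rightarrow> real) \<Rightarrow> real" where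
  "dirichlet_form a \<tau> n f g =
    (\<Sum>(x, y)\<in>box_edges n. conductance a \<tau> x y * ((f x - f y) * (g x - g y))) / 2"

abbreviation dirichlet_energy ::
    "real \<Rightarrow> (int ^ 'd \<Rightarrow> real) \<Rightarrow> nat \<Rightarrow> (int ^ 'd \<Rightarrow> real) \<Rightarrow> real" where
  "dirichlet_energy a \<tau> n f \<equiv> dirichlet_form a \<tau> n f f"

text \<open>The absolute value makes the variational principle valid for every environment without zeros,
  because \<open>powr\<close> depends only on the modulus of its base. Environments outside the almost sure event
  where \<open>\<tau> \<ge> 1\<close> have to be covered for measurability.\<close>

definition trap_mass :: "(int ^ 'd \<Rightarrow> real) \<Rightarrow> nat \<Rightarrow> (int ^ 'd \<Rightarrow> real) \<Rightarrow> real" where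
  "trap_mass \<tau> n f = (\<Sum>x\<in>lattice_box n. \<bar>\<tau> x\<bar> * (f x)\<^sup>2)"

definition supported_in_box :: "nat \<Rightarrow> (int ^ 'd \<Rightarrow> real) \<Rightarrow> bool" where
  "supported_in_box n f \<longleftrightarrow> (\<forall>x. x \<notin> lattice_box n \<longrightarrow> f x = 0)"

lemma conductance_nonneg [simp]: "0 \<le> conductance a \<tau> x y"
  by (simp add: conductance_def)

lemma conductance_commute: "conductance a \<tau> x y = conductance a \<tau> y x"
  by (simp add: conductance_def mult.commute)

lemma finite_box_edges [simp]: "finite (box_edges n :: ((int ^ 'd) \<times> (int ^ 'd)) set)"
proof (rule finite_subset)
  show "(box_edges n :: ((int ^ 'd) \<times> (int ^ 'd)) set) \<subseteq> lattice_box (Suc n) \<times> lattice_box (Suc n)"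
  proof
    fix p :: "(int ^ 'd) \<times> (int ^ 'd)"
    assume p: "p \<in> box_edges n"
    obtain x y where xy: "p = (x, y)" by (cases p)
    then have e: "y \<sim>\<^sub>Z x" "x \<sim>\<^sub>Z y" "x \<in> lattice_box n \<or> y \<in> lattice_box n"
      using p nearest_nbr_sym[of x y] by (auto simp: box_edges_def)
    then show "p \<in> lattice_box (Suc n) \<times> lattice_box (Suc n)"
      using sup_norm_nearest_nbr[OF e(1)] sup_norm_nearest_nbr[OF e(2)]
      unfolding xy mem_Times_iff lattice_box_iff by auto
  qed
qed auto

lemma sum_box_edges_swap:
  fixes h :: "int ^ 'd \<Rightarrow> int ^ 'd \<Rightarrow> 'b::comm_monoid_add"
  shows "(\<Sum>(x, y)\<in>box_edges n. h x y) = (\<Sum>(x, y)\<in>box_edges n. h y x)"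
  by (rule sum.reindex_bij_witness[of _ prod.swap prod.swap])
     (auto simp: box_edges_def nearest_nbr_sym)

lemma sum_box_edges:
  fixes h :: "int ^ 'd \<Rightarrow> int ^ 'd \<Rightarrow> 'b::comm_monoid_add"
  assumes "\<And>x y. x \<notin> lattice_box n \<Longrightarrow> h x y = 0"
  shows "(\<Sum>(x, y)\<in>box_edges n. h x y) = (\<Sum>x\<in>lattice_box n. \<Sum>y | y \<sim>\<^sub>Z x. h x y)"
proof -
  have "(\<Sum>x\<in>lattice_box n. \<Sum>y | y \<sim>\<^sub>Z x. h x y)
      = (\<Sum>(x, y)\<in>Sigma (lattice_box n) (\<lambda>x. {y. y \<sim>\<^sub>Z x}). h x y)"
    by (rule sum.Sigma) (auto simp: finite_nearest_nbr)
  also have "\<dots> = (\<Sum>(x, y)\<in>box_edges n. h x y)"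
  proof (rule sum.mono_neutral_left)
    show "Sigma (lattice_box n) (\<lambda>x. {y. y \<sim>\<^sub>Z x}) \<subseteq> box_edges n" by (auto simp: box_edges_def)
    show "\<forall>p\<in>box_edges n - Sigma (lattice_box n) (\<lambda>x. {y. y \<sim>\<^sub>Z x}). (case p of (x, y) \<Rightarrow> h x y) = 0"
      using assms by (auto simp: box_edges_def)
  qed simp
  finally show ?thesis by simp
qed

text \<open>Both halves of \<open>(f(x) - f(y)) (g(x) - g(y))\<close> contribute equally, by exchanging \<open>x\<close> and \<open>y\<close>;
  the remaining factor \<open>g(x)\<close> restricts the sum to the box.\<close>

lemma dirichlet_form_by_parts:
  assumes g: "supported_in_box n g"
  shows "dirichlet_form a \<tau> n f g
    = (\<Sum>x\<in>lattice_box n. g x * (\<Sum>y | y \<sim>\<^sub>Z x. conductance a \<tau> x y * (f x - f y)))"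
proof -
  let ?c = "conductance a \<tau>"
  have "(\<Sum>(x, y)\<in>box_edges n. ?c x y * ((f x - f y) * (g x - g y)))
      = (\<Sum>(x, y)\<in>box_edges n. ?c x y * (f x - f y) * g x)
        + (\<Sum>(x, y)\<in>box_edges n. ?c x y * (f y - f x) * g y)"
    unfolding sum.distrib[symmetric] by (rule sum.cong) (auto simp: algebra_simps)
  also have "(\<Sum>(x, y)\<in>box_edges n. ?c x y * (f y - f x) * g y)
      = (\<Sum>(x, y)\<in>box_edges n. ?c x y * (f x - f y) * g x)"
    by (subst sum_box_edges_swap) (simp add: conductance_commute)
  finally have "dirichlet_form a \<tau> n f g = (\<Sum>(x, y)\<in>box_edges n. ?c x y * (f x - f y) * g x)"
    unfolding dirichlet_form_def by simp
  also have "\<dots> = (\<Sum>x\<in>lattice_box n. \<Sum>y | y \<sim>\<^sub>Z x. ?c x y * (f x - f y) * g x)"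
    by (rule sum_box_edges) (use g in \<open>auto simp: supported_in_box_def\<close>)
  also have "\<dots> = (\<Sum>x\<in>lattice_box n. g x * (\<Sum>y | y \<sim>\<^sub>Z x. ?c x y * (f x - f y)))"
    by (simp add: sum_distrib_left mult.commute)
  finally show ?thesis .
qed

lemma dirichlet_energy_nonneg: "0 \<le> dirichlet_energy a \<tau> n f"
  unfolding dirichlet_form_def by (auto intro!: sum_nonneg divide_nonneg_nonneg)

lemma dirichlet_energy_add:
  "dirichlet_energy a \<tau> n (\<lambda>x. f x + t * g x)
    = dirichlet_energy a \<tau> n f + 2 * t * dirichlet_form a \<tau> n f g + t\<^sup>2 * dirichlet_energy a \<tau> n g"
proof -
  let ?c = "conductance a \<tau>"
  have "(\<Sum>(x, y)\<in>box_edges n. ?c x y * ((f x + t * g x - (f y + t * g y)) * (f x + t * g x - (f y + t * g y))))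
    = (\<Sum>(x, y)\<in>box_edges n. ?c x y * ((f x - f y) * (f x - f y)))
      + 2 * t * (\<Sum>(x, y)\<in>box_edges n. ?c x y * ((f x - f y) * (g x - g y)))
      + t\<^sup>2 * (\<Sum>(x, y)\<in>box_edges n. ?c x y * ((g x - g y) * (g x - g y)))"
    unfolding sum_distrib_left sum.distrib[symmetric]
    by (rule sum.cong) (auto simp: algebra_simps power2_eq_square)
  then show ?thesis unfolding dirichlet_form_def by simp
qed

lemma trap_mass_nonneg: "0 \<le> trap_mass \<tau> n f"
  unfolding trap_mass_def by (auto intro!: sum_nonneg)

lemma trap_mass_pos:
  assumes "x \<in> lattice_box n" "\<tau> x \<noteq> 0" "f x \<noteq> 0"
  shows "0 < trap_mass \<tau> n f"
  unfolding trap_mass_def by (rule sum_pos2[of _ x]) (use assms in auto)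

lemma powr_weight: "t powr a = \<bar>t\<bar> * t powr (- (1 - a))" for t a :: real
proof (cases "t = 0")
  case False
  have "t powr a = \<bar>t\<bar> powr a" "t powr (- (1 - a)) = \<bar>t\<bar> powr (a - 1)"
    by (cases "t > 0"; simp add: uminus_powr_eq)+
  then show ?thesis using False by (simp add: powr_mult_base)
qed auto

text \<open>Multiplication by the reversible measure symmetrises the generator:
  \<open>\<tau>\<^sub>x \<tau>\<^sub>x\<^sup>-\<^sup>(\<^sup>1\<^sup>-\<^sup>a\<^sup>) = \<tau>\<^sub>x\<^sup>a\<close>.\<close>

lemma neg_generator_eq:
  "\<bar>\<tau> x\<bar> * - generator a \<tau> f x = (\<Sum>y | y \<sim>\<^sub>Z x. conductance a \<tau> x y * (f x - f y))"
  unfolding generator_def conductance_def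
  by (subst (2) powr_weight) (simp add: sum_distrib_left sum_negf[symmetric] algebra_simps sum_subtractf)

lemma eigenfunction_equation:
  assumes "\<forall>x. - dirichlet_generator a \<tau> n f x = \<mu> * f x" "x \<in> lattice_box n"
  shows "(\<Sum>y | y \<sim>\<^sub>Z x. conductance a \<tau> x y * (f x - f y)) = \<mu> * (\<bar>\<tau> x\<bar> * f x)"
proof -
  have "- generator a \<tau> f x = \<mu> * f x"
    using assms(1)[rule_format, of x] assms(2) by (simp add: dirichlet_generator_def)
  then show ?thesis using neg_generator_eq[of \<tau> x a f] by (simp add: mult.left_commute)
qed

lemma eigenfunction_energy:
  assumes "\<forall>x. - dirichlet_generator a \<tau> n f x = \<mu> * f x" "supported_in_box n f"
  shows "dirichlet_energy a \<tau> n f = \<mu> * trap_mass \<tau> n f"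
proof -
  have "dirichlet_energy a \<tau> n f = (\<Sum>x\<in>lattice_box n. f x * (\<mu> * (\<bar>\<tau> x\<bar> * f x)))"
    unfolding dirichlet_form_by_parts[OF assms(2)]
    by (rule sum.cong) (auto simp: eigenfunction_equation[OF assms(1)])
  then show ?thesis
    by (simp add: trap_mass_def sum_distrib_left power2_eq_square algebra_simps)
qed

lemma quadratic_nonneg_imp_linear_0:
  fixes b c :: real
  assumes "\<And>t. 0 \<le> t * b + t\<^sup>2 * c"
  shows "b = 0"
proof (rule ccontr)
  assume b: "b \<noteq> 0"
  obtain u :: real where u: "0 < u" "c \<le> u" using gt_ex[of "max 0 c"] by auto
  define t where "t = - b / (2 * u)"
  have "t * b + t\<^sup>2 * c \<le> t * b + t\<^sup>2 * u"
    using u by (intro add_left_mono mult_left_mono) auto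
  also have "\<dots> = - b\<^sup>2 / (4 * u)"
    unfolding t_def using u by (simp add: power2_eq_square field_simps)
  also have "\<dots> < 0" using b u by (simp add: divide_neg_pos)
  finally show False using assms[of t] by simp
qed

text \<open>Functions on the finite box with \<open>\<Sum> f(x)\<^sup>2 = 1\<close> form a compact set in the product topology, on
  which the Rayleigh quotient is continuous; homogeneity extends the minimum to all functions.\<close>

lemma exists_rayleigh_minimiser:
  fixes \<tau> :: "int ^ 'd \<Rightarrow> real"
  assumes nz: "\<forall>x\<in>lattice_box n. \<tau> x \<noteq> 0"
  obtains f \<mu> where "supported_in_box n f" "\<exists>x. f x \<noteq> 0"
    "dirichlet_energy a \<tau> n f = \<mu> * trap_mass \<tau> n f"
    "\<And>g. supported_in_box n g \<Longrightarrow> \<mu> * trap_mass \<tau> n g \<le> dirichlet_energy a \<tau> n g"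
proof -
  define B :: "(int ^ 'd) set" where "B = lattice_box n"
  define S where "S = (\<lambda>x. if x \<in> B then {-1..1::real} else {0})"
  define K where "K = PiE UNIV S"
  define N where "N f = (\<Sum>x\<in>B. (f x)\<^sup>2)" for f :: "int ^ 'd \<Rightarrow> real"
  have [simp]: "finite B" by (simp add: B_def)
  have "compactin (product_topology (\<lambda>i. euclidean) UNIV) K"
    unfolding K_def by (subst compactin_PiE) (auto simp: S_def)
  then have K: "compact K" by (simp add: euclidean_product_topology)
  have contN: "continuous_on UNIV N"
    unfolding N_def by (intro continuous_intros continuous_on_product_coordinates)
  have contE: "continuous_on UNIV (dirichlet_energy a \<tau> n)"
    unfolding dirichlet_form_def case_prod_unfold
    by (intro continuous_intros continuous_on_product_coordinates) auto
  have contM: "continuous_on UNIV (trap_mass \<tau> n)"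
    unfolding trap_mass_def by (intro continuous_intros continuous_on_product_coordinates)
  define T where "T = K \<inter> {f. N f = 1}"
  have "closed {f. N f = 1}" using contN by (intro closed_Collect_eq) auto
  then have T: "compact T" unfolding T_def using K by (simp add: compact_Int_closed)
  have Tsupp: "supported_in_box n f" if "f \<in> T" for f
  proof -
    have "f \<in> PiE UNIV S" using that by (simp add: T_def K_def)
    then have "f x \<in> S x" for x by (rule PiE_mem) simp
    then have "f x = 0" if "x \<notin> B" for x using that by (metis S_def singletonD)
    then show ?thesis by (simp add: supported_in_box_def B_def)
  qed
  have posM: "0 < trap_mass \<tau> n f" if "supported_in_box n f" "f x \<noteq> 0" for f x
    using that nz trap_mass_pos[of x n \<tau> f] unfolding supported_in_box_def by blast
  have Tpos: "0 < trap_mass \<tau> n f" if "f \<in> T" for f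
  proof -
    have "N f \<noteq> 0" using that by (simp add: T_def)
    then obtain x where x: "f x \<noteq> 0" by (cases "\<forall>x. f x = 0") (auto simp: N_def)
    show ?thesis by (rule posM[OF Tsupp[OF that] x])
  qed
  define R where "R f = dirichlet_energy a \<tau> n f / trap_mass \<tau> n f" for f
  have contR: "continuous_on T R"
    unfolding R_def using contE contM Tpos
    by (intro continuous_on_divide) (auto intro: continuous_on_subset simp: less_le)
  \<comment> \<open>the Rayleigh quotient is invariant under scaling, so every function can be normalised into \<open>T\<close>\<close>
  have scaleE: "dirichlet_energy a \<tau> n (\<lambda>x. c * f x) = c\<^sup>2 * dirichlet_energy a \<tau> n f" for f c
    unfolding dirichlet_form_def case_prod_unfold
    by (simp add: sum_distrib_left algebra_simps power2_eq_square)
  have scaleM: "trap_mass \<tau> n (\<lambda>x. c * f x) = c\<^sup>2 * trap_mass \<tau> n f" for f c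
    unfolding trap_mass_def by (simp add: sum_distrib_left power_mult_distrib algebra_simps)
  have normalise: "\<exists>c. c \<noteq> 0 \<and> (\<lambda>x. c * f x) \<in> T" if f: "supported_in_box n f" "f x \<noteq> 0" for f x
  proof -
    have xB: "x \<in> B" using f by (auto simp: supported_in_box_def B_def)
    have Np: "N f > 0" unfolding N_def by (rule sum_pos2[of _ x]) (use xB f in auto)
    define c where "c = 1 / sqrt (N f)"
    have c: "c > 0" "c\<^sup>2 = 1 / N f" using Np by (auto simp: c_def power_divide)
    have "N (\<lambda>x. c * f x) = c\<^sup>2 * N f" by (simp add: N_def power_mult_distrib sum_distrib_left)
    then have Nc: "N (\<lambda>x. c * f x) = 1" using Np c by simp
    have "c * f y \<in> S y" for y
    proof (cases "y \<in> B")
      case True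
      have "(c * f y)\<^sup>2 \<le> N (\<lambda>x. c * f x)"
        unfolding N_def by (rule member_le_sum[OF True]) auto
      then have "\<bar>c * f y\<bar> \<le> 1" using Nc by (simp add: abs_square_le_1)
      then show ?thesis using True by (auto simp: S_def abs_le_iff)
    next
      case False
      then show ?thesis using f by (auto simp: S_def supported_in_box_def B_def)
    qed
    then have "(\<lambda>x. c * f x) \<in> T" using Nc by (auto simp: T_def K_def PiE_def)
    then show ?thesis using c by (intro exI[of _ c]) auto
  qed
  have "T \<noteq> {}"
  proof -
    have "(0 :: int ^ 'd) \<in> lattice_box n" by (simp add: lattice_box_def)
    then have "supported_in_box n (\<lambda>x :: int ^ 'd. if x = 0 then 1 else 0)"
      by (auto simp: supported_in_box_def)
    from normalise[OF this, of 0] show ?thesis by auto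
  qed
  with continuous_attains_inf[OF T _ contR] obtain f where f: "f \<in> T" "\<And>g. g \<in> T \<Longrightarrow> R f \<le> R g"
    by blast
  show ?thesis
  proof (rule that[of f "R f"])
    show "supported_in_box n f" by (rule Tsupp[OF f(1)])
    show "\<exists>x. f x \<noteq> 0"
    proof (rule ccontr)
      assume "\<not> ?thesis"
      then have "N f = 0" by (simp add: N_def)
      then show False using f(1) by (simp add: T_def)
    qed
    show "dirichlet_energy a \<tau> n f = R f * trap_mass \<tau> n f"
      using Tpos[OF f(1)] by (simp add: R_def)
  next
    fix g :: "int ^ 'd \<Rightarrow> real" assume g: "supported_in_box n g"
    show "R f * trap_mass \<tau> n g \<le> dirichlet_energy a \<tau> n g"
    proof (cases "\<exists>x. g x \<noteq> 0")
      case True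
      then obtain x where x: "g x \<noteq> 0" by blast
      obtain c where c: "c \<noteq> 0" "(\<lambda>x. c * g x) \<in> T" using normalise[OF g x] by blast
      have "R f \<le> R (\<lambda>x. c * g x)" by (rule f(2)[OF c(2)])
      also have "\<dots> = R g" unfolding R_def scaleE scaleM using c(1) by simp
      finally show ?thesis using posM[OF g x] by (simp add: R_def pos_le_divide_eq)
    next
      case False
      then have "g = (\<lambda>x. 0)" by auto
      then show ?thesis by (simp add: trap_mass_def dirichlet_form_def)
    qed
  qed
qed

lemma trap_mass_add_delta:
  assumes "z \<in> lattice_box n"
  shows "trap_mass \<tau> n (\<lambda>x. f x + t * (if x = z then 1 else 0))
    = trap_mass \<tau> n f + 2 * t * (\<bar>\<tau> z\<bar> * f z) + t\<^sup>2 * \<bar>\<tau> z\<bar>"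
proof -
  have "trap_mass \<tau> n (\<lambda>x. f x + t * (if x = z then 1 else 0))
      = (\<Sum>x\<in>lattice_box n. \<bar>\<tau> x\<bar> * (f x)\<^sup>2
          + (if x = z then 2 * t * (\<bar>\<tau> x\<bar> * f x) + t\<^sup>2 * \<bar>\<tau> x\<bar> else 0))"
    unfolding trap_mass_def by (rule sum.cong) (auto simp: power2_eq_square algebra_simps)
  then show ?thesis using assms by (simp add: sum.distrib sum.delta trap_mass_def)
qed

text \<open>A minimiser of the Rayleigh quotient solves the eigenvalue equation, by the first variation in the
  direction of the unit mass at each point \<open>z\<close> of the box. Conversely every eigenvalue is the
  Rayleigh quotient of its eigenfunction, so the minimum is the least eigenvalue.\<close>

theorem principal_eigenvalue_rayleigh:
  fixes \<tau> :: "int ^ 'd \<Rightarrow> real"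
  assumes nz: "\<forall>x\<in>lattice_box n. \<tau> x \<noteq> 0"
  obtains f where "supported_in_box n f" "\<exists>x. f x \<noteq> 0" "0 < trap_mass \<tau> n f"
    "dirichlet_energy a \<tau> n f = principal_dirichlet_eigenvalue a \<tau> n * trap_mass \<tau> n f"
    "\<And>g. supported_in_box n g \<Longrightarrow>
       principal_dirichlet_eigenvalue a \<tau> n * trap_mass \<tau> n g \<le> dirichlet_energy a \<tau> n g"
proof -
  obtain f \<mu> where f: "supported_in_box n f" "\<exists>x. f x \<noteq> 0"
    and e: "dirichlet_energy a \<tau> n f = \<mu> * trap_mass \<tau> n f"
    and min: "\<And>g. supported_in_box n g \<Longrightarrow> \<mu> * trap_mass \<tau> n g \<le> dirichlet_energy a \<tau> n g"
    using exists_rayleigh_minimiser[OF nz] by blast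
  have posM: "0 < trap_mass \<tau> n g" if "supported_in_box n g" "\<exists>x. g x \<noteq> 0" for g
    using that nz trap_mass_pos[of _ n \<tau> g] unfolding supported_in_box_def by blast
  have eq: "(\<Sum>y | y \<sim>\<^sub>Z z. conductance a \<tau> z y * (f z - f y)) = \<mu> * (\<bar>\<tau> z\<bar> * f z)"
    if z: "z \<in> lattice_box n" for z
  proof -
    \<comment> \<open>first variation: the quotient of \<open>f + t \<delta>\<close> is smallest at \<open>t = 0\<close>\<close>
    define \<delta> where "\<delta> = (\<lambda>x. if x = z then 1 else 0 :: real)"
    have d: "supported_in_box n \<delta>" using z by (auto simp: supported_in_box_def \<delta>_def)
    let ?b = "2 * dirichlet_form a \<tau> n f \<delta> - 2 * \<mu> * (\<bar>\<tau> z\<bar> * f z)"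
    have "0 \<le> t * ?b + t\<^sup>2 * (dirichlet_energy a \<tau> n \<delta> - \<mu> * \<bar>\<tau> z\<bar>)" for t
    proof -
      have "supported_in_box n (\<lambda>x. f x + t * \<delta> x)"
        using f d by (auto simp: supported_in_box_def)
      from min[OF this]
      have "\<mu> * (trap_mass \<tau> n f + 2 * t * (\<bar>\<tau> z\<bar> * f z) + t\<^sup>2 * \<bar>\<tau> z\<bar>)
          \<le> dirichlet_energy a \<tau> n f + 2 * t * dirichlet_form a \<tau> n f \<delta> + t\<^sup>2 * dirichlet_energy a \<tau> n \<delta>"
        unfolding dirichlet_energy_add by (simp only: \<delta>_def trap_mass_add_delta[OF z])
      then show ?thesis using e by (simp add: algebra_simps)
    qed
    then have "?b = 0" by (rule quadratic_nonneg_imp_linear_0)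
    moreover have "dirichlet_form a \<tau> n f \<delta> = (\<Sum>x\<in>lattice_box n. if x = z then
        (\<Sum>y | y \<sim>\<^sub>Z x. conductance a \<tau> x y * (f x - f y)) else 0)"
      unfolding dirichlet_form_by_parts[OF d] by (rule sum.cong) (auto simp: \<delta>_def)
    ultimately show ?thesis using z by simp
  qed
  have eig: "neg_dirichlet_eigenvalue a \<tau> n \<mu>"
    unfolding neg_dirichlet_eigenvalue_def
  proof (rule exI[of _ f], intro conjI allI)
    show "\<exists>x. f x \<noteq> 0" by fact
    fix x
    show "x \<notin> lattice_box n \<longrightarrow> f x = 0" using f by (simp add: supported_in_box_def)
    show "- dirichlet_generator a \<tau> n f x = \<mu> * f x"
    proof (cases "x \<in> lattice_box n")
      case True
      have "\<bar>\<tau> x\<bar> * - generator a \<tau> f x = \<bar>\<tau> x\<bar> * (\<mu> * f x)"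
        unfolding neg_generator_eq eq[OF True] by simp
      then have "- generator a \<tau> f x = \<mu> * f x"
        using bspec[OF nz True] mult_left_cancel[of "\<bar>\<tau> x\<bar>"] abs_eq_0 by blast
      then show ?thesis using True by (simp add: dirichlet_generator_def)
    next
      case False
      then show ?thesis using f by (simp add: dirichlet_generator_def supported_in_box_def)
    qed
  qed
  have "principal_dirichlet_eigenvalue a \<tau> n = \<mu>"
    unfolding principal_dirichlet_eigenvalue_def
  proof (rule Least_equality[where P = "neg_dirichlet_eigenvalue a \<tau> n", OF eig])
    fix \<nu> assume "neg_dirichlet_eigenvalue a \<tau> n \<nu>"
    then obtain g where g: "\<exists>x. g x \<noteq> 0" "supported_in_box n g"
      "\<forall>x. - dirichlet_generator a \<tau> n g x = \<nu> * g x"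
      unfolding neg_dirichlet_eigenvalue_def supported_in_box_def by blast
    have "\<mu> * trap_mass \<tau> n g \<le> \<nu> * trap_mass \<tau> n g"
      using min[OF g(2)] eigenfunction_energy[OF g(3,2)] by simp
    then show "\<mu> \<le> \<nu>" using posM[OF g(2,1)] by simp
  qed
  then show ?thesis using that[OF f posM[OF f]] e min by simp
qed

text \<open>At a site with \<open>\<tau>\<^sub>z = 0\<close> all conductances of its edges vanish, so the unit mass at \<open>z\<close> is an eigenfunction for
  0, while the energy still excludes negative eigenvalues. Such environments have probability 0, but
  the measure space need not be complete, so the eigenvalue must be controlled there as well.\<close>

lemma principal_eigenvalue_zero:
  assumes z: "z \<in> lattice_box n" "\<tau> z = 0"
  shows "principal_dirichlet_eigenvalue a \<tau> n = 0"
  unfolding principal_dirichlet_eigenvalue_def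
proof (rule Least_equality)
  show "neg_dirichlet_eigenvalue a \<tau> n 0"
    unfolding neg_dirichlet_eigenvalue_def
  proof (rule exI[of _ "\<lambda>x. if x = z then 1 else 0 :: real"], intro conjI allI)
    let ?f = "\<lambda>x. if x = z then 1 else 0 :: real"
    show "\<exists>x. ?f x \<noteq> 0" by auto
    fix x
    show "x \<notin> lattice_box n \<longrightarrow> ?f x = 0" using z by auto
    have "generator a \<tau> ?f x = 0"
      unfolding generator_def by (rule sum.neutral) (use z in auto)
    then show "- dirichlet_generator a \<tau> n ?f x = 0 * ?f x"
      by (simp add: dirichlet_generator_def)
  qed
next
  fix \<nu> assume "neg_dirichlet_eigenvalue a \<tau> n \<nu>"
  then obtain g x where g: "g x \<noteq> 0" "supported_in_box n g"
      "\<forall>x. - dirichlet_generator a \<tau> n g x = \<nu> * g x"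
    unfolding neg_dirichlet_eigenvalue_def supported_in_box_def by blast
  show "0 \<le> \<nu>"
  proof (rule ccontr)
    assume "\<not> 0 \<le> \<nu>"
    then have neg: "\<nu> < 0" by simp
    have xB: "x \<in> lattice_box n" using g by (auto simp: supported_in_box_def)
    have "\<tau> x \<noteq> 0"
    proof
      assume "\<tau> x = 0"
      then have "dirichlet_generator a \<tau> n g x = 0"
        by (simp add: dirichlet_generator_def generator_def)
      then show False using g(3)[rule_format, of x] g(1) neg by simp
    qed
    then have "0 < trap_mass \<tau> n g" using trap_mass_pos xB g(1) by blast
    then have "dirichlet_energy a \<tau> n g < 0"
      using neg eigenfunction_energy[OF g(3,2)] by (simp add: mult_neg_pos)
    then show False using dirichlet_energy_nonneg[of a \<tau> n g] by simp
  qed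
qed

lemma principal_eigenvalue_less_iff:
  assumes nz: "\<forall>x\<in>lattice_box n. \<tau> x \<noteq> 0"
  shows "principal_dirichlet_eigenvalue a \<tau> n < c
    \<longleftrightarrow> (\<exists>f. supported_in_box n f \<and> dirichlet_energy a \<tau> n f < c * trap_mass \<tau> n f)"
    (is "?l < c \<longleftrightarrow> ?R")
proof -
  obtain f where f: "supported_in_box n f" "0 < trap_mass \<tau> n f"
      "dirichlet_energy a \<tau> n f = ?l * trap_mass \<tau> n f"
    and min: "\<And>g. supported_in_box n g \<Longrightarrow> ?l * trap_mass \<tau> n g \<le> dirichlet_energy a \<tau> n g"
    using principal_eigenvalue_rayleigh[OF nz] by metis
  show ?thesis
  proof
    assume "?l < c"
    then show ?R using f by (intro exI[of _ f]) simp
  next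
    assume ?R
    then obtain g where g: "supported_in_box n g" "dirichlet_energy a \<tau> n g < c * trap_mass \<tau> n g"
      by blast
    then have "?l * trap_mass \<tau> n g < c * trap_mass \<tau> n g" using min by (meson le_less_trans)
    then show "?l < c" by (rule mult_right_less_imp_less) (rule trap_mass_nonneg)
  qed
qed

definition rational_box_functions :: "nat \<Rightarrow> (int ^ 'd \<Rightarrow> real) set" where
  "rational_box_functions n = {f. supported_in_box n f \<and> range f \<subseteq> \<rat>}"

lemma countable_rational_box_functions: "countable (rational_box_functions n :: (int ^ 'd \<Rightarrow> real) set)"
proof (rule countable_subset)
  let ?ext = "\<lambda>g x. if x \<in> lattice_box n then g x else 0 :: real"
  show "(rational_box_functions n :: (int ^ 'd \<Rightarrow> real) set) \<subseteq> ?ext ` (PiE (lattice_box n) (\<lambda>_. \<rat>))"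
  proof
    fix f :: "int ^ 'd \<Rightarrow> real" assume f: "f \<in> rational_box_functions n"
    then have "restrict f (lattice_box n) \<in> PiE (lattice_box n) (\<lambda>_. \<rat>)"
      by (auto simp: rational_box_functions_def)
    moreover have "f = ?ext (restrict f (lattice_box n))"
      using f by (auto simp: rational_box_functions_def supported_in_box_def)
    ultimately show "f \<in> ?ext ` (PiE (lattice_box n) (\<lambda>_. \<rat>))" by blast
  qed
  show "countable (?ext ` (PiE (lattice_box n) (\<lambda>_. \<rat>)))"
    by (intro countable_image countable_PiE) (auto simp: countable_rat)
qed

lemma floor_approximation: "(\<lambda>k. real_of_int \<lfloor>real k * r\<rfloor> / real k) \<longlonglongrightarrow> r"
proof (rule tendsto_sandwich)
  show "\<forall>\<^sub>F k in sequentially. r - 1 / real k \<le> real_of_int \<lfloor>real k * r\<rfloor> / real k"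
    using eventually_gt_at_top[of 0]
  proof eventually_elim
    case (elim k)
    have "real k * r - 1 \<le> real_of_int \<lfloor>real k * r\<rfloor>" by linarith
    then have "(real k * r - 1) / real k \<le> real_of_int \<lfloor>real k * r\<rfloor> / real k"
      by (rule divide_right_mono) simp
    then show ?case using elim by (simp add: diff_divide_distrib)
  qed
  show "\<forall>\<^sub>F k in sequentially. real_of_int \<lfloor>real k * r\<rfloor> / real k \<le> r"
    using eventually_gt_at_top[of 0]
  proof eventually_elim
    case (elim k)
    have "real_of_int \<lfloor>real k * r\<rfloor> / real k \<le> (real k * r) / real k"
      by (rule divide_right_mono) auto
    then show ?case using elim by simp
  qed
  show "(\<lambda>k. r - 1 / real k) \<longlonglongrightarrow> r"
    using tendsto_diff[OF tendsto_const[of r] lim_1_over_n] by simp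
qed auto

text \<open>By density the infimum of the Rayleigh quotient can be taken over countably many functions,
  which are fixed in advance and do not depend on the environment.\<close>

lemma principal_eigenvalue_less_iff_rational:
  fixes \<tau> :: "int ^ 'd \<Rightarrow> real"
  assumes nz: "\<forall>x\<in>lattice_box n. \<tau> x \<noteq> 0"
  shows "principal_dirichlet_eigenvalue a \<tau> n < c
    \<longleftrightarrow> (\<exists>f\<in>rational_box_functions n. dirichlet_energy a \<tau> n f < c * trap_mass \<tau> n f)"
proof -
  have "\<exists>g\<in>rational_box_functions n. dirichlet_energy a \<tau> n g < c * trap_mass \<tau> n g"
    if f: "supported_in_box n f" "dirichlet_energy a \<tau> n f < c * trap_mass \<tau> n f" for f
  proof -
    define g where "g k x = real_of_int \<lfloor>real k * f x\<rfloor> / real k" for k x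
    have lim: "(\<lambda>k. g k x) \<longlonglongrightarrow> f x" for x unfolding g_def by (rule floor_approximation)
    have "(\<lambda>k. dirichlet_energy a \<tau> n (g k)) \<longlonglongrightarrow> dirichlet_energy a \<tau> n f"
      unfolding dirichlet_form_def case_prod_unfold by (intro tendsto_intros lim) auto
    moreover have "(\<lambda>k. c * trap_mass \<tau> n (g k)) \<longlonglongrightarrow> c * trap_mass \<tau> n f"
      unfolding trap_mass_def by (intro tendsto_intros lim)
    ultimately have "(\<lambda>k. c * trap_mass \<tau> n (g k) - dirichlet_energy a \<tau> n (g k))
        \<longlonglongrightarrow> c * trap_mass \<tau> n f - dirichlet_energy a \<tau> n f"
      by (intro tendsto_diff)
    then have "\<forall>\<^sub>F k in sequentially. 0 < c * trap_mass \<tau> n (g k) - dirichlet_energy a \<tau> n (g k)"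
      by (rule order_tendstoD) (use f(2) in simp)
    then obtain k where k: "dirichlet_energy a \<tau> n (g k) < c * trap_mass \<tau> n (g k)"
      by (auto simp: eventually_sequentially)
    have "g k \<in> rational_box_functions n"
      using f(1) by (auto simp: rational_box_functions_def supported_in_box_def g_def)
    then show ?thesis using k by blast
  qed
  moreover have "supported_in_box n f" if "f \<in> rational_box_functions n" for f :: "int ^ 'd \<Rightarrow> real"
    using that by (simp add: rational_box_functions_def)
  ultimately show ?thesis
    unfolding principal_eigenvalue_less_iff[OF nz] by metis
qed

lemma principal_eigenvalue_measurable:
  fixes \<tau> :: "int ^ 'd \<Rightarrow> 'w \<Rightarrow> real"
  assumes [measurable]: "\<And>x. \<tau> x \<in> borel_measurable M"
  shows "(\<lambda>\<omega>. principal_dirichlet_eigenvalue a (\<lambda>x. \<tau> x \<omega>) n) \<in> borel_measurable M"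
proof (rule borel_measurableI_less)
  fix c :: real
  let ?\<tau> = "\<lambda>\<omega> x. \<tau> x \<omega>"
  let ?Z = "\<lambda>\<omega>. \<exists>x\<in>lattice_box n. \<tau> x \<omega> = 0"
  let ?Q = "\<lambda>\<omega>. \<exists>f\<in>rational_box_functions n.
      dirichlet_energy a (?\<tau> \<omega>) n f < c * trap_mass (?\<tau> \<omega>) n f"
  have [measurable]: "(\<lambda>\<omega>. dirichlet_energy a (?\<tau> \<omega>) n f) \<in> borel_measurable M" for f
    unfolding dirichlet_form_def conductance_def case_prod_unfold by measurable
  have [measurable]: "(\<lambda>\<omega>. trap_mass (?\<tau> \<omega>) n f) \<in> borel_measurable M" for f
    unfolding trap_mass_def by measurable
  have Q: "{\<omega>\<in>space M. ?Q \<omega>} \<in> sets M"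
    by (rule sets.sets_Collect_countable_Ex'[OF _ countable_rational_box_functions]) measurable
  have Z: "{\<omega>\<in>space M. ?Z \<omega>} \<in> sets M"
    by (rule sets.sets_Collect_finite_Ex) (auto simp: assms)
  have "{\<omega>\<in>space M. principal_dirichlet_eigenvalue a (?\<tau> \<omega>) n < c}
     = ({\<omega>\<in>space M. ?Z \<omega>} \<inter> {\<omega>\<in>space M. 0 < c}) \<union> ({\<omega>\<in>space M. ?Q \<omega>} - {\<omega>\<in>space M. ?Z \<omega>})"
  proof (intro set_eqI)
    fix \<omega>
    show "\<omega> \<in> {\<omega>\<in>space M. principal_dirichlet_eigenvalue a (?\<tau> \<omega>) n < c} \<longleftrightarrow>
      \<omega> \<in> ({\<omega>\<in>space M. ?Z \<omega>} \<inter> {\<omega>\<in>space M. 0 < c}) \<union> ({\<omega>\<in>space M. ?Q \<omega>} - {\<omega>\<in>space M. ?Z \<omega>})"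
    proof (cases "?Z \<omega>")
      case True
      then have "principal_dirichlet_eigenvalue a (?\<tau> \<omega>) n = 0"
        using principal_eigenvalue_zero[of _ n "?\<tau> \<omega>"] by blast
      then show ?thesis using True by auto
    next
      case False
      then have "principal_dirichlet_eigenvalue a (?\<tau> \<omega>) n < c \<longleftrightarrow> ?Q \<omega>"
        by (intro principal_eigenvalue_less_iff_rational) auto
      then show ?thesis using False by auto
    qed
  qed
  also have "\<dots> \<in> sets M" using Q Z by auto
  finally show "{\<omega>\<in>space M. principal_dirichlet_eigenvalue a (?\<tau> \<omega>) n < c} \<in> sets M" .
qed

section \<open>Comparison and lower bounds by superharmonic functions\<close>

lemma principal_eigenvalue_le:
  assumes nz: "\<forall>x\<in>lattice_box n. \<tau> x \<noteq> 0"
    and f: "supported_in_box n f" "dirichlet_energy a \<tau> n f \<le> E" "m \<le> trap_mass \<tau> n f" "0 < m"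
  shows "principal_dirichlet_eigenvalue a \<tau> n \<le> E / m"
proof -
  let ?l = "principal_dirichlet_eigenvalue a \<tau> n"
  have min: "?l * trap_mass \<tau> n f \<le> dirichlet_energy a \<tau> n f"
    using principal_eigenvalue_rayleigh[OF nz, of a thesis for thesis] f(1) by metis
  have E: "0 \<le> E" using f(2) dirichlet_energy_nonneg[of a \<tau> n f] by simp
  have "?l \<le> E / trap_mass \<tau> n f"
    using min f by (simp add: pos_le_divide_eq)
  also have "\<dots> \<le> E / m" using f E by (intro divide_left_mono) auto
  finally show ?thesis .
qed

lemma principal_eigenvalue_ge:
  assumes nz: "\<forall>x\<in>lattice_box n. \<tau> x \<noteq> 0"
    and "\<And>f. supported_in_box n f \<Longrightarrow> c * trap_mass \<tau> n f \<le> dirichlet_energy a \<tau> n f"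
  shows "c \<le> principal_dirichlet_eigenvalue a \<tau> n"
  using principal_eigenvalue_less_iff[OF nz, of a c] assms(2) by (meson not_le)

text \<open>Enlarging the box only enlarges the set of test functions, and the energy and the mass of a
  function do not change. This yields the monotonicity of the eigenvalue in \<open>n\<close>.\<close>

lemma supported_in_box_mono: "supported_in_box m f \<Longrightarrow> m \<le> n \<Longrightarrow> supported_in_box n f"
  unfolding supported_in_box_def using lattice_box_mono by blast

lemma dirichlet_energy_box_mono:
  assumes "supported_in_box m f" "m \<le> n"
  shows "dirichlet_energy a \<tau> n f = dirichlet_energy a \<tau> m f"
proof -
  have sub: "box_edges m \<subseteq> box_edges n"
    using lattice_box_mono[OF assms(2)] by (auto simp: box_edges_def)
  have "(\<Sum>(x, y)\<in>box_edges m. conductance a \<tau> x y * ((f x - f y) * (f x - f y)))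
      = (\<Sum>(x, y)\<in>box_edges n. conductance a \<tau> x y * ((f x - f y) * (f x - f y)))"
  proof (rule sum.mono_neutral_left[OF finite_box_edges sub])
    show "\<forall>p\<in>box_edges n - box_edges m.
        (case p of (x, y) \<Rightarrow> conductance a \<tau> x y * ((f x - f y) * (f x - f y))) = 0"
      using assms(1) by (auto simp: box_edges_def supported_in_box_def)
  qed
  then show ?thesis by (simp add: dirichlet_form_def)
qed

lemma trap_mass_box_mono:
  assumes "supported_in_box m f" "m \<le> n"
  shows "trap_mass \<tau> n f = trap_mass \<tau> m f"
  unfolding trap_mass_def
  by (intro sum.mono_neutral_right lattice_box_mono assms)
     (use assms(1) in \<open>auto simp: supported_in_box_def\<close>)

lemma principal_eigenvalue_antimono:
  assumes nz: "\<forall>x\<in>lattice_box n. \<tau> x \<noteq> 0" and mn: "m \<le> n"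
  shows "principal_dirichlet_eigenvalue a \<tau> n \<le> principal_dirichlet_eigenvalue a \<tau> m"
proof (rule principal_eigenvalue_ge)
  show "\<forall>x\<in>lattice_box m. \<tau> x \<noteq> 0" using nz lattice_box_mono[OF mn] by blast
  fix f :: "int ^ 'a \<Rightarrow> real" assume f: "supported_in_box m f"
  show "principal_dirichlet_eigenvalue a \<tau> n * trap_mass \<tau> m f \<le> dirichlet_energy a \<tau> m f"
    using principal_eigenvalue_rayleigh[OF nz, of a thesis for thesis] supported_in_box_mono[OF f mn]
    by (metis dirichlet_energy_box_mono[OF f mn] trap_mass_box_mono[OF f mn])
qed

text \<open>The difference of the two sides is a square; this is the pointwise form of the ground state
  substitution \<open>f = u g\<close>.\<close>

lemma edge_hardy:
  fixes s t u v :: real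
  assumes "0 < u" "0 < v"
  shows "s\<^sup>2 * (1 - v / u) + t\<^sup>2 * (1 - u / v) \<le> (s - t)\<^sup>2"
proof -
  have "(s - t)\<^sup>2 - (s\<^sup>2 * (1 - v / u) + t\<^sup>2 * (1 - u / v)) = (s * v - t * u)\<^sup>2 / (u * v)"
    using assms by (simp add: field_simps power2_eq_square)
  also have "\<dots> \<ge> 0" using assms by simp
  finally show ?thesis by simp
qed

text \<open>Summing the previous inequality over the edges gives \<open>E(f) \<ge> \<Sum> f\<^sup>2 (- \<Delta> u) / u\<close>, and the
  right-hand side is at least \<open>\<Sum> f\<^sup>2 \<tau> / U\<close>. All conductances are at least 1, so the Laplacian of
  simple random walk can be used for every \<open>a\<close>.\<close>

lemma barta_lower_bound:
  fixes \<tau> u :: "int ^ 'd \<Rightarrow> real"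
  assumes tau: "\<And>x. 1 \<le> \<tau> x" and a: "0 \<le> a"
    and nn: "\<And>x. x \<in> lattice_box (Suc n) \<Longrightarrow> 0 \<le> u x"
    and pos: "\<And>x. x \<in> lattice_box n \<Longrightarrow> 0 < u x"
    and le: "\<And>x. x \<in> lattice_box n \<Longrightarrow> u x \<le> U"
    and super: "\<And>x. x \<in> lattice_box n \<Longrightarrow> \<tau> x \<le> (\<Sum>y | y \<sim>\<^sub>Z x. u x - u y)"
  shows "1 / U \<le> principal_dirichlet_eigenvalue a \<tau> n"
proof (rule principal_eigenvalue_ge)
  show "\<forall>x\<in>lattice_box n. \<tau> x \<noteq> 0" using tau by (metis not_one_le_zero)
  fix f :: "int ^ 'd \<Rightarrow> real" assume f: "supported_in_box n f"
  have f0: "f x = 0" if "x \<notin> lattice_box n" for x using f that by (simp add: supported_in_box_def)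
  have edge: "(f x)\<^sup>2 * (1 - u y / u x) + (f y)\<^sup>2 * (1 - u x / u y)
      \<le> conductance a \<tau> x y * ((f x - f y) * (f x - f y))"
    if e: "(x, y) \<in> box_edges n" for x y
  proof -
    have c: "1 \<le> conductance a \<tau> x y"
      using mult_mono[OF ge_one_powr_ge_zero[OF tau a] ge_one_powr_ge_zero[OF tau a]]
      by (simp add: conductance_def)
    have nbr: "x \<in> lattice_box (Suc n)" "y \<in> lattice_box (Suc n)"
      using e sup_norm_nearest_nbr[of x y] sup_norm_nearest_nbr[of y x] nearest_nbr_sym[of x y]
      by (auto simp: box_edges_def lattice_box_iff)
    have "(f x)\<^sup>2 * (1 - u y / u x) + (f y)\<^sup>2 * (1 - u x / u y) \<le> (f x - f y)\<^sup>2"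
    proof -
      consider "x \<in> lattice_box n" "y \<in> lattice_box n" | "x \<in> lattice_box n" "y \<notin> lattice_box n"
        | "x \<notin> lattice_box n" "y \<in> lattice_box n"
        using e by (auto simp: box_edges_def)
      then show ?thesis
      proof cases
        case 1
        then show ?thesis using edge_hardy pos by blast
      next
        case 2
        have "0 \<le> u y / u x" using nn[OF nbr(2)] pos[OF 2(1)] by simp
        then have "(f x)\<^sup>2 * (1 - u y / u x) \<le> (f x)\<^sup>2 * 1" by (intro mult_left_mono) auto
        then show ?thesis using f0[OF 2(2)] by simp
      next
        case 3
        have "0 \<le> u x / u y" using nn[OF nbr(1)] pos[OF 3(2)] by simp
        then have "(f y)\<^sup>2 * (1 - u x / u y) \<le> (f y)\<^sup>2 * 1" by (intro mult_left_mono) auto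
        then show ?thesis using f0[OF 3(1)] by simp
      qed
    qed
    also have "\<dots> \<le> conductance a \<tau> x y * (f x - f y)\<^sup>2"
      using mult_right_mono[OF c, of "(f x - f y)\<^sup>2"] by simp
    finally show ?thesis by (simp add: power2_eq_square)
  qed
  have "1 / U * trap_mass \<tau> n f = (\<Sum>x\<in>lattice_box n. (f x)\<^sup>2 * (\<tau> x / U))"
    using tau by (simp add: trap_mass_def sum_distrib_left algebra_simps abs_of_nonneg[OF order_trans[OF zero_le_one]])
  also have "\<dots> \<le> (\<Sum>x\<in>lattice_box n. (f x)\<^sup>2 * (\<Sum>y | y \<sim>\<^sub>Z x. 1 - u y / u x))"
  proof (intro sum_mono mult_left_mono)
    fix x :: "int ^ 'd" assume x: "x \<in> lattice_box n"
    have t0: "0 \<le> \<tau> x" using tau[of x] by simp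
    have "\<tau> x / U \<le> \<tau> x / u x"
      using pos[OF x] le[OF x] t0 by (intro divide_left_mono) auto
    also have "\<dots> \<le> (\<Sum>y | y \<sim>\<^sub>Z x. u x - u y) / u x"
      using pos[OF x] super[OF x] by (intro divide_right_mono) auto
    also have "\<dots> = (\<Sum>y | y \<sim>\<^sub>Z x. 1 - u y / u x)"
      using pos[OF x] by (simp add: sum_divide_distrib diff_divide_distrib)
    finally show "\<tau> x / U \<le> (\<Sum>y | y \<sim>\<^sub>Z x. 1 - u y / u x)" .
  qed auto
  also have "\<dots> = (\<Sum>x\<in>lattice_box n. \<Sum>y | y \<sim>\<^sub>Z x. (f x)\<^sup>2 * (1 - u y / u x))"
    by (simp add: sum_distrib_left)
  also have "\<dots> = (\<Sum>(x, y)\<in>box_edges n. (f x)\<^sup>2 * (1 - u y / u x))"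
    by (rule sum_box_edges[symmetric]) (simp add: f0)
  also have "\<dots> = ((\<Sum>(x, y)\<in>box_edges n. (f x)\<^sup>2 * (1 - u y / u x))
      + (\<Sum>(x, y)\<in>box_edges n. (f y)\<^sup>2 * (1 - u x / u y))) / 2"
    using sum_box_edges_swap[of "\<lambda>x y. (f x)\<^sup>2 * (1 - u y / u x)" n] by simp
  also have "\<dots> \<le> dirichlet_energy a \<tau> n f"
    unfolding dirichlet_form_def sum.distrib[symmetric]
    by (intro divide_right_mono sum_mono) (use edge in auto)
  finally show "1 / U * trap_mass \<tau> n f \<le> dirichlet_energy a \<tau> n f" .
qed

section \<open>An explicit majorant of the Green function\<close>

text \<open>This is \<open>\<integral>\<^sub>R\<^sup>D r\<^sup>-\<^sup>s dr\<close>. With \<open>s = d / 2\<close> and \<open>R = |x|\<^sup>2\<close> it is, up to a constant factor, the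
  fundamental solution of the Laplacian in dimension \<open>d\<close>, normalised to vanish at \<open>|x|\<^sup>2 = D\<close>.\<close>

definition radial_potential :: "real \<Rightarrow> real \<Rightarrow> real \<Rightarrow> real" where
  "radial_potential s D R = (if s = 1 then ln D - ln R else (R powr (1 - s) - D powr (1 - s)) / (s - 1))"

lemma radial_potential_deriv:
  assumes "0 < R"
  shows "(radial_potential s D has_real_derivative - (R powr (- s))) (at R)"
proof (cases "s = 1")
  case True
  have D: "((\<lambda>R. c - ln R) has_real_derivative - (R powr (- 1))) (at R)" for c
    by (rule derivative_eq_intros refl assms)+ (use assms in \<open>simp add: powr_minus inverse_eq_divide\<close>)
  have "radial_potential s D = (\<lambda>R. ln D - ln R)"
    using True by (simp add: radial_potential_def fun_eq_iff)
  then show ?thesis unfolding True by (simp only: D)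
next
  case False
  have "((\<lambda>R. (R powr (1 - s) - D powr (1 - s)) / (s - 1)) has_real_derivative
      ((1 - s) * R powr (1 - s - 1)) / (s - 1)) (at R)"
    using DERIV_cdivide[OF DERIV_diff[OF has_real_derivative_powr[OF assms, of "1 - s"]
        DERIV_const[of "D powr (1 - s)"]], of "s - 1"] by simp
  moreover have "((1 - s) * R powr (1 - s - 1)) / (s - 1) = - (R powr (- s))"
    using False by (simp add: field_simps)
  ultimately show ?thesis unfolding radial_potential_def[abs_def] using False by simp
qed

lemma radial_potential_nonneg:
  assumes "0 < R" "R \<le> D" shows "0 \<le> radial_potential s D R"
proof -
  consider "s = 1" | "s < 1" | "1 < s" by linarith
  then show ?thesis
  proof cases
    case 1
    then show ?thesis using assms by (simp add: radial_potential_def)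
  next
    case 2
    then have "R powr (1 - s) \<le> D powr (1 - s)" using assms by (intro powr_mono2) auto
    then show ?thesis using 2 by (simp add: radial_potential_def divide_nonpos_neg)
  next
    case 3
    then have "D powr (1 - s) \<le> R powr (1 - s)" using assms by (intro powr_mono2') auto
    then show ?thesis using 3 by (simp add: radial_potential_def)
  qed
qed

lemma radial_potential_antimono:
  assumes "0 < R" "R \<le> R'" shows "radial_potential s D R' \<le> radial_potential s D R"
proof -
  have "0 \<le> radial_potential s R' R" using assms by (rule radial_potential_nonneg)
  moreover have "radial_potential s D R - radial_potential s D R' = radial_potential s R' R"
    by (simp add: radial_potential_def diff_divide_distrib)
  ultimately show ?thesis by simp
qed

text \<open>Fourth-order Taylor expansion at \<open>R\<close>; on the segment, which stays above \<open>R / 2\<close>, the fourth derivative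
  is at most \<open>2\<^sup>s\<^sup>+\<^sup>3\<close> times its value at \<open>R\<close>.\<close>

lemma radial_potential_taylor:
  assumes "0 < R" "\<bar>z\<bar> \<le> R / 2" "0 < s"
  shows "radial_potential s D (R + z) \<le> radial_potential s D R - R powr (- s) * z
    + s / 2 * R powr (- s - 1) * z\<^sup>2 - s * (s + 1) / 6 * R powr (- s - 2) * z ^ 3
    + s * (s + 1) * (s + 2) / 24 * 2 powr (s + 3) * R powr (- s - 3) * z ^ 4"
proof (cases "z = 0")
  case False
  define diff where "diff m = (if m = 0 then radial_potential s D
     else if m = 1 then (\<lambda>r. - (r powr (- s)))
     else if m = 2 then (\<lambda>r. s * r powr (- s - 1))
     else if m = 3 then (\<lambda>r. - (s * (s + 1) * r powr (- s - 2)))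
     else (\<lambda>r. s * (s + 1) * (s + 2) * r powr (- s - 3)))" for m :: nat
  have deriv: "DERIV (diff m) t :> diff (Suc m) t" if "m < 4" "0 < t" for m t
  proof -
    have "m = 0 \<or> m = 1 \<or> m = 2 \<or> m = 3" using that(1) by arith
    then consider "m = 0" | "m = 1" | "m = 2" | "m = 3" by blast
    then show ?thesis
    proof cases
      case 1
      then show ?thesis using radial_potential_deriv[OF that(2)] by (simp add: diff_def)
    next
      case 2
      have "((\<lambda>r. - (r powr (- s))) has_real_derivative - (- s * t powr (- s - 1))) (at t)"
        using that(2) by (intro derivative_eq_intros) auto
      then show ?thesis using 2 by (simp add: diff_def numeral_2_eq_2)
    next
      case 3
      have "((\<lambda>r. s * r powr (- s - 1)) has_real_derivative s * ((- s - 1) * t powr (- s - 1 - 1))) (at t)"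
        using that(2) by (intro derivative_eq_intros) auto
      moreover have "s * ((- s - 1) * t powr (- s - 1 - 1)) = diff (Suc m) t"
        using 3 by (simp add: diff_def algebra_simps)
      ultimately show ?thesis using 3 by (simp add: diff_def)
    next
      case 4
      have "((\<lambda>r. - (s * (s + 1) * r powr (- s - 2))) has_real_derivative
          - (s * (s + 1) * ((- s - 2) * t powr (- s - 2 - 1)))) (at t)"
        using that(2) by (intro derivative_eq_intros) auto
      moreover have "- (s * (s + 1) * ((- s - 2) * t powr (- s - 2 - 1))) = diff (Suc m) t"
        using 4 by (simp add: diff_def algebra_simps)
      ultimately show ?thesis using 4 by (simp add: diff_def)
    qed
  qed
  have z: "- (R / 2) \<le> z" "z \<le> R / 2" using assms(2) by (simp_all add: abs_le_iff)
  obtain t where t: "if R + z < R then R + z < t \<and> t < R else R < t \<and> t < R + z"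
    and eq: "radial_potential s D (R + z)
       = (\<Sum>m<4. (diff m R / fact m) * (R + z - R) ^ m) + (diff 4 t / fact 4) * (R + z - R) ^ 4"
    using Taylor[of 4 diff "radial_potential s D" "R / 2" "2 * R" R "R + z"] deriv assms(1) z False
    by (auto simp: diff_def)
  have t2: "R / 2 \<le> t" using t z assms(1) by (auto split: if_splits)
  have "t powr (- s - 3) \<le> (R / 2) powr (- s - 3)"
    using t2 assms by (intro powr_mono2') auto
  also have "\<dots> = 2 powr (s + 3) * R powr (- s - 3)"
    using assms(1) by (simp add: powr_divide powr_diff powr_minus powr_add field_simps)
  finally have tt: "t powr (- s - 3) \<le> 2 powr (s + 3) * R powr (- s - 3)" .
  have "diff 4 t / fact 4 * z ^ 4 = s * (s + 1) * (s + 2) / 24 * t powr (- s - 3) * z ^ 4"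
    by (simp add: diff_def fact_numeral)
  also have "\<dots> \<le> s * (s + 1) * (s + 2) / 24 * (2 powr (s + 3) * R powr (- s - 3)) * z ^ 4"
    using tt assms(3) by (intro mult_right_mono mult_left_mono) auto
  finally have "diff 4 t / fact 4 * z ^ 4
      \<le> s * (s + 1) * (s + 2) / 24 * (2 powr (s + 3) * R powr (- s - 3)) * z ^ 4" .
  moreover have "(\<Sum>m<4. (diff m R / fact m) * z ^ m)
      = radial_potential s D R - R powr (- s) * z + s / 2 * R powr (- s - 1) * z\<^sup>2
        - s * (s + 1) / 6 * R powr (- s - 2) * z ^ 3"
  proof -
    have "{..<4} = {0, 1, 2, 3 :: nat}" by auto
    then show ?thesis by (simp add: diff_def fact_numeral)
  qed
  ultimately show ?thesis unfolding eq by (simp add: mult.assoc)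
qed simp

definition sq_norm :: "int ^ 'd \<Rightarrow> real" where
  "sq_norm x = (\<Sum>i\<in>UNIV. (real_of_int (x $ i))\<^sup>2)"

lemma sq_norm_nonneg [simp]: "0 \<le> sq_norm x"
  by (simp add: sq_norm_def sum_nonneg)

lemma sq_norm_step:
  assumes "s = 1 \<or> s = -1"
  shows "sq_norm (x + axis i s) = sq_norm x + (1 + 2 * of_int s * real_of_int (x $ i))"
proof -
  have "sq_norm (x + axis i s) = (\<Sum>j\<in>UNIV. (real_of_int (x $ j))\<^sup>2
      + (if j = i then 1 + 2 * of_int s * real_of_int (x $ j) else 0))"
    unfolding sq_norm_def
    by (rule sum.cong) (use assms in \<open>auto simp: axis_def power2_eq_square algebra_simps\<close>)
  then show ?thesis by (simp add: sum.distrib sq_norm_def)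
qed

lemma sup_norm_sq_le_sq_norm: "(real (sup_norm x))\<^sup>2 \<le> sq_norm x"
proof -
  obtain i where i: "\<bar>x $ i\<bar> = int (sup_norm x)" using sup_norm_attained by blast
  then have "(real (sup_norm x))\<^sup>2 = (real_of_int (x $ i))\<^sup>2"
    by (metis of_int_abs of_int_of_nat_eq power2_abs)
  also have "\<dots> \<le> sq_norm x" unfolding sq_norm_def by (rule member_le_sum) auto
  finally show ?thesis .
qed

lemma sq_norm_le_sup_norm_sq:
  fixes x :: "int ^ 'd"
  shows "sq_norm x \<le> real CARD('d) * (real (sup_norm x))\<^sup>2"
proof -
  have "sq_norm x \<le> (\<Sum>i\<in>(UNIV::'d set). (real (sup_norm x))\<^sup>2)"
    unfolding sq_norm_def
  proof (rule sum_mono)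
    fix i
    have "\<bar>real_of_int (x $ i)\<bar> \<le> \<bar>real (sup_norm x)\<bar>"
      using component_le_sup_norm[of x i] by linarith
    then show "(real_of_int (x $ i))\<^sup>2 \<le> (real (sup_norm x))\<^sup>2" by (rule abs_le_square_iff[THEN iffD1])
  qed
  then show ?thesis by simp
qed

text \<open>A step in direction \<open>i\<close> changes \<open>R = |x|\<^sup>2 + A\<close> by \<open>1 \<plusminus> 2 x\<^sub>i\<close>. In the sum of the Taylor expansions
  over all neighbours the second-order terms cancel as for the continuous fundamental solution,
  except for \<open>- 2 d A R\<^sup>-\<^sup>s\<^sup>-\<^sup>1\<close>, which is due to the shift \<open>A\<close>. The errors of the discretisation are also
  of order \<open>R\<^sup>-\<^sup>s\<^sup>-\<^sup>1\<close>, with a constant that does not depend on \<open>A\<close>, so a large \<open>A\<close> wins.\<close>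

lemma radial_superharmonic:
  fixes x :: "int ^ 'd"
  defines "s \<equiv> real CARD('d) / 2"
  defines "c \<equiv> s * (s + 1) * (s + 2) / 24 * 2 powr (s + 3)"
  assumes A: "6 \<le> A" "s + 82 * c + 1 \<le> 2 * A"
  shows "(sq_norm x + A) powr (- s - 1)
    \<le> (\<Sum>y | y \<sim>\<^sub>Z x. radial_potential s D (sq_norm x + A) - radial_potential s D (sq_norm y + A))"
proof -
  define R where "R = sq_norm x + A"
  define P where "P = R powr (- s - 1)"
  define d where "d = real CARD('d)"
  have d1: "1 \<le> d" by (simp add: d_def Suc_leI)
  have s0: "0 < s" by (simp add: s_def)
  have c0: "0 \<le> c" using s0 by (simp add: c_def)
  have R: "6 \<le> R" using A(1) by (simp add: R_def add_increasing)
  have P0: "0 < P" using R by (simp add: P_def)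
  let ?w = "radial_potential s D"
  let ?t = "\<lambda>i. real_of_int (x $ i)"
  have per: "?w (R + (1 + 2 * ?t i)) + ?w (R + (1 - 2 * ?t i)) - 2 * ?w R
      \<le> P * (- 2 * R + s + 4 * s * (?t i)\<^sup>2 + 82 * c)" for i
  proof -
    define t where "t = ?t i"
    have t2: "t\<^sup>2 + 6 \<le> R"
      using A(1) member_le_sum[of i UNIV "\<lambda>i. (?t i)\<^sup>2"] by (simp add: t_def R_def sq_norm_def)
    \<comment> \<open>the Taylor expansion is used on increments of modulus at most \<open>R / 2\<close>\<close>
    have small: "1 + 2 * \<bar>t\<bar> \<le> R / 2"
    proof -
      have "0 \<le> (\<bar>t\<bar> - 2)\<^sup>2" by simp
      then have "4 * \<bar>t\<bar> \<le> t\<^sup>2 + 4" by (simp add: power2_eq_square algebra_simps)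
      then show ?thesis using t2 by linarith
    qed
    have pow: "R powr (- s) = R * P" "R powr (- s - 2) = P / R" "R powr (- s - 3) = P / R\<^sup>2"
      using R by (simp_all add: P_def powr_diff powr_minus field_simps power2_eq_square
          power3_eq_cube powr_numeral)
    have tay: "?w (R + z) \<le> ?w R - R * P * z + s / 2 * P * z\<^sup>2 - s * (s + 1) / 6 * (P / R) * z ^ 3
        + c * (P / R\<^sup>2) * z ^ 4" if "\<bar>z\<bar> \<le> R / 2" for z
      using radial_potential_taylor[of R z s D] that R s0
      by (simp add: pow c_def flip: P_def)
    have "?w (R + (1 + 2 * t)) + ?w (R + (1 - 2 * t)) - 2 * ?w R
      \<le> - (R * P * ((1 + 2 * t) + (1 - 2 * t))) + s / 2 * P * ((1 + 2 * t)\<^sup>2 + (1 - 2 * t)\<^sup>2)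
        - s * (s + 1) / 6 * (P / R) * ((1 + 2 * t) ^ 3 + (1 - 2 * t) ^ 3)
        + c * (P / R\<^sup>2) * ((1 + 2 * t) ^ 4 + (1 - 2 * t) ^ 4)"
    proof -
      have "\<bar>1 + 2 * t\<bar> \<le> R / 2" "\<bar>1 - 2 * t\<bar> \<le> R / 2" using small by linarith+
      from tay[OF this(1)] tay[OF this(2)] show ?thesis by (simp only: distrib_left)
    qed
    also have "(1 + 2 * t) + (1 - 2 * t) = 2" by simp
    also have "(1 + 2 * t)\<^sup>2 + (1 - 2 * t)\<^sup>2 = 2 + 8 * t\<^sup>2"
      by (simp add: power2_eq_square algebra_simps)
    also have "(1 + 2 * t) ^ 3 + (1 - 2 * t) ^ 3 = 2 + 24 * t\<^sup>2"
      by (simp add: power2_eq_square power3_eq_cube algebra_simps)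
    also have "(1 + 2 * t) ^ 4 + (1 - 2 * t) ^ 4 = 2 + 48 * t\<^sup>2 + 32 * (t\<^sup>2)\<^sup>2"
      by (simp add: power2_eq_square power4_eq_xxxx algebra_simps)
    also have "- (R * P * 2) + s / 2 * P * (2 + 8 * t\<^sup>2) - s * (s + 1) / 6 * (P / R) * (2 + 24 * t\<^sup>2)
        + c * (P / R\<^sup>2) * (2 + 48 * t\<^sup>2 + 32 * (t\<^sup>2)\<^sup>2)
      \<le> - (R * P * 2) + s / 2 * P * (2 + 8 * t\<^sup>2) - 0 + c * (P / R\<^sup>2) * (82 * R\<^sup>2)"
    proof (intro add_mono diff_mono mult_left_mono order_refl)
      show "0 \<le> s * (s + 1) / 6 * (P / R) * (2 + 24 * t\<^sup>2)" using s0 P0 R by simp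
      have "2 \<le> 2 * R\<^sup>2" "t\<^sup>2 \<le> R\<^sup>2"
      proof -
        have "1 * 1 \<le> R * R" using R by (intro mult_mono) auto
        then show "2 \<le> 2 * R\<^sup>2" by (simp add: power2_eq_square)
        have "R * 1 \<le> R * R" using R by (intro mult_left_mono) auto
        then show "t\<^sup>2 \<le> R\<^sup>2" using t2 by (simp add: power2_eq_square)
      qed
      moreover have "(t\<^sup>2)\<^sup>2 \<le> R\<^sup>2" using t2 by (intro power_mono) auto
      ultimately show "2 + 48 * t\<^sup>2 + 32 * (t\<^sup>2)\<^sup>2 \<le> 82 * R\<^sup>2" by linarith
      show "0 \<le> c * (P / R\<^sup>2)" using c0 P0 by simp
    qed (use s0 P0 in simp_all)
    also have "\<dots> = P * (- 2 * R + s + 4 * s * t\<^sup>2 + 82 * c)"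
      using R by (simp add: field_simps)
    finally show ?thesis by (simp add: t_def)
  qed
  have "- (\<Sum>y | y \<sim>\<^sub>Z x. ?w R - ?w (sq_norm y + A))
      = (\<Sum>i\<in>UNIV. ?w (R + (1 + 2 * ?t i)) + ?w (R + (1 - 2 * ?t i)) - 2 * ?w R)"
  proof -
    have "sq_norm (x + axis i 1) + A = R + (1 + 2 * ?t i)" for i
      using sq_norm_step[of 1 x i] by (simp add: R_def)
    moreover have "sq_norm (x - axis i 1) + A = R + (1 - 2 * ?t i)" for i
    proof -
      have "x - axis i 1 = x + axis i (- 1)" by (simp add: vec_eq_iff axis_def)
      then show ?thesis unfolding R_def using sq_norm_step[of "- 1" x i] by (simp only:) simp
    qed
    ultimately show ?thesis
      unfolding sum_nearest_nbr by (simp add: add.commute flip: sum_negf)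
  qed
  also have "\<dots> \<le> (\<Sum>i\<in>UNIV. P * (- 2 * R + s + 4 * s * (?t i)\<^sup>2 + 82 * c))"
    by (intro sum_mono per)
  also have "\<dots> = P * (d * (- 2 * R + s + 82 * c) + 4 * s * sq_norm x)"
  proof -
    have "(\<Sum>i\<in>UNIV. P * (k + 4 * s * (?t i)\<^sup>2)) = P * (d * k + 4 * s * sq_norm x)" for k
      by (simp add: sum.distrib sq_norm_def d_def flip: sum_distrib_left)
    from this[of "- 2 * R + s + 82 * c"] show ?thesis by (simp add: add_ac)
  qed
  \<comment> \<open>here \<open>4 s = 2 d\<close> makes \<open>|x|\<^sup>2\<close> cancel and leaves only the shift \<open>A\<close>\<close>
  also have "d * (- 2 * R + s + 82 * c) + 4 * s * sq_norm x = d * (s + 82 * c - 2 * A)"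
    by (simp add: R_def s_def d_def algebra_simps)
  also have "P * (d * (s + 82 * c - 2 * A)) \<le> P * (d * (- 1))"
    using P0 d1 A(2) by (intro mult_left_mono) auto
  also have "\<dots> \<le> - P" using P0 d1 by simp
  finally show ?thesis by (simp add: P_def R_def)
qed

text \<open>Comparing \<open>r\<^sup>-\<^sup>s\<close> with \<open>R\<^sup>-\<^sup>(\<^sup>s\<^sup>-\<^sup>1\<^sup>/\<^sup>2\<^sup>) r\<^sup>-\<^sup>1\<^sup>/\<^sup>2\<close> under the integral gives one bound for all dimensions.
  At distance \<open>k\<close> it is of order \<open>n k\<^sup>-\<^sup>(\<^sup>d\<^sup>-\<^sup>1\<^sup>)\<close>, so every shell contributes at most order \<open>n\<close> to the sum
  of the potential over the box.\<close>

lemma radial_potential_le: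
  assumes R: "1 \<le> R" "R \<le> D" and s: "s = 1 / 2 \<or> s = 1 \<or> 3 / 2 \<le> s"
  shows "radial_potential s D R \<le> 2 * sqrt D * R powr (- (s - 1 / 2))"
proof -
  consider "s = 1 / 2" | "s = 1" | "3 / 2 \<le> s" using s by blast
  then show ?thesis
  proof cases
    case 1
    have "radial_potential s D R = 2 * (sqrt D - sqrt R)"
      unfolding 1 radial_potential_def using R by (simp add: powr_half_sqrt)
    then show ?thesis unfolding 1 using R by simp
  next
    case 2
    have "ln (D / R) \<le> (D / R) powr (1 / 2) / (1 / 2)"
      by (rule ln_powr_bound) (use R in auto)
    also have "\<dots> = 2 * sqrt D * R powr (- (1 / 2))"
      using R by (simp add: powr_half_sqrt powr_minus real_sqrt_divide field_simps)
    finally show ?thesis using 2 R by (simp add: radial_potential_def ln_div)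
  next
    case 3
    have "radial_potential s D R \<le> R powr (1 - s) / (s - 1)"
      using 3 by (simp add: radial_potential_def divide_right_mono)
    also have "\<dots> \<le> R powr (1 - s) / (1 / 2)"
      using 3 by (intro divide_left_mono) auto
    also have "\<dots> = 2 * (R powr (1 / 2) * R powr (- (s - 1 / 2)))"
      by (simp flip: powr_add)
    also have "\<dots> \<le> 2 * (D powr (1 / 2) * R powr (- (s - 1 / 2)))"
      using R by (intro mult_left_mono mult_right_mono powr_mono2) auto
    finally show ?thesis using R by (simp add: powr_half_sqrt)
  qed
qed

lemma sum_lattice_box_shells:
  fixes g :: "int ^ 'd \<Rightarrow> 'b::comm_monoid_add"
  shows "(\<Sum>x\<in>lattice_box m. g x) = (\<Sum>k\<le>m. \<Sum>x | sup_norm x = k. g x)"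
proof -
  have "(\<Sum>x\<in>lattice_box m. g x) = (\<Sum>k\<in>{..m}. \<Sum>x | x \<in> lattice_box m \<and> sup_norm x = k. g x)"
    by (rule sum.group[symmetric]) (auto simp: lattice_box_iff)
  also have "\<dots> = (\<Sum>k\<le>m. \<Sum>x | sup_norm x = k. g x)"
    by (intro sum.cong refl) (auto simp: lattice_box_iff)
  finally show ?thesis .
qed

lemma powr_nonpos_le_one: "1 \<le> x \<Longrightarrow> p \<le> 0 \<Longrightarrow> x powr p \<le> 1" for x p :: real
  using powr_mono[of p 0 x] by simp

text \<open>The order of the maximum of the Green function of a box of radius \<open>n\<close>.\<close>

definition green_bound :: "nat \<Rightarrow> nat \<Rightarrow> real" where
  "green_bound d n = (if d = 1 then real n else if d = 2 then ln (real n) else 1)"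

text \<open>The arguments \<open>x - y\<close> of a potential range over the doubled box, and over one more layer when a
  neighbour is taken; this explains the two radii.\<close>

definition green_majorant :: "real \<Rightarrow> nat \<Rightarrow> (int ^ 'd \<Rightarrow> real) \<Rightarrow> bool" where
  "green_majorant C n v \<longleftrightarrow>
     (\<forall>x\<in>lattice_box (2 * n + 1). 0 \<le> v x) \<and>
     (\<forall>x. (if x = 0 then 1 else 0) \<le> (\<Sum>y | y \<sim>\<^sub>Z x. v x - v y)) \<and>
     (\<forall>x. v x \<le> C * green_bound CARD('d) n) \<and>
     (\<Sum>x\<in>lattice_box (2 * n). v x) \<le> C * (real n)\<^sup>2"

text \<open>The function is a multiple of \<open>x \<mapsto> radial_potential s D (|x|\<^sup>2 + A)\<close>. The factor \<open>K\<close> normalises the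
  Laplacian at 0, and \<open>D\<close> is the largest value of \<open>|x|\<^sup>2 + A\<close> on the box where non-negativity is wanted.\<close>

lemma exists_green_majorant:
  "\<exists>C>0. \<forall>n\<ge>2. \<exists>v :: int ^ 'd \<Rightarrow> real. green_majorant C n v"
proof -
  define d where "d = CARD('d)"
  define s where "s = real d / 2"
  define c where "c = s * (s + 1) * (s + 2) / 24 * 2 powr (s + 3)"
  \<comment> \<open>large enough for the superharmonicity of the shifted radial potential\<close>
  define A where "A = max 6 ((s + 82 * c + 1) / 2)"
  have A: "6 \<le> A" "s + 82 * c + 1 \<le> 2 * A" by (auto simp: A_def max_def)
  have d1: "1 \<le> d" by (simp add: d_def Suc_leI)
  have s3: "s = 1 / 2 \<or> s = 1 \<or> 3 / 2 \<le> s"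
  proof -
    have "d = 1 \<or> d = 2 \<or> 3 \<le> d" using d1 by linarith
    then show ?thesis by (auto simp: s_def)
  qed
  define E where "E = 9 * real d + A"
  define K where "K = A powr (s + 1)"
  have K0: "0 < K" using A by (simp add: K_def)
  have E1: "1 \<le> E" using A by (simp add: E_def add_increasing)
  define C1 where "C1 = 2 * sqrt E + (ln E / ln 2 + 2) + 2"
  define C2 where "C2 = 2 * sqrt E * (1 + 4 * real d * 3 ^ (d - 1))"
  have lnE: "0 \<le> ln E / ln 2" using E1 by simp
  have C1: "0 < C1" using lnE real_sqrt_ge_zero[of E] E1 unfolding C1_def by linarith
  have C2: "0 \<le> C2" using E1 by (simp add: C2_def)
  show ?thesis
  proof (intro exI[of _ "K * (C1 + C2)"] conjI allI impI)
    show "0 < K * (C1 + C2)" using K0 C1 C2 by simp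
    fix n :: nat assume n: "2 \<le> n"
    define D where "D = real d * (real (2 * n + 1))\<^sup>2 + A"
    have DE: "D \<le> E * (real n)\<^sup>2"
    proof -
      have "(real (2 * n + 1))\<^sup>2 \<le> (3 * real n)\<^sup>2" using n by (intro power_mono) auto
      then have "real d * (real (2 * n + 1))\<^sup>2 \<le> real d * (9 * (real n)\<^sup>2)"
        by (intro mult_left_mono) (auto simp: power_mult_distrib)
      moreover have "A * 1 \<le> A * (real n)\<^sup>2" using A n by (intro mult_left_mono) auto
      ultimately show ?thesis by (simp add: D_def E_def algebra_simps)
    qed
    have D0: "0 < D" using A by (simp add: D_def add_nonneg_pos)
    have sD: "sqrt D \<le> sqrt E * real n"
      using real_sqrt_le_mono[OF DE] by (simp add: real_sqrt_mult)
    define w where "w R = radial_potential s D R" for R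
    define v :: "int ^ 'd \<Rightarrow> real" where "v x = K * w (sq_norm x + A)" for x
    have inD: "sq_norm x + A \<le> D" if "x \<in> lattice_box (2 * n + 1)" for x :: "int ^ 'd"
    proof -
      have "(real (sup_norm x))\<^sup>2 \<le> (real (2 * n + 1))\<^sup>2"
        using that by (intro power_mono) (auto simp: lattice_box_iff simp del: of_nat_Suc of_nat_add of_nat_mult)
      then have "real d * (real (sup_norm x))\<^sup>2 \<le> real d * (real (2 * n + 1))\<^sup>2"
        by (intro mult_left_mono) auto
      then show ?thesis using sq_norm_le_sup_norm_sq[of x] unfolding D_def d_def by linarith
    qed
    have pos: "0 < sq_norm x + A" "1 \<le> sq_norm x + A" for x :: "int ^ 'd"
      using A sq_norm_nonneg[of x] by linarith+
    have 1: "0 \<le> v x" if "x \<in> lattice_box (2 * n + 1)" for x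
      unfolding v_def w_def
      by (intro mult_nonneg_nonneg radial_potential_nonneg inD[OF that] pos) (use K0 in simp)
    have 2: "(if x = 0 then 1 else 0) \<le> (\<Sum>y | y \<sim>\<^sub>Z x. v x - v y)" for x
    proof -
      have "(sq_norm x + A) powr (- s - 1) \<le> (\<Sum>y | y \<sim>\<^sub>Z x. w (sq_norm x + A) - w (sq_norm y + A))"
        unfolding w_def s_def d_def
        by (rule radial_superharmonic) (use A in \<open>auto simp: s_def d_def c_def\<close>)
      then have "K * (sq_norm x + A) powr (- s - 1) \<le> K * (\<Sum>y | y \<sim>\<^sub>Z x. w (sq_norm x + A) - w (sq_norm y + A))"
        using K0 by (intro mult_left_mono) auto
      also have "\<dots> = (\<Sum>y | y \<sim>\<^sub>Z x. v x - v y)"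
        by (simp add: v_def sum_distrib_left right_diff_distrib)
      finally have le: "K * (sq_norm x + A) powr (- s - 1) \<le> (\<Sum>y | y \<sim>\<^sub>Z x. v x - v y)" .
      show ?thesis
      proof (cases "x = 0")
        case True
        have "K * (sq_norm x + A) powr (- s - 1) = A powr ((s + 1) + (- s - 1))"
          using True unfolding K_def powr_add by (simp add: sq_norm_def)
        also have "\<dots> = 1" using A by simp
        finally show ?thesis using le True by simp
      next
        case False
        have "0 \<le> K * (sq_norm x + A) powr (- s - 1)" using K0 by simp
        then show ?thesis using le False by simp
      qed
    qed
    have wA: "w A \<le> C1 * green_bound d n"
    proof -
      consider "d = 1" | "d = 2" | "3 \<le> d" using d1 by linarith
      then show ?thesis
      proof cases
        case 1
        have "w A \<le> 2 * sqrt D"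
          using 1 A D0 by (simp add: w_def radial_potential_def s_def powr_half_sqrt)
        also have "\<dots> \<le> 2 * sqrt E * real n" using sD by simp
        also have "\<dots> \<le> C1 * real n"
          using lnE by (intro mult_right_mono) (auto simp: C1_def)
        finally show ?thesis using 1 by (simp add: green_bound_def)
      next
        case 2
        have "0 \<le> ln A" using A by simp
        then have "w A \<le> ln D" using 2 by (simp add: w_def radial_potential_def s_def)
        also have "\<dots> \<le> ln (E * (real n)\<^sup>2)" using DE D0 by (intro ln_mono) auto
        also have "\<dots> = ln E + 2 * ln (real n)"
          using E1 n by (simp add: ln_mult ln_realpow)
        also have "ln E \<le> ln E / ln 2 * ln (real n)"
        proof -
          have "ln 2 \<le> ln (real n)" using n by simp
          then have "ln E / ln 2 * ln 2 \<le> ln E / ln 2 * ln (real n)"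
            using lnE by (intro mult_left_mono) auto
          then show ?thesis by simp
        qed
        also have "ln E / ln 2 * ln (real n) + 2 * ln (real n) = (ln E / ln 2 + 2) * ln (real n)"
          by (simp add: algebra_simps)
        also have "\<dots> \<le> C1 * ln (real n)"
          using n E1 by (intro mult_right_mono) (auto simp: C1_def)
        finally show ?thesis using 2 by (simp add: green_bound_def)
      next
        case 3
        have "w A \<le> A powr (1 - s) / (s - 1)"
          using 3 by (simp add: w_def radial_potential_def s_def divide_right_mono)
        also have "\<dots> \<le> 1 / (1 / 2)"
          using 3 A by (intro frac_le) (auto simp: s_def intro!: powr_nonpos_le_one)
        also have "\<dots> \<le> C1" using lnE E1 by (simp add: C1_def)
        finally show ?thesis using 3 by (simp add: green_bound_def)
      qed
    qed
    have gb0: "0 \<le> green_bound d n" using n by (simp add: green_bound_def)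
    have 3: "v x \<le> K * (C1 + C2) * green_bound CARD('d) n" for x
    proof -
      have "w (sq_norm x + A) \<le> w A"
        unfolding w_def using A sq_norm_nonneg[of x] by (intro radial_potential_antimono) linarith+
      also note wA
      also have "C1 * green_bound d n \<le> (C1 + C2) * green_bound d n"
        using C2 gb0 by (intro mult_right_mono) auto
      finally show ?thesis
        using K0 unfolding v_def d_def mult.assoc by (intro mult_left_mono) auto
    qed
    have sd: "2 * (s - 1 / 2) = real (d - 1)" using d1 by (simp add: s_def of_nat_diff)
    have 4: "(\<Sum>x\<in>lattice_box (2 * n). v x) \<le> K * (C1 + C2) * (real n)\<^sup>2"
    proof -
      have bnd: "w (sq_norm x + A) \<le> 2 * sqrt D * (sq_norm x + A) powr (- (s - 1 / 2))"
        if "x \<in> lattice_box (2 * n)" for x :: "int ^ 'd"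
        unfolding w_def
        by (intro radial_potential_le pos inD s3) (use that in \<open>auto simp: lattice_box_iff\<close>)
      have shell: "(\<Sum>x | sup_norm (x :: int ^ 'd) = k. w (sq_norm x + A)) \<le> 2 * sqrt D * (2 * real d * 3 ^ (d - 1))"
        if k: "1 \<le> k" "k \<le> 2 * n" for k
      proof -
        have "(\<Sum>x | sup_norm (x :: int ^ 'd) = k. w (sq_norm x + A))
            \<le> (\<Sum>x | sup_norm (x :: int ^ 'd) = k. 2 * sqrt D * real k powr (- real (d - 1)))"
        proof (rule sum_mono)
          fix x :: "int ^ 'd" assume "x \<in> {x. sup_norm x = k}"
          then have x: "sup_norm x = k" by simp
          have "w (sq_norm x + A) \<le> 2 * sqrt D * (sq_norm x + A) powr (- (s - 1 / 2))"
            by (rule bnd) (use x k in \<open>auto simp: lattice_box_iff\<close>)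
          also have "(sq_norm x + A) powr (- (s - 1 / 2)) \<le> ((real k)\<^sup>2) powr (- (s - 1 / 2))"
            using sup_norm_sq_le_sq_norm[of x] x A k s3 by (intro powr_mono2') auto
          also have "((real k)\<^sup>2) powr (- (s - 1 / 2)) = real k powr (- real (d - 1))"
            using k unfolding sd[symmetric] by (simp add: powr_powr flip: powr_numeral)
          finally show "w (sq_norm x + A) \<le> 2 * sqrt D * real k powr (- real (d - 1))"
            using D0 by (simp add: mult_left_mono)
        qed
        also have "\<dots> = real (card {x :: int ^ 'd. sup_norm x = k}) * (2 * sqrt D * real k powr (- real (d - 1)))"
          by simp
        also have "\<dots> \<le> (2 * real d * (3 * real k) ^ (d - 1)) * (2 * sqrt D * real k powr (- real (d - 1)))"
        proof (rule mult_right_mono)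
          have "real (card {x :: int ^ 'd. sup_norm x = k}) \<le> real (2 * d * (2 * k + 1) ^ (d - 1))"
            using card_sphere_le(2)[of k, where 'd = 'd] unfolding d_def by (rule of_nat_mono)
          also have "\<dots> = 2 * real d * (real (2 * k + 1)) ^ (d - 1)" by simp
          also have "\<dots> \<le> 2 * real d * (3 * real k) ^ (d - 1)"
            using k by (intro mult_left_mono power_mono) auto
          finally show "real (card {x :: int ^ 'd. sup_norm x = k}) \<le> 2 * real d * (3 * real k) ^ (d - 1)" .
        qed (use D0 in simp)
        also have "\<dots> = 2 * sqrt D * (2 * real d * 3 ^ (d - 1)) * (real k ^ (d - 1) * real k powr (- real (d - 1)))"
          by (simp add: power_mult_distrib algebra_simps)
        also have "real k ^ (d - 1) * real k powr (- real (d - 1)) = 1"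
          using k by (simp add: powr_minus powr_realpow)
        finally show ?thesis by simp
      qed
      have "(\<Sum>x\<in>lattice_box (2 * n). w (sq_norm (x :: int ^ 'd) + A))
          = (\<Sum>x | sup_norm (x :: int ^ 'd) = 0. w (sq_norm x + A))
            + (\<Sum>k\<in>{1..2 * n}. \<Sum>x | sup_norm (x :: int ^ 'd) = k. w (sq_norm x + A))"
        unfolding sum_lattice_box_shells by (simp add: atMost_atLeast0 sum.atLeast_Suc_atMost)
      also have "\<dots> \<le> 2 * sqrt D + (\<Sum>k\<in>{1..2 * n}. 2 * sqrt D * (2 * real d * 3 ^ (d - 1)))"
      proof (intro add_mono sum_mono shell)
        have "w (sq_norm (0 :: int ^ 'd) + A) \<le> 2 * sqrt D * (sq_norm (0 :: int ^ 'd) + A) powr (- (s - 1 / 2))"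
          by (rule bnd) (simp add: lattice_box_def)
        also have "\<dots> \<le> 2 * sqrt D * 1"
          using D0 A s3 by (intro mult_left_mono powr_nonpos_le_one) (auto simp: sq_norm_def)
        finally show "(\<Sum>x | sup_norm (x :: int ^ 'd) = 0. w (sq_norm x + A)) \<le> 2 * sqrt D" by simp
      qed auto
      also have "\<dots> = 2 * sqrt D * (1 + real n * (4 * real d * 3 ^ (d - 1)))"
        by (simp add: algebra_simps)
      also have "\<dots> \<le> 2 * (sqrt E * real n) * (real n + real n * (4 * real d * 3 ^ (d - 1)))"
        using sD n D0 E1 by (intro mult_mono add_mono) auto
      also have "\<dots> = C2 * (real n)\<^sup>2"
        by (simp add: C2_def power2_eq_square algebra_simps)
      also have "\<dots> \<le> (C1 + C2) * (real n)\<^sup>2" using C1 by (intro mult_right_mono) auto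
      finally have "K * (\<Sum>x\<in>lattice_box (2 * n). w (sq_norm (x :: int ^ 'd) + A)) \<le> K * ((C1 + C2) * (real n)\<^sup>2)"
        using K0 by (intro mult_left_mono) auto
      then show ?thesis by (simp add: v_def sum_distrib_left mult.assoc)
    qed
    show "\<exists>v :: int ^ 'd \<Rightarrow> real. green_majorant (K * (C1 + C2)) n v"
      unfolding green_majorant_def using 1 2 3 4 by (intro exI[of _ v]) blast
  qed
qed

section \<open>Lower bound by the potential of the traps\<close>

text \<open>The potential \<open>u(x) = \<Sum>\<^sub>y \<tau>\<^sub>y v(x - y)\<close> satisfies \<open>- \<Delta> u \<ge> \<tau>\<close>, by translation invariance of the
  Laplacian.\<close>

lemma eigenvalue_lower_bound_from_potential:
  fixes \<tau> v :: "int ^ 'd \<Rightarrow> real"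
  assumes tau: "\<And>x. 1 \<le> \<tau> x" and a: "0 \<le> a"
    and nn: "\<And>x. x \<in> lattice_box (2 * n + 1) \<Longrightarrow> 0 \<le> v x"
    and super: "\<And>x. (if x = 0 then 1 else 0) \<le> (\<Sum>y | y \<sim>\<^sub>Z x. v x - v y)"
    and U: "\<And>x. x \<in> lattice_box n \<Longrightarrow> (\<Sum>y\<in>lattice_box n. \<tau> y * v (x - y)) \<le> U"
  shows "1 / U \<le> principal_dirichlet_eigenvalue a \<tau> n"
proof -
  define u where "u x = (\<Sum>y\<in>lattice_box n. \<tau> y * v (x - y))" for x
  have t0: "0 \<le> \<tau> x" for x using tau[of x] by simp
  have diff: "x - y \<in> lattice_box (2 * n + 1)"
    if "x \<in> lattice_box (Suc n)" "y \<in> lattice_box n" for x y :: "int ^ 'd"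
    using that sup_norm_diff_le[of x y] by (auto simp: lattice_box_iff)
  have v0: "0 < v 0"
  proof (rule ccontr)
    assume "\<not> 0 < v 0"
    have "(\<Sum>y | y \<sim>\<^sub>Z (0 :: int ^ 'd). v 0 - v y) \<le> 0"
    proof (rule sum_nonpos)
      fix y :: "int ^ 'd" assume "y \<in> {y. y \<sim>\<^sub>Z 0}"
      then have "y \<in> lattice_box (2 * n + 1)"
        using sup_norm_nearest_nbr[of y 0] sup_norm_eq_0_iff[of "0 :: int ^ 'd"]
        by (simp add: lattice_box_iff del: sup_norm_eq_0_iff)
      then show "v 0 - v y \<le> 0" using nn \<open>\<not> 0 < v 0\<close> by force
    qed
    then show False using super[of 0] by simp
  qed
  have lap: "(\<Sum>z | z \<sim>\<^sub>Z x. u x - u z)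
      = (\<Sum>y\<in>lattice_box n. \<tau> y * (\<Sum>z | z \<sim>\<^sub>Z (x - y). v (x - y) - v z))" for x
  proof -
    have "(\<Sum>z | z \<sim>\<^sub>Z x. u x - u z)
        = (\<Sum>z | z \<sim>\<^sub>Z x. \<Sum>y\<in>lattice_box n. \<tau> y * (v (x - y) - v (z - y)))"
      by (simp add: u_def sum_subtractf right_diff_distrib)
    also have "\<dots> = (\<Sum>y\<in>lattice_box n. \<tau> y * (\<Sum>z | z \<sim>\<^sub>Z x. v (x - y) - v (z - y)))"
      by (subst sum.swap) (simp add: sum_distrib_left)
    also have "\<dots> = (\<Sum>y\<in>lattice_box n. \<tau> y * (\<Sum>z | z \<sim>\<^sub>Z (x - y). v (x - y) - v z))"
      unfolding sum_nearest_nbr by (simp add: algebra_simps)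
    finally show ?thesis .
  qed
  show ?thesis
  proof (rule barta_lower_bound[OF tau a])
    fix x :: "int ^ 'd"
    show "0 \<le> u x" if "x \<in> lattice_box (Suc n)"
      unfolding u_def by (intro sum_nonneg mult_nonneg_nonneg t0 nn diff that)
    assume x: "x \<in> lattice_box n"
    show "u x \<le> U" using U[OF x] by (simp add: u_def)
    have "0 < \<tau> x * v (x - x)" using v0 tau[of x] by simp
    also have "\<dots> \<le> u x"
      unfolding u_def
      by (rule member_le_sum[OF x])
         (use x diff in \<open>auto simp: lattice_box_iff intro!: mult_nonneg_nonneg t0 nn\<close>)
    finally show "0 < u x" .
    have "\<tau> x = (\<Sum>y\<in>lattice_box n. \<tau> y * (if x - y = 0 then 1 else 0))"
      using x by (simp add: if_distrib cong: if_cong)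
    also have "\<dots> \<le> (\<Sum>z | z \<sim>\<^sub>Z x. u x - u z)"
      unfolding lap by (intro sum_mono mult_left_mono super t0)
    finally show "\<tau> x \<le> (\<Sum>z | z \<sim>\<^sub>Z x. u x - u z)" .
  qed
qed

section \<open>Radial test functions\<close>

definition shell_edges :: "int ^ 'd \<Rightarrow> nat \<Rightarrow> ((int ^ 'd) \<times> (int ^ 'd)) set" where
  "shell_edges c k = {(x, y). y \<sim>\<^sub>Z x \<and> sup_norm (x - c) = k \<and> sup_norm (y - c) = Suc k}"

definition shell_conductance :: "real \<Rightarrow> (int ^ 'd \<Rightarrow> real) \<Rightarrow> int ^ 'd \<Rightarrow> nat \<Rightarrow> real" where
  "shell_conductance a \<tau> c k = (\<Sum>(x, y)\<in>shell_edges c k. conductance a \<tau> x y)"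

lemma card_shell_edges_le:
  fixes c :: "int ^ 'd"
  shows "finite (shell_edges c k)"
    and "card (shell_edges c k) \<le> 4 * CARD('d)\<^sup>2 * (2 * k + 1) ^ (CARD('d) - 1)"
proof -
  let ?S = "{x :: int ^ 'd. sup_norm (x - c) = k}"
  have eq: "?S = (\<lambda>x. x + c) ` {x. sup_norm x = k}"
    by (auto simp: image_iff) (metis diff_add_cancel)
  have fin: "finite ?S" unfolding eq by (intro finite_imageI card_sphere_le)
  have "card ?S = card {x :: int ^ 'd. sup_norm x = k}"
    unfolding eq by (rule card_image) (auto simp: inj_on_def)
  then have card: "card ?S \<le> 2 * CARD('d) * (2 * k + 1) ^ (CARD('d) - 1)"
    using card_sphere_le(2)[of k, where 'd = 'd] by simp
  have sub: "shell_edges c k \<subseteq> Sigma ?S (\<lambda>x. {y. y \<sim>\<^sub>Z x})"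
    by (auto simp: shell_edges_def)
  have finS: "finite (Sigma ?S (\<lambda>x. {y. y \<sim>\<^sub>Z x}))"
    using fin finite_nearest_nbr by (intro finite_SigmaI) auto
  show "finite (shell_edges c k)" by (rule finite_subset[OF sub finS])
  have "card (shell_edges c k) \<le> card (Sigma ?S (\<lambda>x. {y. y \<sim>\<^sub>Z x}))"
    by (rule card_mono[OF finS sub])
  also have "\<dots> = card ?S * (2 * CARD('d))"
    using fin finite_nearest_nbr by (subst card_SigmaI) (auto simp: card_nearest_nbr)
  also have "\<dots> \<le> (2 * CARD('d) * (2 * k + 1) ^ (CARD('d) - 1)) * (2 * CARD('d))"
    using card by (rule mult_right_mono) simp
  finally show "card (shell_edges c k) \<le> 4 * CARD('d)\<^sup>2 * (2 * k + 1) ^ (CARD('d) - 1)"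
    by (simp add: power2_eq_square algebra_simps)
qed

lemma supported_in_box_radial:
  fixes c :: "int ^ 'd"
  assumes "\<And>j. N < j \<Longrightarrow> \<phi> j = 0" "sup_norm c + N \<le> n"
  shows "supported_in_box n (\<lambda>x. \<phi> (sup_norm (x - c)))"
  unfolding supported_in_box_def
proof (intro allI impI)
  fix x :: "int ^ 'd" assume "x \<notin> lattice_box n"
  then have "n < sup_norm x" by (simp add: lattice_box_iff)
  moreover have "sup_norm x \<le> sup_norm (x - c) + sup_norm c"
    using sup_norm_add_le[of "x - c" c] by simp
  ultimately show "\<phi> (sup_norm (x - c)) = 0" using assms by (intro assms(1)) linarith
qed

text \<open>Along an edge the distance to the centre changes by at most 1. Edges inside a shell contribute
  nothing, and the edges between two consecutive shells all contribute the same increment.\<close>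

lemma radial_energy_le:
  fixes \<phi> :: "nat \<Rightarrow> real" and c :: "int ^ 'd"
  assumes \<phi>: "\<And>j. N < j \<Longrightarrow> \<phi> j = 0"
  shows "dirichlet_energy a \<tau> n (\<lambda>x. \<phi> (sup_norm (x - c)))
    \<le> (\<Sum>k\<le>N. shell_conductance a \<tau> c k * (\<phi> k - \<phi> (Suc k))\<^sup>2)"
proof -
  define r where "r x = sup_norm (x - c)" for x
  define g where "g x y = conductance a \<tau> x y * (\<phi> (r x) - \<phi> (r y))\<^sup>2" for x y
  have g0: "0 \<le> g x y" for x y by (simp add: g_def)
  have step: "r y \<le> Suc (r x)" if "y \<sim>\<^sub>Z x" for x y
  proof -
    have "(y - c) \<sim>\<^sub>Z (x - c)" using that by (simp add: nearest_nbr_def)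
    then show ?thesis unfolding r_def by (rule sup_norm_nearest_nbr)
  qed
  \<comment> \<open>keep the outward orientation of every edge\<close>
  define u where "u x y = (if r y = Suc (r x) then g x y else 0)" for x y
  have split: "g x y \<le> u x y + u y x" if "(x, y) \<in> box_edges n" for x y
  proof -
    have "r y \<le> Suc (r x)" "r x \<le> Suc (r y)"
      using that step nearest_nbr_sym[of x y] by (auto simp: box_edges_def)
    moreover have "g x y = g y x"
      by (simp add: g_def conductance_commute[of a \<tau> x y] power2_commute)
    moreover have "r x = r y \<Longrightarrow> g x y = 0" by (simp add: g_def)
    ultimately show ?thesis
      using g0[of x y] unfolding u_def by (cases "r x = r y") auto
  qed
  have "dirichlet_energy a \<tau> n (\<lambda>x. \<phi> (sup_norm (x - c))) = (\<Sum>(x, y)\<in>box_edges n. g x y) / 2"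
    by (simp add: dirichlet_form_def g_def r_def power2_eq_square)
  also have "\<dots> \<le> (\<Sum>(x, y)\<in>box_edges n. u x y + u y x) / 2"
    by (intro divide_right_mono sum_mono) (use split in auto)
  also have "\<dots> = ((\<Sum>(x, y)\<in>box_edges n. u x y) + (\<Sum>(x, y)\<in>box_edges n. u y x)) / 2"
    by (simp add: sum.distrib case_prod_unfold)
  also have "\<dots> = (\<Sum>(x, y)\<in>box_edges n. u x y)"
    using sum_box_edges_swap[of u n] by simp
  also have "\<dots> = (\<Sum>p\<in>box_edges n \<inter> (\<Union>k\<le>N. shell_edges c k). case p of (x, y) \<Rightarrow> u x y)"
  proof (rule sum.mono_neutral_right)
    show "\<forall>p\<in>box_edges n - box_edges n \<inter> (\<Union>k\<le>N. shell_edges c k). (case p of (x, y) \<Rightarrow> u x y) = 0"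
    proof
      fix p assume p: "p \<in> box_edges n - box_edges n \<inter> (\<Union>k\<le>N. shell_edges c k)"
      obtain x y where xy: "p = (x, y)" by (cases p)
      have e: "(x, y) \<in> box_edges n" "(x, y) \<notin> (\<Union>k\<le>N. shell_edges c k)"
        using p by (auto simp: xy)
      have "u x y = 0"
      proof (cases "r y = Suc (r x)")
        case True
        then have "(x, y) \<in> shell_edges c (r x)" using e by (auto simp: shell_edges_def r_def box_edges_def)
        then have "N < r x" using e by force
        then show ?thesis using True \<phi> by (simp add: u_def g_def)
      qed (simp add: u_def)
      then show "(case p of (x, y) \<Rightarrow> u x y) = 0" by (simp add: xy)
    qed
  qed auto
  also have "\<dots> \<le> (\<Sum>p\<in>(\<Union>k\<le>N. shell_edges c k). case p of (x, y) \<Rightarrow> u x y)"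
    by (intro sum_mono2) (auto simp: card_shell_edges_le u_def g0)
  also have "\<dots> = (\<Sum>k\<le>N. \<Sum>p\<in>shell_edges c k. case p of (x, y) \<Rightarrow> u x y)"
    by (rule sum.UNION_disjoint) (auto simp: card_shell_edges_le, auto simp: shell_edges_def)
  also have "\<dots> = (\<Sum>k\<le>N. shell_conductance a \<tau> c k * (\<phi> k - \<phi> (Suc k))\<^sup>2)"
  proof (rule sum.cong[OF refl])
    fix k
    have "(\<Sum>p\<in>shell_edges c k. case p of (x, y) \<Rightarrow> u x y)
        = (\<Sum>p\<in>shell_edges c k. (case p of (x, y) \<Rightarrow> conductance a \<tau> x y) * (\<phi> k - \<phi> (Suc k))\<^sup>2)"
      by (rule sum.cong) (auto simp: shell_edges_def u_def g_def r_def)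
    then show "(\<Sum>p\<in>shell_edges c k. case p of (x, y) \<Rightarrow> u x y)
        = shell_conductance a \<tau> c k * (\<phi> k - \<phi> (Suc k))\<^sup>2"
      by (simp add: shell_conductance_def sum_distrib_right)
  qed
  finally show ?thesis .
qed

lemma principal_eigenvalue_le_radial:
  fixes \<phi> :: "nat \<Rightarrow> real" and c :: "int ^ 'd"
  assumes tau: "\<And>x. 1 \<le> \<tau> x"
    and \<phi>: "\<And>j. N < j \<Longrightarrow> \<phi> j = 0" "\<And>j. j \<le> r \<Longrightarrow> \<phi> j = 1"
    and c: "sup_norm c + N \<le> n" and S: "S \<subseteq> {x. sup_norm (x - c) \<le> r}" "S \<subseteq> lattice_box n" "S \<noteq> {}"
    and E: "(\<Sum>k\<le>N. shell_conductance a \<tau> c k * (\<phi> k - \<phi> (Suc k))\<^sup>2) \<le> E"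
  shows "principal_dirichlet_eigenvalue a \<tau> n \<le> E / (\<Sum>x\<in>S. \<tau> x)"
proof (rule principal_eigenvalue_le)
  have t0: "0 \<le> \<tau> x" for x using tau[of x] by simp
  have fin: "finite S" using S(2) finite_lattice_box by (rule finite_subset)
  show "\<forall>x\<in>lattice_box n. \<tau> x \<noteq> 0" using tau by (metis not_one_le_zero)
  show "supported_in_box n (\<lambda>x. \<phi> (sup_norm (x - c)))"
    by (rule supported_in_box_radial[OF \<phi>(1) c])
  show "dirichlet_energy a \<tau> n (\<lambda>x. \<phi> (sup_norm (x - c))) \<le> E"
    using radial_energy_le[OF \<phi>(1)] E by (rule order_trans)
  have "(\<Sum>x\<in>S. \<tau> x) = (\<Sum>x\<in>S. \<bar>\<tau> x\<bar> * (\<phi> (sup_norm (x - c)))\<^sup>2)"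
    using S(1) \<phi>(2) t0 by (intro sum.cong) auto
  also have "\<dots> \<le> trap_mass \<tau> n (\<lambda>x. \<phi> (sup_norm (x - c)))"
    unfolding trap_mass_def by (intro sum_mono2 S) auto
  finally show "(\<Sum>x\<in>S. \<tau> x) \<le> trap_mass \<tau> n (\<lambda>x. \<phi> (sup_norm (x - c)))" .
  have "0 < \<tau> x" for x using tau[of x] by simp
  then show "0 < (\<Sum>x\<in>S. \<tau> x)" using fin S(3) by (intro sum_pos) auto
qed

lemma conductance_le_mult:
  assumes "1 \<le> \<tau> x" "1 \<le> \<tau> y" "0 \<le> a" "a \<le> 1"
  shows "conductance a \<tau> x y \<le> \<tau> x * \<tau> y"
  unfolding conductance_def
  using assms powr_mono[of a 1 "\<tau> x"] powr_mono[of a 1 "\<tau> y"] by (intro mult_mono) auto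

text \<open>The indicator of the ball of radius 1 around \<open>c\<close> is constant on the edges at \<open>c\<close>. Hence the depth
  of the trap enters the denominator of the Rayleigh quotient but, even for \<open>a > 0\<close>, not the energy.\<close>

lemma principal_eigenvalue_le_isolated_trap:
  fixes \<tau> :: "int ^ 'd \<Rightarrow> real"
  assumes tau: "\<And>x. 1 \<le> \<tau> x" and a: "0 \<le> a" "a \<le> 1"
    and c: "sup_norm c + 2 \<le> n" and K: "\<And>y. sup_norm (y - c) \<le> 2 \<Longrightarrow> y \<noteq> c \<Longrightarrow> \<tau> y \<le> K"
  shows "principal_dirichlet_eigenvalue a \<tau> n \<le> 4 * (real CARD('d))\<^sup>2 * 3 ^ (CARD('d) - 1) * K\<^sup>2 / \<tau> c"
proof -
  let ?\<phi> = "\<lambda>j :: nat. if j \<le> 1 then 1 else 0 :: real"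
  have "principal_dirichlet_eigenvalue a \<tau> n
     \<le> (4 * (real CARD('d))\<^sup>2 * 3 ^ (CARD('d) - 1) * K\<^sup>2) / (\<Sum>x\<in>{c}. \<tau> x)"
  proof (rule principal_eigenvalue_le_radial[where \<phi> = ?\<phi> and r = 1 and N = 1, OF tau])
    have "shell_conductance a \<tau> c 1 \<le> (\<Sum>p\<in>shell_edges c 1. K\<^sup>2)"
      unfolding shell_conductance_def
    proof (rule sum_mono)
      fix p assume p: "p \<in> shell_edges c 1"
      obtain x y where xy: "p = (x, y)" by (cases p)
      have n: "sup_norm (x - c) = 1" "sup_norm (y - c) = 2"
        using p by (auto simp: xy shell_edges_def)
      then have "x \<noteq> c" "y \<noteq> c" using sup_norm_eq_0_iff[of "c - c"] by force+
      then have "\<tau> x \<le> K" "\<tau> y \<le> K" using n K by auto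
      moreover have "conductance a \<tau> x y \<le> \<tau> x * \<tau> y" by (rule conductance_le_mult[OF tau tau a])
      moreover have "0 \<le> \<tau> x" "0 \<le> \<tau> y" using tau[of x] tau[of y] by auto
      ultimately have "conductance a \<tau> x y \<le> K * K"
        by (meson mult_mono order_trans)
      then show "(case p of (x, y) \<Rightarrow> conductance a \<tau> x y) \<le> K\<^sup>2"
        by (simp add: xy power2_eq_square)
    qed
    also have "\<dots> = real (card (shell_edges c 1)) * K\<^sup>2" by simp
    also have "\<dots> \<le> real (4 * CARD('d)\<^sup>2 * (2 * 1 + 1) ^ (CARD('d) - 1)) * K\<^sup>2"
      using card_shell_edges_le(2)[of c 1] by (intro mult_right_mono of_nat_mono) auto
    finally have "shell_conductance a \<tau> c 1 \<le> 4 * (real CARD('d))\<^sup>2 * 3 ^ (CARD('d) - 1) * K\<^sup>2"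
      by simp
    moreover have "{..1} = {0, 1 :: nat}" by auto
    ultimately show "(\<Sum>k\<le>1. shell_conductance a \<tau> c k * (?\<phi> k - ?\<phi> (Suc k))\<^sup>2)
        \<le> 4 * (real CARD('d))\<^sup>2 * 3 ^ (CARD('d) - 1) * K\<^sup>2" by simp
    show "{c} \<subseteq> {x. sup_norm (x - c) \<le> 1}" by (simp add: sup_norm_eq_0_iff[THEN iffD2])
  qed (use c in \<open>auto simp: lattice_box_iff\<close>)
  then show ?thesis by simp
qed

text \<open>The profile decreases by \<open>1 / |G|\<close> across every shell in \<open>G\<close> and is constant elsewhere, so that the
  energy is at most \<open>|G| L / |G|\<^sup>2\<close>.\<close>

lemma principal_eigenvalue_le_good_shells:
  fixes \<tau> :: "int ^ 'd \<Rightarrow> real"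
  assumes tau: "\<And>x. 1 \<le> \<tau> x"
    and G: "G \<subseteq> {m..n}" "G \<noteq> {}" "m \<le> n" and L: "\<And>k. k \<in> G \<Longrightarrow> shell_conductance a \<tau> 0 k \<le> L"
    and S: "S \<subseteq> lattice_box m" "S \<noteq> {}"
  shows "principal_dirichlet_eigenvalue a \<tau> n \<le> L / real (card G) / (\<Sum>x\<in>S. \<tau> x)"
proof -
  have fin: "finite G" using G(1) by (rule finite_subset) simp
  then have g0: "0 < card G" using G(2) by (simp add: card_gt_0_iff)
  define \<phi> where "\<phi> j = real (card {k\<in>G. j \<le> k}) / real (card G)" for j
  have diff: "\<phi> k - \<phi> (Suc k) = (if k \<in> G then 1 / real (card G) else 0)" for k
  proof -
    have eq: "{i\<in>G. k \<le> i} = {i\<in>G. Suc k \<le> i} \<union> (G \<inter> {k})" by auto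
    have "card {i\<in>G. k \<le> i} = card {i\<in>G. Suc k \<le> i} + card (G \<inter> {k})"
      unfolding eq by (rule card_Un_disjoint) (use fin in auto)
    then show ?thesis by (auto simp: \<phi>_def add_divide_distrib)
  qed
  show ?thesis
  proof (rule principal_eigenvalue_le_radial[where \<phi> = \<phi> and N = n and r = m and c = 0, OF tau])
    show "\<phi> j = 0" if "n < j" for j
    proof -
      have "{k\<in>G. j \<le> k} = {}" using that G(1) by auto
      then show ?thesis by (simp only: \<phi>_def card.empty)
    qed
    show "\<phi> j = 1" if "j \<le> m" for j
    proof -
      have "{k\<in>G. j \<le> k} = G" using that G(1) by auto
      then show ?thesis using g0 by (simp add: \<phi>_def)
    qed
    have "(\<Sum>k\<le>n. shell_conductance a \<tau> 0 k * (\<phi> k - \<phi> (Suc k))\<^sup>2)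
        = (\<Sum>k\<in>G. shell_conductance a \<tau> 0 k * (1 / real (card G))\<^sup>2)"
    proof -
      have "(\<Sum>k\<in>G. shell_conductance a \<tau> 0 k * (\<phi> k - \<phi> (Suc k))\<^sup>2)
          = (\<Sum>k\<le>n. shell_conductance a \<tau> 0 k * (\<phi> k - \<phi> (Suc k))\<^sup>2)"
        by (rule sum.mono_neutral_left) (use G(1) diff in auto)
      then show ?thesis by (simp add: diff cong: sum.cong)
    qed
    also have "\<dots> \<le> (\<Sum>k\<in>G. L * (1 / real (card G))\<^sup>2)"
      by (intro sum_mono mult_right_mono L) auto
    also have "\<dots> = L / real (card G)" using g0 by (simp add: power2_eq_square)
    finally show "(\<Sum>k\<le>n. shell_conductance a \<tau> 0 k * (\<phi> k - \<phi> (Suc k))\<^sup>2) \<le> L / real (card G)" .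
  qed (use S G lattice_box_mono[of m n] in \<open>auto simp: lattice_box_iff\<close>)
qed

text \<open>The profile \<open>1 - H\<^sub>k / H\<^sub>N\<^sub>+\<^sub>1\<close>, with the harmonic numbers in place of the logarithm, has increments
  \<open>1 / ((k + 1) H\<^sub>N\<^sub>+\<^sub>1)\<close>. A shell has of order \<open>k\<close> edges, all of conductance 1, so the energy is
  of order \<open>\<Sum> 1 / (k H\<^sub>N\<^sub>+\<^sub>1\<^sup>2) \<approx> 1 / H\<^sub>N\<^sub>+\<^sub>1\<close>.\<close>

lemma principal_eigenvalue_le_planar_trap:
  fixes \<tau> :: "int ^ 'd \<Rightarrow> real"
  assumes tau: "\<And>x. 1 \<le> \<tau> x" and d: "CARD('d) = 2"
    and n: "4 \<le> n" and c: "c \<in> lattice_box (n div 2)"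
  shows "principal_dirichlet_eigenvalue 0 \<tau> n \<le> 64 / ln (real n) / \<tau> c"
proof -
  define N where "N = n div 2"
  define H :: real where "H = harm (Suc N)"
  have H0: "0 < H" unfolding H_def by (simp add: harm_pos)
  define \<psi> where "\<psi> j = (if j = 0 then 1 else if j \<le> N then 1 - harm j / H else 0 :: real)" for j :: nat
  have diff: "\<psi> k - \<psi> (Suc k) = 1 / (real (Suc k) * H)" if "k \<le> N" for k
  proof -
    have hs: "harm (Suc k) = harm k + 1 / real (Suc k)"
      by (simp add: harm_Suc inverse_eq_divide)
    have p: "\<psi> k = 1 - harm k / H" using that by (simp add: \<psi>_def harm_expand)
    have "\<psi> (Suc k) = 1 - harm (Suc k) / H"
    proof (cases "k = N")
      case True
      then have "harm (Suc k) / H = 1" using H0 by (simp add: True flip: H_def)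
      then show ?thesis using True by (simp add: \<psi>_def)
    next
      case False
      then show ?thesis using that by (simp add: \<psi>_def)
    qed
    then show ?thesis unfolding p hs using H0 by (simp add: add_divide_distrib)
  qed
  have "principal_dirichlet_eigenvalue 0 \<tau> n \<le> 32 / H / (\<Sum>x\<in>{c}. \<tau> x)"
  proof (rule principal_eigenvalue_le_radial[where \<phi> = \<psi> and N = N and r = 0, OF tau])
    show "(\<Sum>k\<le>N. shell_conductance 0 \<tau> c k * (\<psi> k - \<psi> (Suc k))\<^sup>2) \<le> 32 / H"
    proof -
      have "shell_conductance 0 \<tau> c k * (\<psi> k - \<psi> (Suc k))\<^sup>2 \<le> 32 / H\<^sup>2 * inverse (real (Suc k))"
        if "k \<le> N" for k
      proof -
        have "shell_conductance 0 \<tau> c k = (\<Sum>p\<in>shell_edges c k. 1)"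
          unfolding shell_conductance_def
        proof (rule sum.cong[OF refl])
          fix p assume "p \<in> shell_edges c k"
          have "\<tau> x \<noteq> 0" for x using tau[of x] by auto
          then show "(case p of (x, y) \<Rightarrow> conductance 0 \<tau> x y) = 1"
            by (auto simp: conductance_def)
        qed
        also have "\<dots> = real (card (shell_edges c k))" by simp
        also have "\<dots> \<le> real (4 * CARD('d)\<^sup>2 * (2 * k + 1) ^ (CARD('d) - 1))"
          by (rule of_nat_mono) (rule card_shell_edges_le)
        also have "\<dots> = 16 * real (2 * k + 1)" by (simp add: d)
        also have "\<dots> \<le> 32 * real (Suc k)" by simp
        finally have "shell_conductance 0 \<tau> c k * (\<psi> k - \<psi> (Suc k))\<^sup>2
            \<le> 32 * real (Suc k) * (\<psi> k - \<psi> (Suc k))\<^sup>2"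
          by (rule mult_right_mono) simp
        also have "\<dots> = 32 / H\<^sup>2 * inverse (real (Suc k))"
        proof -
          have m: "32 * m * (1 / (m * H))\<^sup>2 = 32 / H\<^sup>2 * inverse m" if "0 < m" for m :: real
            using H0 that by (simp add: field_simps power2_eq_square)
          show ?thesis unfolding diff[OF that] by (rule m) simp
        qed
        finally show ?thesis .
      qed
      then have "(\<Sum>k\<le>N. shell_conductance 0 \<tau> c k * (\<psi> k - \<psi> (Suc k))\<^sup>2)
          \<le> (\<Sum>k\<le>N. 32 / H\<^sup>2 * inverse (real (Suc k)))"
        by (intro sum_mono) auto
      also have "\<dots> = 32 / H\<^sup>2 * (\<Sum>k\<le>N. inverse (real (Suc k)))"
        by (simp only: sum_distrib_left)
      also have "(\<Sum>k\<le>N. inverse (real (Suc k))) = H"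
        unfolding H_def harm_altdef lessThan_Suc_atMost ..
      also have "32 / H\<^sup>2 * H = 32 / H" by (simp add: power2_eq_square)
      finally show ?thesis .
    qed
    show "{c} \<subseteq> {x. sup_norm (x - c) \<le> 0}" by (auto simp: sup_norm_eq_0_iff)
  qed (use c in \<open>auto simp: lattice_box_iff N_def \<psi>_def\<close>)
  also have "\<dots> = 32 / H / \<tau> c" by simp
  also have "\<dots> \<le> 64 / ln (real n) / \<tau> c"
  proof (rule divide_right_mono)
    \<comment> \<open>the radius \<open>N\<close> is about \<open>n / 2\<close>, whose logarithm is at least half of \<open>ln n\<close>\<close>
    have "sqrt (real n) \<le> real N + 2"
    proof (rule real_le_lsqrt)
      have "real n \<le> 2 * real N + 1" unfolding N_def by linarith
      also have "\<dots> \<le> (real N + 2)\<^sup>2" by (simp add: power2_eq_square algebra_simps)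
      finally show "real n \<le> (real N + 2)\<^sup>2" .
    qed auto
    then have "ln (sqrt (real n)) \<le> ln (real N + 2)" using n by (intro ln_mono) auto
    also have "\<dots> \<le> H"
      using ln_le_harm[of "Suc N"] by (simp add: H_def add.commute)
    finally have "ln (real n) / 2 \<le> H" using n by (simp add: ln_sqrt)
    moreover have "0 < ln (real n)" using n by simp
    ultimately have "32 / H \<le> 32 / (ln (real n) / 2)"
      using H0 by (intro divide_left_mono) auto
    then show "32 / H \<le> 64 / ln (real n)" by simp
    show "0 \<le> \<tau> c" using tau[of c] by simp
  qed
  finally show ?thesis .
qed

section \<open>Sums of bounded independent variables\<close>

text \<open>Exponential Markov inequality at the inverse \<open>1 / b\<close> of the bound, with \<open>exp u \<le> 1 + 2 u\<close> on
  \<open>[0, 1]\<close>. Only the means and the bound enter, which suits truncated heavy-tailed variables.\<close>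

lemma (in prob_space) prob_sum_ge_le_exp:
  assumes fin: "finite I" and ind: "indep_vars (\<lambda>_. borel) X I" and b: "0 < b"
    and X: "\<And>i \<omega>. i \<in> I \<Longrightarrow> 0 \<le> X i \<omega> \<and> X i \<omega> \<le> b"
  shows "prob {\<omega>\<in>space M. K \<le> (\<Sum>i\<in>I. X i \<omega>)} \<le> exp ((2 * (\<Sum>i\<in>I. expectation (X i)) - K) / b)"
proof -
  have rv [measurable]: "X i \<in> borel_measurable M" if "i \<in> I" for i
    using ind that by (auto simp: indep_vars_def)
  let ?Y = "\<lambda>i \<omega>. exp (X i \<omega> / b)"
  have ind': "indep_vars (\<lambda>_. borel) ?Y I"
    using ind by (rule indep_vars_compose2) measurable
  have Yb: "?Y i \<omega> \<le> exp 1" if "i \<in> I" for i \<omega>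
    using X[OF that] b by (simp add: pos_divide_le_eq)
  have intX: "integrable M (X i)" if "i \<in> I" for i
    using X[OF that] rv[OF that] by (intro integrable_const_bound[where B = b]) auto
  have intY: "integrable M (?Y i)" if "i \<in> I" for i
    using Yb[OF that] rv[OF that] by (intro integrable_const_bound[where B = "exp 1"]) auto
  have EY: "expectation (?Y i) \<le> exp (2 * expectation (X i) / b)" if i: "i \<in> I" for i
  proof -
    have "expectation (?Y i) \<le> expectation (\<lambda>\<omega>. 1 + 2 / b * X i \<omega>)"
    proof (rule integral_mono[OF intY[OF i]])
      show "integrable M (\<lambda>\<omega>. 1 + 2 / b * X i \<omega>)" using intX[OF i] by auto
      fix \<omega>
      have u: "0 \<le> X i \<omega> / b" "X i \<omega> / b \<le> 1" using X[OF i, of \<omega>] b by auto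
      have "?Y i \<omega> \<le> 1 + X i \<omega> / b + (X i \<omega> / b)\<^sup>2" by (rule exp_bound[OF u])
      also have "(X i \<omega> / b)\<^sup>2 \<le> X i \<omega> / b"
        using mult_left_mono[OF u(2) u(1)] by (simp add: power2_eq_square)
      finally show "?Y i \<omega> \<le> 1 + 2 / b * X i \<omega>" by simp
    qed
    also have "\<dots> = 1 + 2 * expectation (X i) / b"
      using intX[OF i] by (simp add: prob_space)
    also have "\<dots> \<le> exp (2 * expectation (X i) / b)" by (rule exp_ge_add_one_self)
    finally show ?thesis .
  qed
  have prod: "exp ((\<Sum>i\<in>I. X i \<omega>) / b) = (\<Prod>i\<in>I. ?Y i \<omega>)" for \<omega>
    using fin by (simp add: sum_divide_distrib exp_sum)
  have E: "expectation (\<lambda>\<omega>. exp ((\<Sum>i\<in>I. X i \<omega>) / b)) = (\<Prod>i\<in>I. expectation (?Y i))"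
    unfolding prod by (rule indep_vars_lebesgue_integral[OF fin ind' intY])
  have int: "integrable M (\<lambda>\<omega>. exp ((\<Sum>i\<in>I. X i \<omega>) / b))"
    unfolding prod by (rule indep_vars_integrable[OF fin ind' intY])
  have "{\<omega>\<in>space M. K \<le> (\<Sum>i\<in>I. X i \<omega>)}
      = {\<omega>\<in>space M. exp (K / b) \<le> exp ((\<Sum>i\<in>I. X i \<omega>) / b)}"
    using b by (simp add: divide_le_cancel)
  then have "prob {\<omega>\<in>space M. K \<le> (\<Sum>i\<in>I. X i \<omega>)}
      \<le> expectation (\<lambda>\<omega>. exp ((\<Sum>i\<in>I. X i \<omega>) / b)) / exp (K / b)"
    using integral_Markov_inequality_measure[OF int, of "{}" "exp (K / b)"] by simp
  also have "\<dots> \<le> (\<Prod>i\<in>I. exp (2 * expectation (X i) / b)) / exp (K / b)"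
    unfolding E by (intro divide_right_mono prod_mono) (use EY in \<open>auto intro!: integral_nonneg\<close>)
  also have "\<dots> = exp ((2 * (\<Sum>i\<in>I. expectation (X i)) - K) / b)"
    using fin by (simp add: exp_sum[symmetric] exp_diff[symmetric] diff_divide_distrib
        sum_divide_distrib[symmetric] sum_distrib_left[symmetric])
  finally show ?thesis .
qed

lemma (in prob_space) prob_none_le_exp:
  assumes fin: "finite J" and ind: "indep_vars N X J"
    and A: "\<And>j. j \<in> J \<Longrightarrow> A j \<in> sets (N j)"
    and q: "\<And>j. j \<in> J \<Longrightarrow> q \<le> prob (X j -` A j \<inter> space M)" and q0: "0 \<le> q"
  shows "prob {\<omega>\<in>space M. \<forall>j\<in>J. X j \<omega> \<notin> A j} \<le> exp (- (real (card J) * q))"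
proof (cases "J = {}")
  case True
  then show ?thesis by (simp add: prob_space)
next
  case False
  have rv: "X j \<in> measurable M (N j)" if "j \<in> J" for j using ind that by (auto simp: indep_vars_def)
  let ?B = "\<lambda>j. space (N j) - A j"
  have "{\<omega>\<in>space M. \<forall>j\<in>J. X j \<omega> \<notin> A j} = (\<Inter>j\<in>J. X j -` ?B j \<inter> space M)"
    using False rv by (auto dest: measurable_space)
  then have "prob {\<omega>\<in>space M. \<forall>j\<in>J. X j \<omega> \<notin> A j} = (\<Prod>j\<in>J. prob (X j -` ?B j \<inter> space M))"
    using indep_varsD_finite[OF ind False fin, of ?B] A by auto
  also have "\<dots> \<le> (\<Prod>j\<in>J. exp (- q))"
  proof (intro prod_mono conjI)
    fix j assume j: "j \<in> J"
    have "X j -` ?B j \<inter> space M = space M - (X j -` A j \<inter> space M)"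
      using measurable_space[OF rv[OF j]] by auto
    then have "prob (X j -` ?B j \<inter> space M) = 1 - prob (X j -` A j \<inter> space M)"
      using prob_compl[of "X j -` A j \<inter> space M"] rv[OF j] A[OF j] by (simp add: measurable_sets)
    also have "\<dots> \<le> 1 + - q" using q[OF j] by simp
    also have "\<dots> \<le> exp (- q)" by (rule exp_ge_add_one_self)
    finally show "prob (X j -` ?B j \<inter> space M) \<le> exp (- q)" .
  qed simp
  also have "\<dots> = exp (- (real (card J) * q))" by (simp add: exp_of_nat_mult[symmetric])
  finally show ?thesis .
qed

section \<open>Regularly varying tails\<close>

text \<open>Regular variation enters only through the ratio of the tail at \<open>2 t\<close> and \<open>t\<close>; this induction turns
  such doubling estimates into bounds for all large \<open>t\<close>.\<close>

lemma doubling_induct: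
  fixes P :: "real \<Rightarrow> bool"
  assumes t0: "0 < t0" and base: "\<And>t. t0 \<le> t \<Longrightarrow> t \<le> 2 * t0 \<Longrightarrow> P t"
    and step: "\<And>t. t0 \<le> t \<Longrightarrow> P t \<Longrightarrow> P (2 * t)" and t: "t0 \<le> t"
  shows "P t"
proof -
  have *: "P t" if "t0 \<le> t" "t \<le> 2 ^ k * t0" for k t
    using that
  proof (induction k arbitrary: t)
    case 0
    then show ?case using base t0 by auto
  next
    case (Suc k)
    show ?case
    proof (cases "t \<le> 2 * t0")
      case True
      then show ?thesis using base Suc by simp
    next
      case False
      then have "P (t / 2)" using Suc by (intro Suc.IH) auto
      then show ?thesis using step[of "t / 2"] False by simp
    qed
  qed
  obtain k :: nat where "t / t0 < 2 ^ k" using real_arch_pow[of 2 "t / t0"] by auto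
  then show ?thesis using t t0 by (intro *[of t k]) (simp_all add: pos_divide_less_eq)
qed

text \<open>The properties of the tail function of a variable that is at least 1.\<close>

locale regular_tail =
  fixes F :: "real \<Rightarrow> real" and \<alpha> :: real
  assumes tail_antimono: "x \<le> y \<Longrightarrow> F y \<le> F x"
    and tail_nonneg: "0 \<le> F x" and tail_le_1: "F x \<le> 1"
    and tail_eq_1: "x < 1 \<Longrightarrow> F x = 1"
    and alpha_pos: "0 < \<alpha>"
    and tail_rv: "regularly_varying F (- \<alpha>)"
begin

lemma tail_ratio: "0 < \<kappa> \<Longrightarrow> ((\<lambda>x. F (\<kappa> * x) / F x) \<longlongrightarrow> \<kappa> powr (- \<alpha>)) at_top"
  using tail_rv by (simp add: regularly_varying_def)

text \<open>As \<open>z / 0 = 0\<close>, convergence of the ratios to a positive limit excludes zeros of \<open>F\<close> far out, hence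
  everywhere by monotonicity.\<close>

lemma tail_pos: "0 < F x"
proof -
  have "\<forall>\<^sub>F y in at_top. 1 / 2 < F (1 * y) / F y"
    by (rule order_tendstoD(1)[OF tail_ratio]) auto
  then have "\<forall>\<^sub>F y in at_top. F y \<noteq> 0"
    by (rule eventually_mono) auto
  then obtain y0 where y0: "\<And>y. y0 \<le> y \<Longrightarrow> F y \<noteq> 0"
    by (auto simp: eventually_at_top_linorder)
  define y where "y = max x y0"
  have y: "x \<le> y" "F y \<noteq> 0" using y0[of y] by (auto simp: y_def)
  then show ?thesis using tail_antimono[of x y] tail_nonneg[of y] by linarith
qed

lemma tail_doubling_upper:
  assumes "p < \<alpha>"
  obtains t0 where "1 \<le> t0" "\<And>t. t0 \<le> t \<Longrightarrow> F (2 * t) \<le> 2 powr (- p) * F t"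
proof -
  have "\<forall>\<^sub>F t in at_top. F (2 * t) / F t < 2 powr (- p)"
    by (rule order_tendstoD(2)[OF tail_ratio]) (use assms in auto)
  then obtain t1 where "\<And>t. t1 \<le> t \<Longrightarrow> F (2 * t) / F t < 2 powr (- p)"
    by (auto simp: eventually_at_top_linorder)
  then show ?thesis
    by (intro that[of "max 1 t1"]) (auto simp: pos_divide_less_eq tail_pos less_imp_le)
qed

lemma tail_doubling_lower:
  assumes "\<alpha> < p"
  obtains t0 where "1 \<le> t0" "\<And>t. t0 \<le> t \<Longrightarrow> 2 powr (- p) * F t \<le> F (2 * t)"
proof -
  have "\<forall>\<^sub>F t in at_top. 2 powr (- p) < F (2 * t) / F t"
    by (rule order_tendstoD(1)[OF tail_ratio]) (use assms in auto)
  then obtain t1 where "\<And>t. t1 \<le> t \<Longrightarrow> 2 powr (- p) < F (2 * t) / F t"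
    by (auto simp: eventually_at_top_linorder)
  then show ?thesis
    by (intro that[of "max 1 t1"]) (auto simp: pos_less_divide_eq tail_pos less_imp_le)
qed

text \<open>One half of Potter's bounds: \<open>t\<^sup>p F(t)\<close> eventually does not increase under doubling, as the ratio of the
  tails converges to \<open>2\<^sup>-\<^sup>\<alpha> < 2\<^sup>-\<^sup>p\<close>. The opposite half follows below.\<close>

lemma tail_upper_bound:
  assumes p: "0 < p" "p < \<alpha>"
  obtains C where "1 \<le> C" "\<And>t. 1 \<le> t \<Longrightarrow> F t \<le> C * t powr (- p)"
proof -
  obtain t0 where t0: "1 \<le> t0" "\<And>t. t0 \<le> t \<Longrightarrow> F (2 * t) \<le> 2 powr (- p) * F t"
    using tail_doubling_upper[OF p(2)] by blast
  define C where "C = (2 * t0) powr p"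
  have small: "F t \<le> C * t powr (- p)" if "1 \<le> t" "t \<le> 2 * t0" for t
  proof -
    have "1 \<le> (2 * t0 / t) powr p" using that p by (intro ge_one_powr_ge_zero) auto
    also have "\<dots> = C * t powr (- p)"
      using that by (simp add: C_def powr_divide powr_minus_divide)
    finally show ?thesis using tail_le_1[of t] by linarith
  qed
  have "F t \<le> C * t powr (- p)" if t: "1 \<le> t" for t
  proof (cases "t \<le> t0")
    case True
    then show ?thesis using small t t0 by simp
  next
    case False
    have "F t \<le> C * t powr (- p)" if "t0 \<le> t" for t
      using that
    proof (rule doubling_induct[of t0 "\<lambda>t. F t \<le> C * t powr (- p)", rotated -1])
      fix t assume t: "t0 \<le> t" "F t \<le> C * t powr (- p)"
      have "F (2 * t) \<le> 2 powr (- p) * F t" by (rule t0(2)[OF t(1)])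
      also have "\<dots> \<le> 2 powr (- p) * (C * t powr (- p))" using t(2) by (intro mult_left_mono) auto
      also have "\<dots> = C * (2 * t) powr (- p)" using t t0 by (simp add: powr_mult)
      finally show "F (2 * t) \<le> C * (2 * t) powr (- p)" .
    qed (use small t0 in auto)
    then show ?thesis using False by simp
  qed
  moreover have "1 \<le> C" unfolding C_def using t0 p by (intro ge_one_powr_ge_zero) auto
  ultimately show ?thesis using that by blast
qed

lemma tail_lower_bound:
  assumes p: "\<alpha> < p"
  obtains c where "0 < c" "\<And>t. 1 \<le> t \<Longrightarrow> c * t powr (- p) \<le> F t"
proof -
  obtain t0 where t0: "1 \<le> t0" "\<And>t. t0 \<le> t \<Longrightarrow> 2 powr (- p) * F t \<le> F (2 * t)"
    using tail_doubling_lower[OF p] by blast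
  define c where "c = F (2 * t0)"
  have c0: "0 < c" by (simp add: c_def tail_pos)
  have p0: "0 < p" using p alpha_pos by simp
  have small: "c * t powr (- p) \<le> F t" if "1 \<le> t" "t \<le> 2 * t0" for t
  proof -
    have "c * t powr (- p) \<le> c * 1"
      using that p0 c0 by (intro mult_left_mono powr_nonpos_le_one) auto
    also have "\<dots> \<le> F t" unfolding c_def using tail_antimono[OF that(2)] by simp
    finally show ?thesis .
  qed
  have "c * t powr (- p) \<le> F t" if t: "1 \<le> t" for t
  proof (cases "t \<le> t0")
    case True
    then show ?thesis using small t t0 by simp
  next
    case False
    have "c * t powr (- p) \<le> F t" if "t0 \<le> t" for t
      using that
    proof (rule doubling_induct[of t0 "\<lambda>t. c * t powr (- p) \<le> F t", rotated -1])
      fix t assume t: "t0 \<le> t" "c * t powr (- p) \<le> F t"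
      have "c * (2 * t) powr (- p) = 2 powr (- p) * (c * t powr (- p))"
        using t t0 by (simp add: powr_mult)
      also have "\<dots> \<le> 2 powr (- p) * F t" using t(2) by (intro mult_left_mono) auto
      also have "\<dots> \<le> F (2 * t)" by (rule t0(2)[OF t(1)])
      finally show "c * (2 * t) powr (- p) \<le> F (2 * t)" .
    qed (use small t0 in auto)
    then show ?thesis using False by simp
  qed
  then show ?thesis using that c0 by blast
qed

lemma tail_tendsto_0: "(F \<longlongrightarrow> 0) at_top"
proof -
  obtain C where C: "\<And>t. 1 \<le> t \<Longrightarrow> F t \<le> C * t powr (- (\<alpha> / 2))"
    using tail_upper_bound[of "\<alpha> / 2"] alpha_pos by auto
  show ?thesis
  proof (rule tendsto_sandwich)
    show "\<forall>\<^sub>F t in at_top. 0 \<le> F t" using tail_nonneg by simp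
    show "\<forall>\<^sub>F t in at_top. F t \<le> C * t powr (- (\<alpha> / 2))"
      using eventually_ge_at_top[of 1] by eventually_elim (rule C)
    have "((\<lambda>t. t powr (- (\<alpha> / 2))) \<longlongrightarrow> 0) at_top"
      using alpha_pos by (intro tendsto_neg_powr filterlim_ident) auto
    from tendsto_mult_left[OF this, of C] show "((\<lambda>t. C * t powr (- (\<alpha> / 2))) \<longlongrightarrow> 0) at_top"
      by simp
  qed auto
qed

definition quantile :: "real \<Rightarrow> real" where "quantile = tail_quantile F"

lemma quantile_set:
  assumes "1 < x"
  shows "{y. x \<le> 1 / F y} \<noteq> {}" "bdd_below {y. x \<le> 1 / F y}" "\<And>y. x \<le> 1 / F y \<Longrightarrow> 1 \<le> y"
proof -
  have "\<forall>\<^sub>F y in at_top. F y < 1 / x"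
    by (rule order_tendstoD(2)[OF tail_tendsto_0]) (use assms in auto)
  then obtain y where y: "F y < 1 / x" by (auto simp: eventually_at_top_linorder)
  have "x \<le> 1 / F y" using y assms tail_pos[of y] by (simp add: field_simps)
  then show "{y. x \<le> 1 / F y} \<noteq> {}" by blast
  show ge: "1 \<le> y" if "x \<le> 1 / F y" for y
  proof (rule ccontr)
    assume "\<not> 1 \<le> y"
    then show False using that tail_eq_1[of y] assms by simp
  qed
  show "bdd_below {y. x \<le> 1 / F y}" by (rule bdd_belowI[of _ 1]) (use ge in auto)
qed

lemma quantile_ge_1: "1 < x \<Longrightarrow> 1 \<le> quantile x"
  unfolding quantile_def tail_quantile_def
  by (rule cInf_greatest) (use quantile_set in auto)

lemma tail_above_quantile:
  assumes "1 < x" "quantile x < y" shows "F y \<le> 1 / x"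
proof -
  obtain z where z: "x \<le> 1 / F z" "z < y"
    using assms cInf_lessD[OF quantile_set(1)] by (auto simp: quantile_def tail_quantile_def)
  have "F z \<le> 1 / x" using z(1) assms(1) tail_pos[of z] by (simp add: field_simps)
  then show ?thesis using tail_antimono[of z y] z(2) by simp
qed

lemma tail_below_quantile:
  assumes "1 < x" "y < quantile x" shows "1 / x < F y"
proof -
  have "\<not> x \<le> 1 / F y"
    using assms cInf_lower[OF _ quantile_set(2)[OF assms(1)], of y]
    by (auto simp: quantile_def tail_quantile_def)
  then show ?thesis using assms(1) tail_pos[of y] by (simp add: field_simps)
qed

lemma quantile_at_top: "filterlim quantile at_top at_top"
  unfolding filterlim_at_top
proof
  fix Z :: real
  have "\<forall>\<^sub>F x in at_top. max 1 (1 / F (max 1 Z)) < x" by (rule eventually_gt_at_top)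
  then show "\<forall>\<^sub>F x in at_top. Z \<le> quantile x"
  proof eventually_elim
    case (elim x)
    show ?case
    proof (rule ccontr)
      assume "\<not> Z \<le> quantile x"
      then have "F (max 1 Z) \<le> 1 / x" using elim by (intro tail_above_quantile) auto
      then show False using elim tail_pos[of "max 1 Z"] by (simp add: field_simps)
    qed
  qed
qed

text \<open>At a point slightly above the quantile the tail is at most \<open>1 / x\<close>; regular variation transports
  this to a multiple of the quantile. Using the point \<open>2 h(x)\<close> avoids continuity questions at \<open>h(x)\<close>.\<close>

lemma tail_quantile_upper:
  assumes L: "0 < L"
  shows "\<forall>\<^sub>F x in at_top. x * F (L * quantile x) \<le> 2 * (L / 2) powr (- \<alpha>)"
proof -
  have lim: "filterlim (\<lambda>x. 2 * quantile x) at_top at_top"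
    by (rule filterlim_tendsto_pos_mult_at_top[OF tendsto_const _ quantile_at_top]) simp
  have "\<forall>\<^sub>F y in at_top. F (L / 2 * y) / F y < 2 * (L / 2) powr (- \<alpha>)"
    by (rule order_tendstoD(2)[OF tail_ratio]) (use L in auto)
  from this[THEN eventually_compose_filterlim, OF lim]
  have "\<forall>\<^sub>F x in at_top. F (L * quantile x) / F (2 * quantile x) < 2 * (L / 2) powr (- \<alpha>)" by simp
  then show ?thesis
    using eventually_gt_at_top[of 1]
  proof eventually_elim
    case (elim x)
    have "F (2 * quantile x) \<le> 1 / x"
      using quantile_ge_1[OF elim(2)] by (intro tail_above_quantile elim) auto
    then have "x * F (2 * quantile x) \<le> 1" using elim by (simp add: field_simps)
    then have "x * F (2 * quantile x) * (F (L * quantile x) / F (2 * quantile x))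
        \<le> 1 * (2 * (L / 2) powr (- \<alpha>))"
      using elim tail_nonneg by (intro mult_mono) auto
    then show ?case using tail_pos[of "2 * quantile x"] by simp
  qed
qed

lemma tail_quantile_lower:
  assumes L: "0 < L"
  shows "\<forall>\<^sub>F x in at_top. (2 * L) powr (- \<alpha>) / 2 \<le> x * F (L * quantile x)"
proof -
  have lim: "filterlim (\<lambda>x. 1 / 2 * quantile x) at_top at_top"
    by (rule filterlim_tendsto_pos_mult_at_top[OF tendsto_const _ quantile_at_top]) simp
  have "\<forall>\<^sub>F y in at_top. (2 * L) powr (- \<alpha>) / 2 < F (2 * L * y) / F y"
    by (rule order_tendstoD(1)[OF tail_ratio]) (use L in auto)
  from this[THEN eventually_compose_filterlim, OF lim]
  have "\<forall>\<^sub>F x in at_top. (2 * L) powr (- \<alpha>) / 2 < F (L * quantile x) / F (1 / 2 * quantile x)" by simp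
  then show ?thesis
    using eventually_gt_at_top[of 1]
  proof eventually_elim
    case (elim x)
    have "1 / x < F (1 / 2 * quantile x)"
      using quantile_ge_1[OF elim(2)] by (intro tail_below_quantile elim) auto
    then have "1 \<le> x * F (1 / 2 * quantile x)" using elim by (simp add: field_simps)
    then have "1 * ((2 * L) powr (- \<alpha>) / 2)
        \<le> x * F (1 / 2 * quantile x) * (F (L * quantile x) / F (1 / 2 * quantile x))"
      using elim by (intro mult_mono) auto
    then show ?case using tail_pos[of "1 / 2 * quantile x"] by simp
  qed
qed

end

section \<open>The random environment\<close>

text \<open>The bound \<open>\<tau> \<ge> 1\<close> is assumed everywhere here; the last section reduces the almost sure case to this
  one.\<close>

locale trap_environment = prob_space M for M :: "'w measure" +
  fixes \<tau> :: "int ^ 'd \<Rightarrow> 'w \<Rightarrow> real" and \<alpha> :: real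
  assumes indep: "indep_vars (\<lambda>_. borel) \<tau> UNIV"
    and ident: "distr M borel (\<tau> x) = distr M borel (\<tau> 0)"
    and tau_ge_1: "1 \<le> \<tau> x \<omega>"
    and alpha_positive: "0 < \<alpha>"
    and tail_regular: "regularly_varying (tail_prob M (\<tau> 0)) (- \<alpha>)"
begin

abbreviation F :: "real \<Rightarrow> real" where "F \<equiv> tail_prob M (\<tau> 0)"

lemma tau_measurable [measurable]: "\<tau> x \<in> borel_measurable M"
  using indep by (auto simp: indep_vars_def)

lemma tau_nonneg: "0 \<le> \<tau> x \<omega>" using tau_ge_1[of x \<omega>] by simp

sublocale regular_tail F \<alpha>
proof
  show "F y \<le> F x" if "x \<le> y" for x y
    unfolding tail_prob_def using that by (intro finite_measure_mono) auto
  show "F x = 1" if "x < 1" for x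
  proof -
    have "{\<omega>\<in>space M. x < \<tau> 0 \<omega>} = space M" using that tau_ge_1[of 0] by (auto intro: less_le_trans)
    then show ?thesis by (simp add: tail_prob_def prob_space)
  qed
qed (use alpha_positive tail_regular in \<open>auto simp: tail_prob_def\<close>)

lemma prob_tau_in:
  assumes "A \<in> sets borel"
  shows "prob (\<tau> x -` A \<inter> space M) = prob (\<tau> 0 -` A \<inter> space M)"
proof -
  have "measure (distr M borel (\<tau> x)) A = measure (distr M borel (\<tau> 0)) A" by (simp only: ident[of x])
  then show ?thesis using assms by (simp add: measure_distr)
qed

lemma prob_tau_gt: "prob {\<omega>\<in>space M. m < \<tau> x \<omega>} = F m"
proof -
  have "prob {\<omega>\<in>space M. m < \<tau> x \<omega>} = prob (\<tau> x -` {m<..} \<inter> space M)"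
    by (rule arg_cong[where f = prob]) auto
  also have "\<dots> = prob (\<tau> 0 -` {m<..} \<inter> space M)" by (rule prob_tau_in) simp
  also have "\<dots> = F m"
    unfolding tail_prob_def by (rule arg_cong[where f = prob]) auto
  finally show ?thesis .
qed

lemma expectation_tau:
  fixes g :: "real \<Rightarrow> real"
  assumes [measurable]: "g \<in> borel_measurable borel"
  shows "expectation (\<lambda>\<omega>. g (\<tau> x \<omega>)) = expectation (\<lambda>\<omega>. g (\<tau> 0 \<omega>))"
proof -
  have "expectation (\<lambda>\<omega>. g (\<tau> x \<omega>)) = integral\<^sup>L (distr M borel (\<tau> x)) g"
    by (rule integral_distr[symmetric]) measurable
  also have "\<dots> = expectation (\<lambda>\<omega>. g (\<tau> 0 \<omega>))"
    unfolding ident[of x] by (rule integral_distr) measurable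
  finally show ?thesis .
qed

lemma prob_max_gt_le:
  assumes "finite S"
  shows "prob {\<omega>\<in>space M. \<exists>x\<in>S. m < \<tau> x \<omega>} \<le> real (card S) * F m"
proof -
  have "{\<omega>\<in>space M. \<exists>x\<in>S. m < \<tau> x \<omega>} = (\<Union>x\<in>S. {\<omega>\<in>space M. m < \<tau> x \<omega>})" by auto
  also have "prob \<dots> \<le> (\<Sum>x\<in>S. prob {\<omega>\<in>space M. m < \<tau> x \<omega>})"
    using assms by (intro finite_measure_subadditive_finite) auto
  finally show ?thesis by (simp add: prob_tau_gt)
qed

lemma prob_max_le_le:
  assumes "finite S"
  shows "prob {\<omega>\<in>space M. \<forall>x\<in>S. \<tau> x \<omega> \<le> m} \<le> exp (- (real (card S) * F m))"
proof -
  have "prob {\<omega>\<in>space M. \<forall>x\<in>S. \<tau> x \<omega> \<notin> {m<..}} \<le> exp (- (real (card S) * F m))"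
  proof (rule prob_none_le_exp[where X = \<tau> and A = "\<lambda>_. {m<..}" and N = "\<lambda>_. borel", OF assms])
    show "indep_vars (\<lambda>_. borel) \<tau> S" by (rule indep_vars_subset[OF indep]) simp
    fix x
    have "\<tau> x -` {m<..} \<inter> space M = {\<omega>\<in>space M. m < \<tau> x \<omega>}" by auto
    then show "F m \<le> prob (\<tau> x -` {m<..} \<inter> space M)" by (simp add: prob_tau_gt)
  qed (auto simp: tail_nonneg)
  then show ?thesis by (simp add: not_less)
qed

definition truncated_mean :: "real \<Rightarrow> real" where
  "truncated_mean m = expectation (\<lambda>\<omega>. min (\<tau> 0 \<omega>) m)"

lemma integrable_min: "1 \<le> m \<Longrightarrow> integrable M (\<lambda>\<omega>. min (\<tau> x \<omega>) m)"
  using tau_nonneg by (intro integrable_const_bound[where B = m]) auto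

lemma expectation_min: "expectation (\<lambda>\<omega>. min (\<tau> x \<omega>) m) = truncated_mean m"
  unfolding truncated_mean_def by (rule expectation_tau) measurable

lemma truncated_mean_le: "1 \<le> m \<Longrightarrow> truncated_mean m \<le> m"
  unfolding truncated_mean_def
  using integral_mono[OF integrable_min[of m 0], of "\<lambda>_. m"] by (simp add: prob_space)

lemma truncated_mean_ge_1: "1 \<le> m \<Longrightarrow> 1 \<le> truncated_mean m"
  unfolding truncated_mean_def
  using integral_mono[OF _ integrable_min[of m 0], of "\<lambda>_. 1"] tau_ge_1 by (simp add: prob_space)

text \<open>Doubling the truncation level adds at most \<open>m\<close> on the event that the level \<open>m\<close> is exceeded.\<close>

lemma truncated_mean_double:
  assumes m: "1 \<le> m"
  shows "truncated_mean (2 * m) \<le> truncated_mean m + m * F m"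
proof -
  let ?A = "{\<omega>\<in>space M. m < \<tau> 0 \<omega>}"
  have ind: "integrable M (indicator ?A :: 'w \<Rightarrow> real)"
    by (rule integrable_const_bound[where B = 1]) auto
  have "truncated_mean (2 * m) \<le> expectation (\<lambda>\<omega>. min (\<tau> 0 \<omega>) m + m * indicator ?A \<omega>)"
    unfolding truncated_mean_def
  proof (rule integral_mono)
    show "integrable M (\<lambda>\<omega>. min (\<tau> 0 \<omega>) (2 * m))" using m by (intro integrable_min) simp
    show "integrable M (\<lambda>\<omega>. min (\<tau> 0 \<omega>) m + m * indicator ?A \<omega>)"
      using m ind by (intro Bochner_Integration.integrable_add integrable_min) auto
    show "min (\<tau> 0 \<omega>) (2 * m) \<le> min (\<tau> 0 \<omega>) m + m * indicator ?A \<omega>" if "\<omega> \<in> space M" for \<omega>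
      using that m by (auto simp: indicator_def)
  qed
  also have "\<dots> = truncated_mean m + m * prob ?A"
    unfolding truncated_mean_def
    using m ind by (subst Bochner_Integration.integral_add) (auto intro: integrable_min)
  finally show ?thesis by (simp add: prob_tau_gt)
qed

text \<open>The increments under doubling are of order \<open>m\<^sup>1\<^sup>-\<^sup>p\<close>, so they add up to order \<open>m\<^sup>1\<^sup>-\<^sup>p\<close> if \<open>p < 1\<close> and
  to a constant if \<open>p > 1\<close>. The constants \<open>C\<close> and \<open>D\<close> are chosen such that the bound is stable under
  one doubling step.\<close>

lemma truncated_mean_bound:
  assumes p: "0 < p" "p < \<alpha>" "p \<noteq> 1"
  obtains C where "0 < C" "\<And>m. 1 \<le> m \<Longrightarrow> truncated_mean m \<le> C * max 1 (m powr (1 - p))"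
proof -
  obtain B where B: "1 \<le> B" "\<And>t. 1 \<le> t \<Longrightarrow> F t \<le> B * t powr (- p)"
    using tail_upper_bound[OF p(1,2)] by blast
  have double: "truncated_mean (2 * m) \<le> truncated_mean m + B * m powr (1 - p)" if m: "1 \<le> m" for m
  proof -
    have "m * F m \<le> m * (B * m powr (- p))" using B(2)[OF m] m by (intro mult_left_mono) auto
    also have "\<dots> = B * m powr (1 - p)" using m by (simp add: powr_diff powr_minus_divide)
    finally show ?thesis using truncated_mean_double[OF m] by simp
  qed
  consider "p < 1" | "1 < p" using p(3) by linarith
  then show ?thesis
  proof cases
    case 1
    define \<theta> where "\<theta> = 2 powr (1 - p)"
    have th: "1 < \<theta>" using 1 by (simp add: \<theta>_def)
    define C where "C = max 2 (B / (\<theta> - 1))"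
    have step: "C + B \<le> C * \<theta>"
    proof -
      have "B / (\<theta> - 1) \<le> C" by (simp add: C_def)
      then show ?thesis using th by (simp add: pos_divide_le_eq algebra_simps)
    qed
    have "truncated_mean m \<le> C * m powr (1 - p)" if "1 \<le> m" for m
      using that
    proof (rule doubling_induct[of 1 "\<lambda>m. truncated_mean m \<le> C * m powr (1 - p)", rotated -1])
      fix t :: real assume t: "1 \<le> t" "t \<le> 2 * 1"
      have "truncated_mean t \<le> 2" using truncated_mean_le[OF t(1)] t by simp
      also have "\<dots> \<le> C * 1" by (simp add: C_def)
      also have "\<dots> \<le> C * t powr (1 - p)"
        using t 1 by (intro mult_left_mono ge_one_powr_ge_zero) (auto simp: C_def)
      finally show "truncated_mean t \<le> C * t powr (1 - p)" .
    next
      fix t :: real assume t: "1 \<le> t" "truncated_mean t \<le> C * t powr (1 - p)"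
      have "truncated_mean (2 * t) \<le> (C + B) * t powr (1 - p)"
        using double[OF t(1)] t(2) by (simp add: algebra_simps)
      also have "\<dots> \<le> C * \<theta> * t powr (1 - p)" using step by (intro mult_right_mono) auto
      also have "\<dots> = C * (2 * t) powr (1 - p)" using t by (simp add: \<theta>_def powr_mult)
      finally show "truncated_mean (2 * t) \<le> C * (2 * t) powr (1 - p)" .
    qed auto
    moreover have "C * m powr (1 - p) \<le> C * max 1 (m powr (1 - p))" for m
      by (intro mult_left_mono) (auto simp: C_def)
    ultimately show ?thesis by (intro that[of C]) (auto simp: C_def intro: order_trans)
  next
    case 2
    define \<theta> where "\<theta> = 2 powr (1 - p)"
    have th: "0 < \<theta>" "\<theta> < 1" using 2 powr_less_mono[of "1 - p" 0 2] by (auto simp: \<theta>_def)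
    define D where "D = B / (1 - \<theta>)"
    have "D * (1 - \<theta>) = B" using th by (simp add: D_def)
    then have D: "B = D - D * \<theta>" by (simp add: right_diff_distrib)
    have D0: "0 < D" using th B(1) by (simp add: D_def)
    have "truncated_mean m \<le> 2 + D - D * m powr (1 - p)" if "1 \<le> m" for m
      using that
    proof (rule doubling_induct[of 1 "\<lambda>m. truncated_mean m \<le> 2 + D - D * m powr (1 - p)", rotated -1])
      fix t :: real assume t: "1 \<le> t" "t \<le> 2 * 1"
      have "truncated_mean t \<le> 2" using truncated_mean_le[OF t(1)] t by simp
      moreover have "D * t powr (1 - p) \<le> D * 1"
        using t 2 D0 by (intro mult_left_mono powr_nonpos_le_one) auto
      ultimately show "truncated_mean t \<le> 2 + D - D * t powr (1 - p)" by simp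
    next
      fix t :: real assume t: "1 \<le> t" "truncated_mean t \<le> 2 + D - D * t powr (1 - p)"
      have "truncated_mean (2 * t) \<le> 2 + D - (D - B) * t powr (1 - p)"
        using double[OF t(1)] t(2) by (simp add: algebra_simps)
      also have "(D - B) * t powr (1 - p) = D * (2 * t) powr (1 - p)"
        using t D by (simp add: \<theta>_def powr_mult)
      finally show "truncated_mean (2 * t) \<le> 2 + D - D * (2 * t) powr (1 - p)" .
    qed auto
    moreover have "2 + D - D * m powr (1 - p) \<le> (2 + D) * max 1 (m powr (1 - p))" for m
    proof -
      have "2 + D - D * m powr (1 - p) \<le> (2 + D) * 1" using D0 by simp
      also have "\<dots> \<le> (2 + D) * max 1 (m powr (1 - p))"
        using D0 by (intro mult_left_mono) auto
      finally show ?thesis .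
    qed
    ultimately show ?thesis using D0 by (intro that[of "2 + D"]) (auto intro: order_trans)
  qed
qed

text \<open>The upper half of Karamata's theorem: for \<open>\<alpha> < 1\<close> the product \<open>m F(m)\<close> grows geometrically under
  doubling, so the sum of the increments is comparable to the last one.\<close>

lemma truncated_mean_karamata:
  assumes "\<alpha> < 1"
  obtains C t0 where "0 < C" "1 \<le> t0" "\<And>m. t0 \<le> m \<Longrightarrow> truncated_mean m \<le> C * (m * F m)"
proof -
  \<comment> \<open>an exponent strictly between \<open>\<alpha>\<close> and 1, so that \<open>m F(m)\<close> gains a factor \<open>2\<^sup>1\<^sup>-\<^sup>\<beta> > 1\<close> per doubling\<close>
  define \<beta> where "\<beta> = (\<alpha> + 1) / 2"
  have \<beta>: "\<alpha> < \<beta>" "\<beta> < 1" using assms by (auto simp: \<beta>_def)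
  obtain t0 where t0: "1 \<le> t0" "\<And>t. t0 \<le> t \<Longrightarrow> 2 powr (- \<beta>) * F t \<le> F (2 * t)"
    using tail_doubling_lower[OF \<beta>(1)] by blast
  define \<theta> where "\<theta> = 2 powr (1 - \<beta>)"
  have th: "1 < \<theta>" using \<beta> by (simp add: \<theta>_def)
  define C where "C = max (2 / F (2 * t0)) (1 / (\<theta> - 1))"
  have C0: "0 < C" using tail_pos[of "2 * t0"] by (simp add: C_def less_max_iff_disj)
  have step: "C + 1 \<le> C * \<theta>"
  proof -
    have "1 / (\<theta> - 1) \<le> C" by (simp add: C_def)
    then show ?thesis using th by (simp add: pos_divide_le_eq algebra_simps)
  qed
  have "truncated_mean m \<le> C * (m * F m)" if "t0 \<le> m" for m
    using that
  proof (rule doubling_induct[of t0 "\<lambda>m. truncated_mean m \<le> C * (m * F m)", rotated -1])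
    fix t assume t: "t0 \<le> t" "t \<le> 2 * t0"
    have "truncated_mean t \<le> t" using t t0 by (intro truncated_mean_le) simp
    also have "\<dots> \<le> 2 / F (2 * t0) * (t0 * F (2 * t0))"
      using t tail_pos[of "2 * t0"] by simp
    also have "\<dots> \<le> C * (t * F t)"
      using t t0 C0 tail_nonneg tail_antimono[OF t(2)]
      by (intro mult_mono) (auto simp: C_def)
    finally show "truncated_mean t \<le> C * (t * F t)" .
  next
    fix t assume t: "t0 \<le> t" "truncated_mean t \<le> C * (t * F t)"
    have "truncated_mean (2 * t) \<le> (C + 1) * (t * F t)"
      using truncated_mean_double[of t] t t0(1) by (simp add: algebra_simps)
    also have "\<dots> \<le> C * \<theta> * (t * F t)"
      using step t t0(1) tail_nonneg by (intro mult_right_mono) auto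
    also have "\<dots> = C * (2 * t * (2 powr (- \<beta>) * F t))"
      by (simp add: \<theta>_def powr_diff powr_minus_divide)
    also have "\<dots> \<le> C * (2 * t * F (2 * t))"
      using t0(2)[OF t(1)] t t0(1) C0 by (intro mult_left_mono) auto
    finally show "truncated_mean (2 * t) \<le> C * (2 * t * F (2 * t))" .
  qed (use t0 in auto)
  then show ?thesis using that C0 t0(1) by blast
qed

definition eigenvalue :: "real \<Rightarrow> nat \<Rightarrow> 'w \<Rightarrow> real" where
  "eigenvalue a n \<omega> = principal_dirichlet_eigenvalue a (\<lambda>x. \<tau> x \<omega>) n"

lemma eigenvalue_measurable [measurable]: "eigenvalue a n \<in> borel_measurable M"
  unfolding eigenvalue_def[abs_def] by (rule principal_eigenvalue_measurable) measurable

lemma tau_nonzero: "\<tau> x \<omega> \<noteq> 0" using tau_ge_1[of x \<omega>] by auto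

lemma eigenvalue_antimono: "m \<le> n \<Longrightarrow> eigenvalue a n \<omega> \<le> eigenvalue a m \<omega>"
  unfolding eigenvalue_def by (rule principal_eigenvalue_antimono) (auto simp: tau_nonzero)

lemma card_box: "real (card (lattice_box n :: (int ^ 'd) set)) = real (2 * n + 1) ^ CARD('d)"
  by (simp add: card_lattice_box)

lemma card_box_le: "1 \<le> n \<Longrightarrow> real (card (lattice_box n :: (int ^ 'd) set)) \<le> 3 ^ CARD('d) * real n ^ CARD('d)"
  unfolding card_box power_mult_distrib[symmetric] by (intro power_mono) auto

section \<open>Tightness from below\<close>

lemma eigenvalue_lower_total_mass:
  "\<exists>C>0. \<forall>n\<ge>2. \<forall>a\<ge>0. \<forall>\<omega>. 1 / (C * green_bound CARD('d) n * (\<Sum>x\<in>lattice_box n. \<tau> x \<omega>)) \<le> eigenvalue a n \<omega>"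
proof -
  obtain C where C: "0 < C" and v: "\<And>n. 2 \<le> n \<Longrightarrow> \<exists>v :: int ^ 'd \<Rightarrow> real. green_majorant C n v"
    using exists_green_majorant[where 'd = 'd] by blast
  show ?thesis
  proof (intro exI[of _ C] conjI allI impI C)
    fix n :: nat and a :: real and \<omega> assume n: "2 \<le> n" and a: "0 \<le> a"
    obtain v :: "int ^ 'd \<Rightarrow> real" where v:
      "\<And>x. x \<in> lattice_box (2 * n + 1) \<Longrightarrow> 0 \<le> v x"
      "\<And>x. (if x = 0 then 1 else 0) \<le> (\<Sum>y | y \<sim>\<^sub>Z x. v x - v y)"
      "\<And>x. v x \<le> C * green_bound CARD('d) n"
      using v[OF n] unfolding green_majorant_def by blast
    show "1 / (C * green_bound CARD('d) n * (\<Sum>x\<in>lattice_box n. \<tau> x \<omega>)) \<le> eigenvalue a n \<omega>"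
      unfolding eigenvalue_def
    proof (rule eigenvalue_lower_bound_from_potential[OF tau_ge_1 a v(1,2)])
      fix x :: "int ^ 'd"
      have "(\<Sum>y\<in>lattice_box n. \<tau> y \<omega> * v (x - y)) \<le> (\<Sum>y\<in>lattice_box n. \<tau> y \<omega> * (C * green_bound CARD('d) n))"
        by (intro sum_mono mult_left_mono v tau_nonneg)
      then show "(\<Sum>y\<in>lattice_box n. \<tau> y \<omega> * v (x - y)) \<le> C * green_bound CARD('d) n * (\<Sum>x\<in>lattice_box n. \<tau> x \<omega>)"
        by (simp add: sum_distrib_left mult.commute)
    qed auto
  qed
qed

lemma green_bound_pos: "2 \<le> n \<Longrightarrow> 0 < green_bound k n"
  by (auto simp: green_bound_def)

lemma total_mass_pos: "0 < (\<Sum>x\<in>lattice_box n. \<tau> (x :: int ^ 'd) \<omega>)"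
proof -
  have "(0 :: int ^ 'd) \<in> lattice_box n" by (simp add: lattice_box_def)
  moreover have "0 < \<tau> x \<omega>" for x using tau_ge_1[of x \<omega>] by simp
  ultimately show ?thesis by (intro sum_pos) auto
qed

text \<open>With \<open>m = L h(n\<^sup>d)\<close> and \<open>L\<close> large, it is unlikely that some trap exceeds \<open>m\<close>; and the expected sum of
  the truncated traps is at most of order \<open>n\<^sup>d m F(m)\<close>, which is a small multiple of \<open>m\<close>.\<close>

lemma total_mass_tight:
  assumes al: "\<alpha> < 1" and e: "0 < \<epsilon>"
  shows "\<exists>K>0. \<forall>\<^sub>F n in sequentially.
    prob {\<omega>\<in>space M. K * quantile (real n ^ CARD('d)) < (\<Sum>x\<in>lattice_box n. \<tau> (x :: int ^ 'd) \<omega>)} \<le> \<epsilon>"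
proof -
  obtain C t0 where C: "0 < C" "1 \<le> t0" "\<And>m. t0 \<le> m \<Longrightarrow> truncated_mean m \<le> C * (m * F m)"
    using truncated_mean_karamata[OF al] by blast
  define Q :: real where "Q = 3 ^ CARD('d)"
  have Q0: "0 < Q" by (simp add: Q_def)
  obtain L where L: "0 < L" "Q * (2 * (L / 2) powr (- \<alpha>)) \<le> \<epsilon> / 2"
  proof -
    have "((\<lambda>L. Q * (2 * (L / 2) powr (- \<alpha>))) \<longlongrightarrow> 0) at_top"
      using alpha_pos by real_asymp
    then have "\<forall>\<^sub>F L in at_top. Q * (2 * (L / 2) powr (- \<alpha>)) < \<epsilon> / 2"
      by (rule order_tendstoD) (use e in simp)
    then have "\<forall>\<^sub>F L in at_top. Q * (2 * (L / 2) powr (- \<alpha>)) < \<epsilon> / 2 \<and> 0 < L"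
      using eventually_gt_at_top[of 0] by eventually_elim simp
    then show ?thesis using that by (auto simp: eventually_at_top_linorder less_imp_le)
  qed
  define K where "K = C * L"
  have xlim: "filterlim (\<lambda>n. real n ^ CARD('d)) at_top sequentially"
    by (rule filterlim_pow_at_top[OF _ filterlim_real_sequentially]) simp
  have "\<forall>\<^sub>F n in sequentially. real n ^ CARD('d) * F (L * quantile (real n ^ CARD('d))) \<le> 2 * (L / 2) powr (- \<alpha>)"
    by (rule eventually_compose_filterlim[OF tail_quantile_upper[OF L(1)] xlim])
  moreover have "\<forall>\<^sub>F n in sequentially. t0 / L \<le> quantile (real n ^ CARD('d))"
    using filterlim_compose[OF quantile_at_top xlim] by (simp add: filterlim_at_top)
  moreover have "\<forall>\<^sub>F n in sequentially. 2 \<le> n" by (rule eventually_ge_at_top)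
  ultimately have "\<forall>\<^sub>F n in sequentially.
    prob {\<omega>\<in>space M. K * quantile (real n ^ CARD('d)) < (\<Sum>x\<in>lattice_box n. \<tau> (x :: int ^ 'd) \<omega>)} \<le> \<epsilon>"
  proof eventually_elim
    case (elim n)
    let ?B = "lattice_box n :: (int ^ 'd) set"
    define m where "m = L * quantile (real n ^ CARD('d))"
    have m: "t0 \<le> m" "1 \<le> m" using elim(2) L(1) C(2) by (auto simp: m_def field_simps)
    have NF: "real (card ?B) * F m \<le> \<epsilon> / 2"
    proof -
      have "real (card ?B) * F m \<le> 3 ^ CARD('d) * real n ^ CARD('d) * F m"
        using elim(3) by (intro mult_right_mono card_box_le tail_nonneg) auto
      also have "\<dots> = Q * (real n ^ CARD('d) * F m)" by (simp add: Q_def)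
      also have "\<dots> \<le> Q * (2 * (L / 2) powr (- \<alpha>))"
        using elim(1) Q0 by (intro mult_left_mono) (auto simp: m_def)
      finally show ?thesis using L(2) by simp
    qed
    let ?S = "\<lambda>\<omega>. \<Sum>x\<in>?B. min (\<tau> x \<omega>) m"
    have "prob {\<omega>\<in>space M. K * quantile (real n ^ CARD('d)) < (\<Sum>x\<in>?B. \<tau> x \<omega>)}
        \<le> prob ({\<omega>\<in>space M. \<exists>x\<in>?B. m < \<tau> x \<omega>} \<union> {\<omega>\<in>space M. C * m \<le> ?S \<omega>})"
    proof (rule finite_measure_mono)
      show "{\<omega>\<in>space M. K * quantile (real n ^ CARD('d)) < (\<Sum>x\<in>?B. \<tau> x \<omega>)}
          \<subseteq> {\<omega>\<in>space M. \<exists>x\<in>?B. m < \<tau> x \<omega>} \<union> {\<omega>\<in>space M. C * m \<le> ?S \<omega>}"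
      proof
        fix \<omega> assume w: "\<omega> \<in> {\<omega>\<in>space M. K * quantile (real n ^ CARD('d)) < (\<Sum>x\<in>?B. \<tau> x \<omega>)}"
        show "\<omega> \<in> {\<omega>\<in>space M. \<exists>x\<in>?B. m < \<tau> x \<omega>} \<union> {\<omega>\<in>space M. C * m \<le> ?S \<omega>}"
        proof (cases "\<exists>x\<in>?B. m < \<tau> x \<omega>")
          case False
          then have "?S \<omega> = (\<Sum>x\<in>?B. \<tau> x \<omega>)" by (intro sum.cong) (auto simp: min_def)
          then show ?thesis using w by (simp add: K_def m_def mult.assoc)
        qed (use w in simp)
      qed
    qed measurable
    also have "\<dots> \<le> prob {\<omega>\<in>space M. \<exists>x\<in>?B. m < \<tau> x \<omega>} + prob {\<omega>\<in>space M. C * m \<le> ?S \<omega>}"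
      by (rule measure_Un_le) measurable
    also have "prob {\<omega>\<in>space M. \<exists>x\<in>?B. m < \<tau> x \<omega>} \<le> \<epsilon> / 2"
      using prob_max_gt_le[of ?B m] NF by simp
    also have "prob {\<omega>\<in>space M. C * m \<le> ?S \<omega>} \<le> \<epsilon> / 2"
    proof -
      have "prob {\<omega>\<in>space M. C * m \<le> ?S \<omega>} \<le> expectation ?S / (C * m)"
      proof (rule integral_Markov_inequality_measure[where A = "{}"])
        show "integrable M ?S" using m by (intro Bochner_Integration.integrable_sum integrable_min) auto
        show "AE \<omega> in M. 0 \<le> ?S \<omega>"
          using m tau_nonneg by (intro AE_I2 sum_nonneg) auto
        show "0 < C * m" using C m by simp
      qed simp
      also have "expectation ?S = real (card ?B) * truncated_mean m"
        using m by (subst Bochner_Integration.integral_sum) (auto intro: integrable_min simp: expectation_min)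
      also have "real (card ?B) * truncated_mean m / (C * m) \<le> real (card ?B) * (C * (m * F m)) / (C * m)"
        using C m by (intro divide_right_mono mult_left_mono) auto
      also have "\<dots> = real (card ?B) * F m" using C m by simp
      finally show ?thesis using NF by simp
    qed
    finally show ?case by simp
  qed
  then show ?thesis using C(1) L(1) by (intro exI[of _ K]) (simp add: K_def)
qed

theorem eigenvalue_lower_tight:
  assumes al: "\<alpha> < 1" and e: "0 < \<epsilon>" and a: "0 \<le> a"
  shows "\<exists>\<eta>>0. \<forall>\<^sub>F n in sequentially.
    prob {\<omega>\<in>space M. green_bound CARD('d) n * quantile (real n ^ CARD('d)) * eigenvalue a n \<omega> < \<eta>} \<le> \<epsilon>"
proof -
  obtain C where C: "0 < C" "\<And>n a \<omega>. 2 \<le> n \<Longrightarrow> 0 \<le> a \<Longrightarrow>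
      1 / (C * green_bound CARD('d) n * (\<Sum>x\<in>lattice_box n. \<tau> x \<omega>)) \<le> eigenvalue a n \<omega>"
    using eigenvalue_lower_total_mass by blast
  obtain K where K: "0 < K" "\<forall>\<^sub>F n in sequentially.
    prob {\<omega>\<in>space M. K * quantile (real n ^ CARD('d)) < (\<Sum>x\<in>lattice_box n. \<tau> (x :: int ^ 'd) \<omega>)} \<le> \<epsilon>"
    using total_mass_tight[OF al e] by blast
  have "\<forall>\<^sub>F n in sequentially.
    prob {\<omega>\<in>space M. green_bound CARD('d) n * quantile (real n ^ CARD('d)) * eigenvalue a n \<omega> < 1 / (C * K)} \<le> \<epsilon>"
    using K(2) eventually_ge_at_top[of 2]
  proof eventually_elim
    case (elim n)
    have x1: "1 < real n ^ CARD('d)" using elim(2) by (intro one_less_power) auto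
    have q: "0 < quantile (real n ^ CARD('d))" using quantile_ge_1[OF x1] by simp
    have g: "0 < green_bound CARD('d) n" by (rule green_bound_pos[OF elim(2)])
    have "prob {\<omega>\<in>space M. green_bound CARD('d) n * quantile (real n ^ CARD('d)) * eigenvalue a n \<omega> < 1 / (C * K)}
        \<le> prob {\<omega>\<in>space M. K * quantile (real n ^ CARD('d)) < (\<Sum>x\<in>lattice_box n. \<tau> (x :: int ^ 'd) \<omega>)}"
    proof (rule finite_measure_mono)
      show "{\<omega>\<in>space M. green_bound CARD('d) n * quantile (real n ^ CARD('d)) * eigenvalue a n \<omega> < 1 / (C * K)}
        \<subseteq> {\<omega>\<in>space M. K * quantile (real n ^ CARD('d)) < (\<Sum>x\<in>lattice_box n. \<tau> (x :: int ^ 'd) \<omega>)}"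
      proof
        fix \<omega> assume w: "\<omega> \<in> {\<omega>\<in>space M. green_bound CARD('d) n * quantile (real n ^ CARD('d)) * eigenvalue a n \<omega> < 1 / (C * K)}"
        let ?T = "\<Sum>x\<in>lattice_box n. \<tau> (x :: int ^ 'd) \<omega>"
        have T: "0 < ?T" by (rule total_mass_pos)
        have "quantile (real n ^ CARD('d)) / (C * ?T)
            = green_bound CARD('d) n * quantile (real n ^ CARD('d)) * (1 / (C * green_bound CARD('d) n * ?T))"
          using g by simp
        also have "\<dots> \<le> green_bound CARD('d) n * quantile (real n ^ CARD('d)) * eigenvalue a n \<omega>"
          using C(2)[OF elim(2) a, of \<omega>] g q by (intro mult_left_mono) auto
        also have "\<dots> < 1 / (C * K)" using w by simp
        finally have "K * quantile (real n ^ CARD('d)) < ?T" using C(1) K(1) T by (simp add: field_simps)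
        then show "\<omega> \<in> {\<omega>\<in>space M. K * quantile (real n ^ CARD('d))
            < (\<Sum>x\<in>lattice_box n. \<tau> (x :: int ^ 'd) \<omega>)}" using w by simp
      qed
    qed measurable
    then show ?case using elim(1) by simp
  qed
  then show ?thesis using C(1) K(1) by (intro exI[of _ "1 / (C * K)"]) simp
qed

end

section \<open>Almost sure lower bounds\<close>

lemma exists_power_of_2_between:
  fixes n :: nat
  assumes "1 \<le> n" obtains k :: nat where "n \<le> 2 ^ k" "2 ^ k \<le> 2 * n"
proof -
  define k where "k = (LEAST k. n \<le> (2::nat) ^ k)"
  have ex: "\<exists>k. n \<le> (2::nat) ^ k" by (rule exI[of _ n]) (simp add: less_imp_le)
  have 1: "n \<le> 2 ^ k" unfolding k_def by (rule LeastI_ex[OF ex])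
  have "2 ^ k \<le> 2 * n"
  proof (cases k)
    case 0
    then show ?thesis using assms by simp
  next
    case (Suc j)
    then have "\<not> n \<le> 2 ^ j" unfolding k_def by (metis lessI not_less_Least)
    then show ?thesis using Suc by simp
  qed
  then show ?thesis using that 1 by blast
qed

context trap_environment
begin

lemma AE_eventually_of_summable:
  assumes "\<And>n. {\<omega>\<in>space M. P n \<omega>} \<in> sets M"
    and "summable (\<lambda>n. prob {\<omega>\<in>space M. P n \<omega>})"
  shows "AE \<omega> in M. \<forall>\<^sub>F n in sequentially. \<not> P n \<omega>"
proof -
  have "AE \<omega> in M. \<forall>\<^sub>F n in sequentially. \<omega> \<in> space M - {\<omega>\<in>space M. P n \<omega>}"
    by (rule borel_cantelli_AE1) (use assms in \<open>auto simp: less_top[symmetric]\<close>)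
  then show ?thesis
  proof (rule AE_mp, intro AE_I2 impI)
    fix \<omega> assume "\<forall>\<^sub>F n in sequentially. \<omega> \<in> space M - {\<omega>\<in>space M. P n \<omega>}"
    then show "\<forall>\<^sub>F n in sequentially. \<not> P n \<omega>" by (rule eventually_mono) auto
  qed
qed

lemma green_bound_le_powr:
  assumes "0 < \<delta>" "2 \<le> n"
  shows "green_bound k n \<le> max 1 (1 / \<delta>) * real n powr ((if k = 1 then 1 else 0) + \<delta>)"
proof -
  have n1: "1 \<le> real n" using assms(2) by simp
  consider "k = 1" | "k = 2" | "k \<noteq> 1" "k \<noteq> 2" by blast
  then show ?thesis
  proof cases
    case 1
    have "1 * real n powr 1 \<le> max 1 (1 / \<delta>) * real n powr (1 + \<delta>)"
      using n1 assms(1) by (intro mult_mono powr_mono) auto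
    then show ?thesis using 1 n1 by (simp add: green_bound_def)
  next
    case 2
    have "ln (real n) \<le> real n powr \<delta> / \<delta>" by (rule ln_powr_bound[OF n1 assms(1)])
    also have "\<dots> = 1 / \<delta> * real n powr \<delta>" by simp
    also have "\<dots> \<le> max 1 (1 / \<delta>) * real n powr \<delta>" by (intro mult_right_mono) auto
    finally show ?thesis using 2 by (simp add: green_bound_def)
  next
    case 3
    have "1 * 1 \<le> max 1 (1 / \<delta>) * real n powr \<delta>"
      using n1 assms(1) by (intro mult_mono ge_one_powr_ge_zero) auto
    then show ?thesis using 3 by (simp add: green_bound_def)
  qed
qed

text \<open>The exponent of the trapping mechanism when the maximal depth in the box is of order \<open>n\<^sup>d\<^sup>/\<^sup>p\<close>; in
  dimension 1 the energy contributes another factor \<open>n\<close>.\<close>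

definition trap_exponent :: "real \<Rightarrow> real" where
  "trap_exponent p = real CARD('d) / p + (if CARD('d) = 1 then 1 else 0)"

text \<open>The potential of the truncated traps has mean at most \<open>W\<close> times the truncated mean, and its
  summands are bounded by \<open>g m\<close>.\<close>

lemma prob_potential_ge:
  fixes v :: "int ^ 'd \<Rightarrow> real"
  assumes n: "2 \<le> n" and m: "1 \<le> m" and g: "0 < g"
    and v: "\<And>x. x \<in> lattice_box (2 * n + 1) \<Longrightarrow> 0 \<le> v x" "\<And>x. v x \<le> g"
      "(\<Sum>x\<in>lattice_box (2 * n). v x) \<le> W"
    and x: "x \<in> lattice_box n" and t: "0 \<le> t"
  shows "prob {\<omega>\<in>space M. 2 * (W * truncated_mean m) + g * m * t
      \<le> (\<Sum>y\<in>lattice_box n. min (\<tau> y \<omega>) m * v (x - y))} \<le> exp (- t)"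
proof -
  let ?B = "lattice_box n :: (int ^ 'd) set"
  let ?X = "\<lambda>y \<omega>. min (\<tau> y \<omega>) m * v (x - y)"
  let ?K = "2 * (W * truncated_mean m) + g * m * t"
  have in2: "x - y \<in> lattice_box (2 * n)" if "y \<in> ?B" for y
    using that x sup_norm_diff_le[of x y] by (auto simp: lattice_box_iff)
  then have v0: "0 \<le> v (x - y)" if "y \<in> ?B" for y
    using that by (intro v(1)) (auto simp: lattice_box_iff intro: le_SucI)
  have "prob {\<omega>\<in>space M. ?K \<le> (\<Sum>y\<in>?B. ?X y \<omega>)}
      \<le> exp ((2 * (\<Sum>y\<in>?B. expectation (?X y)) - ?K) / (g * m))"
  proof (rule prob_sum_ge_le_exp)
    have "indep_vars (\<lambda>_. borel) \<tau> ?B" by (rule indep_vars_subset[OF indep]) simp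
    then show "indep_vars (\<lambda>_. borel) ?X ?B" by (rule indep_vars_compose2) measurable
    show "0 < g * m" using g m by simp
    fix y \<omega> assume y: "y \<in> ?B"
    have "min (\<tau> y \<omega>) m * v (x - y) \<le> m * g"
      using m v0[OF y] v(2) by (intro mult_mono) auto
    then show "0 \<le> ?X y \<omega> \<and> ?X y \<omega> \<le> g * m"
      using m v0[OF y] tau_nonneg[of y \<omega>] by (simp add: mult.commute)
  qed simp
  also have "(\<Sum>y\<in>?B. expectation (?X y)) = truncated_mean m * (\<Sum>y\<in>?B. v (x - y))"
    by (simp add: expectation_min sum_distrib_left)
  also have "exp ((2 * (truncated_mean m * (\<Sum>y\<in>?B. v (x - y))) - ?K) / (g * m)) \<le> exp (- t)"
  proof -
    have "(\<Sum>y\<in>?B. v (x - y)) = (\<Sum>z\<in>(\<lambda>y. x - y) ` ?B. v z)"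
      by (subst sum.reindex) (auto simp: inj_on_def)
    also have "\<dots> \<le> (\<Sum>z\<in>lattice_box (2 * n). v z)"
      using in2 v(1) by (intro sum_mono2) (auto simp: lattice_box_iff)
    also have "\<dots> \<le> W" by (rule v(3))
    finally have "truncated_mean m * (\<Sum>y\<in>?B. v (x - y)) \<le> truncated_mean m * W"
      using truncated_mean_ge_1[OF m] by (intro mult_left_mono) auto
    then have "(2 * (truncated_mean m * (\<Sum>y\<in>?B. v (x - y))) - ?K) / (g * m) \<le> (- (g * m * t)) / (g * m)"
      using g m by (intro divide_right_mono) (auto simp: mult.commute)
    also have "\<dots> = - t" using g m by simp
    finally show ?thesis by simp
  qed
  finally show ?thesis .
qed

text \<open>The traps are truncated at \<open>m = n\<^sup>d\<^sup>/\<^sup>p\<^sup>+\<^sup>\<delta>\<^sup>1\<close>, which exceeds all of them up to a probability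
  of polynomial decay. The deviation parameter \<open>t = (d + 1) ln n\<close> makes the error at a single point
  \<open>n\<^sup>-\<^sup>d\<^sup>-\<^sup>1\<close>, small enough for a union bound over the box, and costs only a factor \<open>ln n\<close>. The mean
  of the potential is of order \<open>n\<^sup>2\<close> times the truncated mean; for \<open>p > 1\<close> this is the
  diffusive term, and for \<open>p < 1\<close> it does not exceed the order of the trapping term.\<close>

lemma eigenvalue_lower_prob:
  assumes p: "0 < p" "p < \<alpha>" "p \<noteq> 1" and \<delta>: "0 < \<delta>"
  shows "\<exists>C>0. \<exists>C'. \<exists>s>0. \<forall>n\<ge>2. \<forall>a\<ge>0.
    prob {\<omega>\<in>space M. eigenvalue a n \<omega> < 1 / (C * ((real n)\<^sup>2 + real n powr (trap_exponent p + \<delta>)))}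
      \<le> C' * real n powr (- s)"
proof -
  obtain C where C: "0 < C" and sup: "\<And>n. 2 \<le> n \<Longrightarrow> \<exists>v :: int ^ 'd \<Rightarrow> real. green_majorant C n v"
    using exists_green_majorant[where 'd = 'd] by blast
  obtain B where B: "1 \<le> B" "\<And>t. 1 \<le> t \<Longrightarrow> F t \<le> B * t powr (- p)"
    using tail_upper_bound[OF p(1,2)] by blast
  obtain T where T: "0 < T" "\<And>m. 1 \<le> m \<Longrightarrow> truncated_mean m \<le> T * max 1 (m powr (1 - p))"
    using truncated_mean_bound[OF p] by blast
  define D where "D = real CARD('d)"
  have D1: "1 \<le> D" by (simp add: D_def Suc_leI)
  define e :: real where "e = (if CARD('d) = 1 then 1 else 0)"
  have e: "2 - D \<le> e"
  proof (cases "CARD('d) = 1")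
    case False
    then have "2 \<le> CARD('d)" using zero_less_card_finite[where 'a = 'd] by linarith
    then show ?thesis using False by (simp add: e_def D_def)
  qed (simp add: e_def D_def)
  define \<gamma> where "\<gamma> = trap_exponent p"
  have \<gamma>: "\<gamma> = D / p + e" by (simp add: \<gamma>_def trap_exponent_def D_def e_def)
  \<comment> \<open>the loss \<open>\<delta>\<close> is split between the truncation level, the green bound and the factor \<open>ln n\<close>\<close>
  define \<delta>1 where "\<delta>1 = \<delta> / 3"
  have \<delta>1: "0 < \<delta>1" using \<delta> by (simp add: \<delta>1_def)
  define G where "G = max 1 (1 / \<delta>1)"
  define H where "H = 2 * C * T + C * G * ((D + 1) / \<delta>1)"
  have H0: "0 < H"
    using C T D1 \<delta>1 by (auto simp: H_def G_def intro!: add_pos_nonneg mult_nonneg_nonneg)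
  define s where "s = min 1 (p * \<delta>1)"
  have s0: "0 < s" using p \<delta>1 by (simp add: s_def)
  define Q :: real where "Q = 3 ^ CARD('d)"
  have Q0: "0 < Q" by (simp add: Q_def)
  have main: "prob {\<omega>\<in>space M. eigenvalue a n \<omega> < 1 / (H * ((real n)\<^sup>2 + real n powr (\<gamma> + \<delta>)))}
      \<le> Q * (B + 1) * real n powr (- s)" if n: "2 \<le> n" and a: "0 \<le> a" for n a
  proof -
    let ?B = "lattice_box n :: (int ^ 'd) set"
    have n1: "1 \<le> real n" "0 < real n" using n by auto
    obtain v :: "int ^ 'd \<Rightarrow> real" where v:
      "\<And>x. x \<in> lattice_box (2 * n + 1) \<Longrightarrow> 0 \<le> v x"
      "\<And>x. (if x = 0 then 1 else 0) \<le> (\<Sum>y | y \<sim>\<^sub>Z x. v x - v y)"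
      "\<And>x. v x \<le> C * green_bound CARD('d) n" "(\<Sum>x\<in>lattice_box (2 * n). v x) \<le> C * (real n)\<^sup>2"
      using sup[OF n] unfolding green_majorant_def by blast
    define g where "g = C * green_bound CARD('d) n"
    have g0: "0 < g" using C green_bound_pos[OF n] by (simp add: g_def)
    \<comment> \<open>polynomially above the typical maximum of the traps in the box\<close>
    define m where "m = real n powr (D / p + \<delta>1)"
    have m1: "1 \<le> m" unfolding m_def using n1 D1 p \<delta>1 by (intro ge_one_powr_ge_zero) auto
    \<comment> \<open>makes \<open>exp (- t)\<close> smaller than the inverse volume of the box by a factor \<open>n\<close>\<close>
    define t where "t = (D + 1) * ln (real n)"
    have t0: "0 \<le> t" using D1 n by (simp add: t_def)
    define K where "K = 2 * (C * (real n)\<^sup>2 * truncated_mean m) + g * m * t"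
    have K0: "0 < K"
      unfolding K_def using C n1 truncated_mean_ge_1[OF m1] g0 m1 t0
      by (intro add_pos_nonneg) auto
    have KH: "K \<le> H * ((real n)\<^sup>2 + real n powr (\<gamma> + \<delta>))"
    proof -
      have mean: "(real n)\<^sup>2 * truncated_mean m \<le> T * ((real n)\<^sup>2 + real n powr (\<gamma> + \<delta>))"
      proof -
        have "(real n)\<^sup>2 * truncated_mean m \<le> (real n)\<^sup>2 * (T * max 1 (m powr (1 - p)))"
          by (intro mult_left_mono T m1) auto
        also have "\<dots> \<le> (real n)\<^sup>2 * (T * (1 + m powr (1 - p)))"
          using T(1) by (intro mult_left_mono) auto
        also have "\<dots> = T * ((real n)\<^sup>2 + (real n)\<^sup>2 * m powr (1 - p))"
          by (simp add: algebra_simps)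
        also have "m powr (1 - p) = real n powr ((D / p + \<delta>1) * (1 - p))"
          by (simp only: m_def powr_powr)
        also have "(real n)\<^sup>2 * real n powr ((D / p + \<delta>1) * (1 - p)) = real n powr (2 + (D / p + \<delta>1) * (1 - p))"
          using n1 by (simp add: powr_add)
        also have "\<dots> \<le> real n powr (\<gamma> + \<delta>)"
        proof (rule powr_mono)
          have "(D / p + \<delta>1) * (1 - p) = D / p - D + \<delta>1 - \<delta>1 * p"
            using p(1) by (simp add: field_simps)
          moreover have "0 \<le> \<delta>1 * p" using \<delta>1 p(1) by simp
          moreover have "\<delta>1 \<le> \<delta>" using \<delta> by (simp add: \<delta>1_def)
          ultimately show "2 + (D / p + \<delta>1) * (1 - p) \<le> \<gamma> + \<delta>" unfolding \<gamma> using e by linarith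
        qed (rule n1)
        finally show ?thesis using T(1) by simp
      qed
      have gm: "g * m * t \<le> C * G * ((D + 1) / \<delta>1) * real n powr (\<gamma> + \<delta>)"
      proof -
        have "g * m * t \<le> (C * (G * real n powr (e + \<delta>1))) * m * ((D + 1) * (real n powr \<delta>1 / \<delta>1))"
          unfolding g_def t_def G_def e_def
          using C m1 D1 n1 n green_bound_pos[OF n, of "CARD('d)"]
          by (intro mult_mono mult_left_mono green_bound_le_powr ln_powr_bound \<delta>1)
             (auto intro!: mult_nonneg_nonneg)
        also have "\<dots> = C * G * ((D + 1) / \<delta>1) * (real n powr (e + \<delta>1) * m * real n powr \<delta>1)"
          by (simp add: algebra_simps)
        also have "real n powr (e + \<delta>1) * m * real n powr \<delta>1 = real n powr (e + \<delta>1 + (D / p + \<delta>1) + \<delta>1)"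
          by (simp only: m_def powr_add)
        also have "e + \<delta>1 + (D / p + \<delta>1) + \<delta>1 = \<gamma> + \<delta>" by (simp add: \<gamma> \<delta>1_def)
        finally show ?thesis .
      qed
      have "K \<le> 2 * C * (T * ((real n)\<^sup>2 + real n powr (\<gamma> + \<delta>))) + C * G * ((D + 1) / \<delta>1) * real n powr (\<gamma> + \<delta>)"
        unfolding K_def using mult_left_mono[OF mean, of "2 * C"] C gm by (simp add: algebra_simps)
      also have "\<dots> \<le> 2 * C * (T * ((real n)\<^sup>2 + real n powr (\<gamma> + \<delta>)))
          + C * G * ((D + 1) / \<delta>1) * ((real n)\<^sup>2 + real n powr (\<gamma> + \<delta>))"
        using C D1 \<delta>1 by (intro add_left_mono mult_left_mono) (auto simp: G_def)
      finally show ?thesis by (simp add: H_def algebra_simps)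
    qed
    let ?U = "\<lambda>x \<omega>. \<Sum>y\<in>?B. min (\<tau> y \<omega>) m * v (x - y)"
    let ?E1 = "{\<omega>\<in>space M. \<exists>x\<in>?B. m < \<tau> x \<omega>}"
    let ?E2 = "\<lambda>x. {\<omega>\<in>space M. K \<le> ?U x \<omega>}"
    have cB: "real (card ?B) \<le> Q * real n powr D"
      using card_box_le[of n] n n1 by (simp add: Q_def D_def powr_realpow)
    have sub: "{\<omega>\<in>space M. eigenvalue a n \<omega> < 1 / (H * ((real n)\<^sup>2 + real n powr (\<gamma> + \<delta>)))}
        \<subseteq> ?E1 \<union> (\<Union>x\<in>?B. ?E2 x)"
    proof
      fix \<omega> assume w: "\<omega> \<in> {\<omega>\<in>space M. eigenvalue a n \<omega> < 1 / (H * ((real n)\<^sup>2 + real n powr (\<gamma> + \<delta>)))}"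
      show "\<omega> \<in> ?E1 \<union> (\<Union>x\<in>?B. ?E2 x)"
      proof (rule ccontr)
        assume not: "\<omega> \<notin> ?E1 \<union> (\<Union>x\<in>?B. ?E2 x)"
        have le: "min (\<tau> y \<omega>) m = \<tau> y \<omega>" if "y \<in> ?B" for y using not that w by force
        have "1 / K \<le> eigenvalue a n \<omega>"
          unfolding eigenvalue_def
        proof (rule eigenvalue_lower_bound_from_potential[OF tau_ge_1 a v(1,2)])
          fix x assume x: "x \<in> ?B"
          have "(\<Sum>y\<in>?B. \<tau> y \<omega> * v (x - y)) = ?U x \<omega>" using le by (intro sum.cong) auto
          also have "\<dots> \<le> K" using not x w by force
          finally show "(\<Sum>y\<in>?B. \<tau> y \<omega> * v (x - y)) \<le> K" .
        qed auto
        moreover have "1 / (H * ((real n)\<^sup>2 + real n powr (\<gamma> + \<delta>))) \<le> 1 / K"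
          using K0 KH by (intro divide_left_mono) auto
        ultimately show False using w by simp
      qed
    qed
    have "prob {\<omega>\<in>space M. eigenvalue a n \<omega> < 1 / (H * ((real n)\<^sup>2 + real n powr (\<gamma> + \<delta>)))}
        \<le> prob (?E1 \<union> (\<Union>x\<in>?B. ?E2 x))"
      by (rule finite_measure_mono[OF sub]) (intro sets.Un sets.finite_UN, auto)
    also have "\<dots> \<le> prob ?E1 + prob (\<Union>x\<in>?B. ?E2 x)"
      by (rule measure_Un_le) (auto intro!: sets.finite_UN)
    also have "prob ?E1 \<le> Q * B * real n powr (- s)"
    proof -
      have "prob ?E1 \<le> real (card ?B) * F m" by (rule prob_max_gt_le) simp
      also have "\<dots> \<le> (Q * real n powr D) * (B * m powr (- p))"
        using cB B(2)[OF m1] tail_nonneg Q0 by (intro mult_mono) auto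
      also have "\<dots> = Q * B * (real n powr D * m powr (- p))" by (simp only: mult_ac)
      also have "m powr (- p) = real n powr ((D / p + \<delta>1) * (- p))"
        by (simp only: m_def powr_powr)
      also have "real n powr D * real n powr ((D / p + \<delta>1) * (- p)) = real n powr (D + (D / p + \<delta>1) * (- p))"
        by (rule powr_add[symmetric])
      also have "D + (D / p + \<delta>1) * (- p) = - (p * \<delta>1)" using p(1) by (simp add: field_simps)
      also have "real n powr (- (p * \<delta>1)) \<le> real n powr (- s)"
        using n1 by (intro powr_mono) (auto simp: s_def)
      finally show ?thesis using Q0 B(1) by (simp add: mult_left_mono)
    qed
    also have "prob (\<Union>x\<in>?B. ?E2 x) \<le> Q * real n powr (- s)"
    proof -
      have "prob (\<Union>x\<in>?B. ?E2 x) \<le> (\<Sum>x\<in>?B. prob (?E2 x))"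
        by (rule finite_measure_subadditive_finite) auto
      also have "\<dots> \<le> (\<Sum>x\<in>?B. exp (- t))"
      proof (rule sum_mono)
        fix x assume x: "x \<in> ?B"
        show "prob (?E2 x) \<le> exp (- t)"
          unfolding K_def
          by (rule prob_potential_ge[OF n m1 g0 v(1) _ v(4) x t0]) (use v(3) in \<open>auto simp: g_def\<close>)
      qed
      also have "\<dots> = real (card ?B) * real n powr (- (D + 1))"
        using n1 by (simp add: t_def powr_def algebra_simps)
      also have "\<dots> \<le> (Q * real n powr D) * real n powr (- (D + 1))"
        using cB by (intro mult_right_mono) auto
      also have "\<dots> = Q * real n powr (- 1)"
        by (simp add: mult.assoc flip: powr_add)
      also have "\<dots> \<le> Q * real n powr (- s)"
        using n1 Q0 by (intro mult_left_mono powr_mono) (auto simp: s_def)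
      finally show ?thesis .
    qed
    finally show ?thesis by (simp add: algebra_simps)
  qed
  show ?thesis
    using H0 s0 main unfolding \<gamma>_def by blast
qed

text \<open>As the eigenvalue decreases in \<open>n\<close>, the bound at a power of 2 between \<open>n\<close> and \<open>2 n\<close> holds at \<open>n\<close>
  too, up to a constant factor.\<close>

theorem eigenvalue_lower_AE:
  assumes p: "0 < p" "p < \<alpha>" "p \<noteq> 1" and \<delta>: "0 < \<delta>"
  shows "\<exists>c>0. \<forall>a\<ge>0. AE \<omega> in M. \<forall>\<^sub>F n in sequentially.
    c / ((real n)\<^sup>2 + real n powr (trap_exponent p + \<delta>)) \<le> eigenvalue a n \<omega>"
proof -
  define \<gamma> where "\<gamma> = trap_exponent p + \<delta>"
  obtain C C' s where C: "0 < C" "0 < s" and pr: "\<And>n a. 2 \<le> n \<Longrightarrow> 0 \<le> a \<Longrightarrow>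
    prob {\<omega>\<in>space M. eigenvalue a n \<omega> < 1 / (C * ((real n)\<^sup>2 + real n powr \<gamma>))} \<le> C' * real n powr (- s)"
    using eigenvalue_lower_prob[OF p \<delta>] unfolding \<gamma>_def by blast
  have \<gamma>0: "0 < \<gamma>" using p \<delta> by (auto simp: \<gamma>_def trap_exponent_def intro!: add_pos_nonneg add_nonneg_pos)
  \<comment> \<open>the factor \<open>4 + 2\<^sup>\<gamma>\<close> is the price of replacing \<open>n\<close> by \<open>2 n\<close>\<close>
  define c where "c = 1 / (C * (4 + 2 powr \<gamma>))"
  have "0 < 4 + 2 powr \<gamma>" by (simp add: add_pos_nonneg)
  then have c0: "0 < c" using C by (simp add: c_def)
  have "AE \<omega> in M. \<forall>\<^sub>F n in sequentially. c / ((real n)\<^sup>2 + real n powr \<gamma>) \<le> eigenvalue a n \<omega>"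
    if a: "0 \<le> a" for a
  proof -
    let ?bad = "\<lambda>k \<omega>. eigenvalue a (2 ^ k) \<omega> < 1 / (C * ((real (2 ^ k))\<^sup>2 + real (2 ^ k) powr \<gamma>))"
    have summ: "summable (\<lambda>k. prob {\<omega>\<in>space M. ?bad k \<omega>})"
    proof (rule summable_comparison_test_ev)
      show "\<forall>\<^sub>F k in sequentially. norm (prob {\<omega>\<in>space M. ?bad k \<omega>}) \<le> C' * (2 powr (- s)) ^ k"
        using eventually_ge_at_top[of 1]
      proof eventually_elim
        case (elim k)
        have "2 ^ 1 \<le> (2 :: nat) ^ k" using elim by (intro power_increasing) auto
        then have "prob {\<omega>\<in>space M. ?bad k \<omega>} \<le> C' * real (2 ^ k) powr (- s)"
          using a by (intro pr) auto
        also have "real (2 ^ k) powr (- s) = (2 powr (- s)) ^ k"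
          by (simp add: powr_powr mult.commute flip: powr_realpow)
        finally show ?case by simp
      qed
      have "2 powr (- s) < 1" using C(2) powr_less_mono[of "- s" 0 2] by simp
      then show "summable (\<lambda>k. C' * (2 powr (- s)) ^ k)"
        by (intro summable_mult summable_geometric) simp
    qed
    have "AE \<omega> in M. \<forall>\<^sub>F k in sequentially. \<not> ?bad k \<omega>"
      by (rule AE_eventually_of_summable[OF _ summ]) measurable
    then show ?thesis
    proof (rule AE_mp, intro AE_I2 impI)
      fix \<omega> assume "\<forall>\<^sub>F k in sequentially. \<not> ?bad k \<omega>"
      then obtain k0 where k0: "\<And>k. k0 \<le> k \<Longrightarrow> \<not> ?bad k \<omega>" by (auto simp: eventually_sequentially)
      show "\<forall>\<^sub>F n in sequentially. c / ((real n)\<^sup>2 + real n powr \<gamma>) \<le> eigenvalue a n \<omega>"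
        using eventually_ge_at_top[of "2 ^ k0"]
      proof eventually_elim
        case (elim n)
        have n1: "1 \<le> n" using elim by (meson le_trans one_le_numeral one_le_power)
        obtain k where k: "n \<le> 2 ^ k" "2 ^ k \<le> 2 * n" using exists_power_of_2_between[OF n1] by blast
        have "(2 :: nat) ^ k0 \<le> 2 ^ k" using elim k by linarith
        then have "k0 \<le> k" by (simp add: power_increasing_iff)
        let ?m = "real (2 ^ k)"
        have "?m \<le> real (2 * n)" using k(2) by (rule of_nat_mono)
        then have m: "?m \<le> 2 * real n" "0 < ?m" by simp_all
        have "?m\<^sup>2 + ?m powr \<gamma> \<le> (2 * real n)\<^sup>2 + (2 * real n) powr \<gamma>"
          using m \<gamma>0 by (intro add_mono power_mono powr_mono2) auto
        also have "\<dots> = 4 * (real n)\<^sup>2 + 2 powr \<gamma> * real n powr \<gamma>"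
          by (simp add: powr_mult power_mult_distrib)
        also have "\<dots> \<le> (4 + 2 powr \<gamma>) * ((real n)\<^sup>2 + real n powr \<gamma>)"
          by (simp add: algebra_simps)
        finally have "C * (?m\<^sup>2 + ?m powr \<gamma>) \<le> C * ((4 + 2 powr \<gamma>) * ((real n)\<^sup>2 + real n powr \<gamma>))"
          using C by (intro mult_left_mono) auto
        moreover have "0 < C * (?m\<^sup>2 + ?m powr \<gamma>)" using C m by (intro mult_pos_pos add_pos_nonneg) auto
        ultimately have "1 / (C * ((4 + 2 powr \<gamma>) * ((real n)\<^sup>2 + real n powr \<gamma>))) \<le> 1 / (C * (?m\<^sup>2 + ?m powr \<gamma>))"
          by (intro divide_left_mono) auto
        also have "\<dots> \<le> eigenvalue a (2 ^ k) \<omega>" using k0[OF \<open>k0 \<le> k\<close>] by (simp add: not_less)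
        also have "\<dots> \<le> eigenvalue a n \<omega>" by (rule eigenvalue_antimono[OF k(1)])
        finally show ?case by (simp add: c_def mult.assoc)
      qed
    qed
  qed
  then show ?thesis using c0 unfolding \<gamma>_def by blast
qed

end

section \<open>Upper bounds in probability\<close>

lemma sup_norm_ball_eq: "{y. sup_norm (y - c) \<le> n} = (\<lambda>x. x + c) ` lattice_box n"
proof (intro set_eqI iffI)
  fix y assume "y \<in> {y. sup_norm (y - c) \<le> n}"
  then show "y \<in> (\<lambda>x. x + c) ` lattice_box n"
    by (intro image_eqI[of _ _ "y - c"]) (auto simp: lattice_box_iff)
qed (auto simp: lattice_box_iff)

context trap_environment
begin

lemma prob_isolated_trap_ge:
  fixes c :: "int ^ 'd" and m K :: real
  assumes K: "5 ^ CARD('d) * F K \<le> 1 / 2"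
  defines "A \<equiv> \<lambda>y. if y = c then {m<..} else {..K}"
  shows "F m / 2 \<le> prob (\<Inter>y\<in>{y. sup_norm (y - c) \<le> 2}. \<tau> y -` A y \<inter> space M)"
proof -
  let ?B = "{y :: int ^ 'd. sup_norm (y - c) \<le> 2}"
  have B: "?B = (\<lambda>x. x + c) ` lattice_box 2" by (rule sup_norm_ball_eq)
  have fin: "finite ?B" unfolding B by simp
  have card: "card ?B = 5 ^ CARD('d)"
    unfolding B by (subst card_image) (auto simp: inj_on_def card_lattice_box)
  have c: "c \<in> ?B" by (simp add: sup_norm_eq_0_iff[THEN iffD2])
  have Am: "A y \<in> sets borel" for y by (simp add: A_def)
  have "prob (\<Inter>y\<in>?B. \<tau> y -` A y \<inter> space M) = (\<Prod>y\<in>?B. prob (\<tau> y -` A y \<inter> space M))"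
  proof (rule indep_varsD[OF indep _ fin subset_UNIV Am])
    show "?B \<noteq> {}" using c by blast
  qed
  also have "\<dots> = prob (\<tau> c -` A c \<inter> space M) * (\<Prod>y\<in>?B - {c}. prob (\<tau> y -` A y \<inter> space M))"
    by (rule prod.remove[OF fin c])
  also have "prob (\<tau> c -` A c \<inter> space M) = F m"
  proof -
    have "\<tau> c -` A c \<inter> space M = {\<omega>\<in>space M. m < \<tau> c \<omega>}" by (auto simp: A_def)
    then show ?thesis by (simp add: prob_tau_gt)
  qed
  also have "(\<Prod>y\<in>?B - {c}. prob (\<tau> y -` A y \<inter> space M)) = (\<Prod>y\<in>?B - {c}. 1 - F K)"
  proof (rule prod.cong[OF refl])
    fix y assume "y \<in> ?B - {c}"
    then have "\<tau> y -` A y \<inter> space M = space M - {\<omega>\<in>space M. K < \<tau> y \<omega>}"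
      by (auto simp: A_def)
    then show "prob (\<tau> y -` A y \<inter> space M) = 1 - F K"
      using prob_compl[of "{\<omega>\<in>space M. K < \<tau> y \<omega>}"] by (simp add: prob_tau_gt)
  qed
  also have "F m * (\<Prod>y\<in>?B - {c}. 1 - F K) = F m * (1 - F K) ^ (5 ^ CARD('d) - 1)"
    using c card fin by simp
  also have "F m * (1 - F K) ^ (5 ^ CARD('d) - 1) \<ge> F m * (1 / 2)"
  proof (rule mult_left_mono[OF _ tail_nonneg])
    have "real (5 ^ CARD('d) - 1) * F K \<le> 5 ^ CARD('d) * F K"
      using tail_nonneg by (intro mult_right_mono) auto
    then have "1 / 2 \<le> 1 + real (5 ^ CARD('d) - 1) * (- F K)" using K by simp
    also have "\<dots> \<le> (1 + (- F K)) ^ (5 ^ CARD('d) - 1)"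
      using tail_le_1 by (intro Bernoulli_inequality) simp
    finally show "1 / 2 \<le> (1 - F K) ^ (5 ^ CARD('d) - 1)" by simp
  qed
  finally show ?thesis by simp
qed

text \<open>The balls of radius 2 around the points of \<open>5 \<int>\<^sup>d\<close> are disjoint, so their contents are independent.
  In each of them, with probability at least \<open>F(m) / 2\<close>, the centre is deeper than \<open>m\<close> and all other
  sites are at most \<open>K\<close>, where \<open>K\<close> is a fixed large constant.\<close>

lemma eigenvalue_upper_isolated_prob:
  "\<exists>C>0. \<exists>c>0. \<forall>n\<ge>5. \<forall>a\<in>{0..1}. \<forall>m>0.
    prob {\<omega>\<in>space M. C / m < eigenvalue a n \<omega>} \<le> exp (- (c * (real n ^ CARD('d) * F m)))"
proof -
  have "\<forall>\<^sub>F K in at_top. F K < 1 / (2 * 5 ^ CARD('d))"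
    by (rule order_tendstoD(2)[OF tail_tendsto_0]) simp
  then have "\<forall>\<^sub>F K in at_top. F K < 1 / (2 * 5 ^ CARD('d)) \<and> 1 \<le> K"
    using eventually_ge_at_top[of 1] by eventually_elim simp
  then obtain K where K: "F K < 1 / (2 * 5 ^ CARD('d))" "1 \<le> K"
    by (auto simp: eventually_at_top_linorder)
  then have K': "5 ^ CARD('d) * F K \<le> 1 / 2" by (simp add: field_simps)
  define C where "C = 4 * (real CARD('d))\<^sup>2 * 3 ^ (CARD('d) - 1) * K\<^sup>2"
  have C0: "0 < C" using K by (simp add: C_def)
  define c :: real where "c = (1 / 10) ^ CARD('d) / 2"
  have c0: "0 < c" by (simp add: c_def)
  have "prob {\<omega>\<in>space M. C / m < eigenvalue a n \<omega>} \<le> exp (- (c * (real n ^ CARD('d) * F m)))"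
    if n: "5 \<le> n" and a: "a \<in> {0..1}" and m: "0 < m" for n a m
  proof -
    define J where "J = (lattice_box ((n - 2) div 5) :: (int ^ 'd) set)"
    \<comment> \<open>balls of radius 2 around distinct centres are disjoint, and all of them lie in the box\<close>
    define ctr where "ctr z = (\<chi> i. 5 * z $ i)" for z :: "int ^ 'd"
    define N where "N z = {y. sup_norm (y - ctr z) \<le> 2}" for z
    define A where "A z y = (if y = ctr z then {m<..} else {..K})" for z y
    define S where "S z = PiE (N z) (A z)" for z
    have finN: "finite (N z)" for z
      unfolding N_def sup_norm_ball_eq by simp
    have disj: "disjoint_family_on N J"
      unfolding disjoint_family_on_def
    proof (intro ballI impI)
      fix z z' :: "int ^ 'd" assume zz: "z \<noteq> z'"
      show "N z \<inter> N z' = {}"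
      proof (rule ccontr)
        assume "N z \<inter> N z' \<noteq> {}"
        then obtain y where y: "sup_norm (y - ctr z) \<le> 2" "sup_norm (y - ctr z') \<le> 2"
          by (auto simp: N_def)
        have "z $ i = z' $ i" for i
        proof -
          have "\<bar>(y - ctr z) $ i\<bar> \<le> 2" "\<bar>(y - ctr z') $ i\<bar> \<le> 2"
            using y by (simp_all add: sup_norm_le_iff)
          then show ?thesis by (simp add: ctr_def)
        qed
        then show False using zz by (simp add: vec_eq_iff)
      qed
    qed
    let ?X = "\<lambda>z \<omega>. restrict (\<lambda>y. \<tau> y \<omega>) (N z)"
    have ind: "indep_vars (\<lambda>z. PiM (N z) (\<lambda>_. borel)) ?X J"
      by (rule indep_vars_restrict[OF indep _ disj]) simp
    have trap: "eigenvalue a n \<omega> \<le> C / m" if z: "z \<in> J" and S: "?X z \<omega> \<in> S z" for z \<omega>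
    proof -
      have t: "\<tau> y \<omega> \<in> A z y" if "y \<in> N z" for y
        using PiE_mem[OF S[unfolded S_def] that] that by simp
      have "ctr z \<in> N z" by (simp add: N_def sup_norm_eq_0_iff[THEN iffD2])
      from t[OF this] have deep: "m < \<tau> (ctr z) \<omega>" by (simp add: A_def)
      have "sup_norm (ctr z) \<le> 5 * ((n - 2) div 5)"
        using z unfolding J_def lattice_box_iff sup_norm_le_iff by (simp add: ctr_def abs_mult)
      also have "\<dots> \<le> n - 2" by simp
      finally have far: "sup_norm (ctr z) + 2 \<le> n" using n by linarith
      have tK: "\<tau> y \<omega> \<le> K" if "sup_norm (y - ctr z) \<le> 2" "y \<noteq> ctr z" for y
        using t[of y] that by (simp add: N_def A_def)
      have "eigenvalue a n \<omega> \<le> C / \<tau> (ctr z) \<omega>"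
        unfolding eigenvalue_def C_def
        by (intro principal_eigenvalue_le_isolated_trap tau_ge_1 far tK) (use a in auto)
      also have "\<dots> \<le> C / m" using deep m C0 by (intro divide_left_mono) auto
      finally show ?thesis .
    qed
    have "prob {\<omega>\<in>space M. C / m < eigenvalue a n \<omega>} \<le> prob {\<omega>\<in>space M. \<forall>z\<in>J. ?X z \<omega> \<notin> S z}"
    proof (rule finite_measure_mono)
      show "{\<omega>\<in>space M. C / m < eigenvalue a n \<omega>} \<subseteq> {\<omega>\<in>space M. \<forall>z\<in>J. ?X z \<omega> \<notin> S z}"
        using trap by (auto simp: not_le[symmetric])
      have Sm: "S z \<in> sets (PiM (N z) (\<lambda>_. borel))" for z
        unfolding S_def by (rule sets_PiM_I_finite[OF finN]) (simp add: A_def)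
      have rv: "?X z \<in> measurable M (PiM (N z) (\<lambda>_. borel))" if "z \<in> J" for z
        using ind that by (simp add: indep_vars_def)
      have Xs: "?X z -` S z \<inter> space M \<in> sets M" if "z \<in> J" for z
        by (rule measurable_sets[OF rv[OF that] Sm])
      have eq: "{\<omega>\<in>space M. \<forall>z\<in>J. ?X z \<omega> \<notin> S z} = space M - (\<Union>z\<in>J. ?X z -` S z \<inter> space M)"
        by auto
      have "(\<Union>z\<in>J. ?X z -` S z \<inter> space M) \<in> sets M"
        by (rule sets.finite_UN[OF _ Xs]) (simp add: J_def)
      then show "{\<omega>\<in>space M. \<forall>z\<in>J. ?X z \<omega> \<notin> S z} \<in> sets M"
        unfolding eq by (rule sets.compl_sets)
    qed
    also have "\<dots> \<le> exp (- (real (card J) * (F m / 2)))"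
    proof (rule prob_none_le_exp[where X = ?X and A = S and N = "\<lambda>z. PiM (N z) (\<lambda>_. borel)", OF _ ind])
      show "finite J" by (simp add: J_def)
      fix z
      show "S z \<in> sets (PiM (N z) (\<lambda>_. borel))"
        unfolding S_def by (rule sets_PiM_I_finite[OF finN]) (simp add: A_def)
      have "ctr z \<in> N z" by (simp add: N_def sup_norm_eq_0_iff[THEN iffD2])
      then have ne: "N z \<noteq> {}" by blast
      have "?X z -` S z \<inter> space M = (\<Inter>y\<in>N z. \<tau> y -` A z y \<inter> space M)"
        using ne by (auto simp: S_def PiE_iff)
      then show "F m / 2 \<le> prob (?X z -` S z \<inter> space M)"
        using prob_isolated_trap_ge[OF K', where m = m and c = "ctr z"] by (simp add: N_def A_def)
    qed (simp add: tail_nonneg)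
    also have "\<dots> \<le> exp (- (c * (real n ^ CARD('d) * F m)))"
    proof -
      have "(n - 2) div 5 * 5 + 4 \<ge> n - 2" by linarith
      then have "real n / 10 \<le> real (2 * ((n - 2) div 5) + 1)"
        using n by linarith
      then have "(real n / 10) ^ CARD('d) \<le> real (card J)"
        unfolding J_def card_box by (intro power_mono) auto
      then have "(real n / 10) ^ CARD('d) * (F m / 2) \<le> real (card J) * (F m / 2)"
        using tail_nonneg by (intro mult_right_mono) auto
      then show ?thesis by (simp add: c_def power_divide)
    qed
    finally show ?thesis .
  qed
  then show ?thesis using C0 c0 by blast
qed

lemma shell_conductance_le_1:
  assumes "a \<in> {0..1}"
  shows "shell_conductance a (\<lambda>x. \<tau> x \<omega>) c k \<le> shell_conductance 1 (\<lambda>x. \<tau> x \<omega>) c k"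
  unfolding shell_conductance_def
proof (rule sum_mono)
  fix p :: "(int ^ 'd) \<times> (int ^ 'd)"
  show "(case p of (x, y) \<Rightarrow> conductance a (\<lambda>x. \<tau> x \<omega>) x y)
      \<le> (case p of (x, y) \<Rightarrow> conductance 1 (\<lambda>x. \<tau> x \<omega>) x y)"
    using assms tau_nonneg tau_ge_1
      conductance_le_mult[of "\<lambda>x. \<tau> x \<omega>" "fst p" "snd p" a]
    by (cases p) (simp add: conductance_def)
qed

lemma shell_conductance_1:
  "shell_conductance 1 (\<lambda>x. \<tau> x \<omega>) c k = (\<Sum>(x, y)\<in>shell_edges c k. \<tau> x \<omega> * \<tau> y \<omega>)"
  unfolding shell_conductance_def conductance_def using tau_nonneg by simp

text \<open>For \<open>\<alpha> > 1\<close> the truncated means stay bounded; Fatou's lemma removes the truncation.\<close>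

lemma integrable_tau:
  assumes "1 < \<alpha>" shows "integrable M (\<tau> x)"
proof -
  define p where "p = (1 + \<alpha>) / 2"
  have p: "0 < p" "p < \<alpha>" "p \<noteq> 1" "1 < p" using assms by (auto simp: p_def)
  obtain C where C: "0 < C" "\<And>m. 1 \<le> m \<Longrightarrow> truncated_mean m \<le> C * max 1 (m powr (1 - p))"
    using truncated_mean_bound[OF p(1-3)] by blast
  let ?f = "\<lambda>k \<omega>. ennreal (min (\<tau> x \<omega>) (real (Suc k)))"
  have le: "(\<integral>\<^sup>+\<omega>. ?f k \<omega> \<partial>M) \<le> ennreal C" for k
  proof -
    have "(\<integral>\<^sup>+\<omega>. ?f k \<omega> \<partial>M) = ennreal (expectation (\<lambda>\<omega>. min (\<tau> x \<omega>) (real (Suc k))))"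
      by (rule nn_integral_eq_integral) (auto intro!: integrable_min AE_I2 tau_nonneg)
    also have "\<dots> = ennreal (truncated_mean (real (Suc k)))" by (simp only: expectation_min)
    also have "\<dots> \<le> ennreal (C * max 1 (real (Suc k) powr (1 - p)))"
      by (intro ennreal_leI C) simp
    also have "max 1 (real (Suc k) powr (1 - p)) = 1"
      using p by (intro max_absorb1 powr_nonpos_le_one) auto
    finally show ?thesis by simp
  qed
  have "(\<integral>\<^sup>+\<omega>. ennreal (\<tau> x \<omega>) \<partial>M) = (\<integral>\<^sup>+\<omega>. liminf (\<lambda>k. ?f k \<omega>) \<partial>M)"
  proof (rule nn_integral_cong)
    fix \<omega>
    obtain k0 :: nat where k0: "\<tau> x \<omega> \<le> real k0" using real_arch_simple by blast
    have "(\<lambda>k. ?f k \<omega>) \<longlonglongrightarrow> ennreal (\<tau> x \<omega>)"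
    proof (rule tendsto_eventually)
      show "\<forall>\<^sub>F k in sequentially. ?f k \<omega> = ennreal (\<tau> x \<omega>)"
        using eventually_ge_at_top[of k0] by eventually_elim (use k0 in \<open>simp add: min_def\<close>)
    qed
    then show "ennreal (\<tau> x \<omega>) = liminf (\<lambda>k. ?f k \<omega>)"
      by (intro lim_imp_Liminf[symmetric]) auto
  qed
  also have "\<dots> \<le> liminf (\<lambda>k. \<integral>\<^sup>+\<omega>. ?f k \<omega> \<partial>M)"
    by (rule nn_integral_liminf) measurable
  also have "\<dots> \<le> liminf (\<lambda>k :: nat. ennreal C)"
    by (rule Liminf_mono) (use le in auto)
  also have "\<dots> = ennreal C" by (simp add: Liminf_const)
  also have "\<dots> < \<infinity>" by simp
  finally show ?thesis
    by (intro integrableI_nonneg) (auto intro!: AE_I2 tau_nonneg)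
qed

text \<open>For \<open>\<alpha> > 1\<close> this is Markov's inequality, as the two ends of an edge are independent with finite mean.
  In dimension 1 the shells have a bounded number of sites, all of which are likely to be below a large
  constant \<open>K\<close>.\<close>

lemma shell_conductance_tight:
  assumes "CARD('d) = 1 \<or> 1 < \<alpha>"
  shows "\<exists>L>0. \<forall>n\<ge>1. \<forall>k\<le>n.
    prob {\<omega>\<in>space M. L * real n ^ (CARD('d) - 1) < shell_conductance 1 (\<lambda>x. \<tau> x \<omega>) 0 k} \<le> 1 / 8"
proof (cases "1 < \<alpha>")
  case True
  define \<mu> where "\<mu> = expectation (\<tau> 0)"
  have mu: "expectation (\<tau> x) = \<mu>" for x
    using expectation_tau[of "\<lambda>t. t" x] by (simp add: \<mu>_def)
  have mu0: "1 \<le> \<mu>"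
    unfolding \<mu>_def using integral_mono[OF _ integrable_tau[OF True, of 0], of "\<lambda>_. 1"] tau_ge_1
    by (simp add: prob_space)
  have prod: "integrable M (\<lambda>\<omega>. \<tau> x \<omega> * \<tau> y \<omega>)" "expectation (\<lambda>\<omega>. \<tau> x \<omega> * \<tau> y \<omega>) = \<mu>\<^sup>2"
    if "x \<noteq> y" for x y
  proof -
    have ind: "indep_vars (\<lambda>_. borel) \<tau> {x, y}" by (rule indep_vars_subset[OF indep]) simp
    show "integrable M (\<lambda>\<omega>. \<tau> x \<omega> * \<tau> y \<omega>)"
      using indep_vars_integrable[OF _ ind integrable_tau[OF True]] that by simp
    show "expectation (\<lambda>\<omega>. \<tau> x \<omega> * \<tau> y \<omega>) = \<mu>\<^sup>2"
      using indep_vars_lebesgue_integral[OF _ ind integrable_tau[OF True]] that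
      by (simp add: mu power2_eq_square)
  qed
  define L where "L = 8 * (4 * (real CARD('d))\<^sup>2 * 3 ^ (CARD('d) - 1) * \<mu>\<^sup>2)"
  have L0: "0 < L" using mu0 by (simp add: L_def)
  have "prob {\<omega>\<in>space M. L * real n ^ (CARD('d) - 1) < shell_conductance 1 (\<lambda>x. \<tau> x \<omega>) 0 k} \<le> 1 / 8"
    if n: "1 \<le> n" and k: "k \<le> n" for n k
  proof -
    let ?E = "shell_edges (0 :: int ^ 'd) k"
    let ?D = "\<lambda>\<omega>. \<Sum>(x, y)\<in>?E. \<tau> x \<omega> * \<tau> y \<omega>"
    have ne: "fst q \<noteq> snd q" if "q \<in> ?E" for q using that by (auto simp: shell_edges_def)
    have int: "integrable M ?D"
      unfolding case_prod_unfold by (intro Bochner_Integration.integrable_sum prod ne)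
    have "expectation ?D = (\<Sum>q\<in>?E. \<mu>\<^sup>2)"
      unfolding case_prod_unfold
    proof (subst Bochner_Integration.integral_sum)
      show "(\<Sum>q\<in>?E. expectation (\<lambda>\<omega>. \<tau> (fst q) \<omega> * \<tau> (snd q) \<omega>)) = (\<Sum>q\<in>?E. \<mu>\<^sup>2)"
        by (intro sum.cong refl prod ne)
    qed (intro prod ne)
    also have "\<dots> = real (card ?E) * \<mu>\<^sup>2" by simp
    also have "\<dots> \<le> (4 * (real CARD('d))\<^sup>2 * (3 ^ (CARD('d) - 1) * real n ^ (CARD('d) - 1))) * \<mu>\<^sup>2"
    proof (rule mult_right_mono)
      have "real (card ?E) \<le> real (4 * CARD('d)\<^sup>2 * (2 * k + 1) ^ (CARD('d) - 1))"
        by (intro of_nat_mono card_shell_edges_le)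
      also have "\<dots> = 4 * (real CARD('d))\<^sup>2 * real (2 * k + 1) ^ (CARD('d) - 1)" by simp
      also have "\<dots> \<le> 4 * (real CARD('d))\<^sup>2 * (3 * real n) ^ (CARD('d) - 1)"
        using n k by (intro mult_left_mono power_mono) auto
      finally show "real (card ?E) \<le> 4 * (real CARD('d))\<^sup>2 * (3 ^ (CARD('d) - 1) * real n ^ (CARD('d) - 1))"
        by (simp add: power_mult_distrib)
    qed simp
    also have "\<dots> = L * real n ^ (CARD('d) - 1) / 8" by (simp add: L_def algebra_simps)
    finally have E: "expectation ?D \<le> L * real n ^ (CARD('d) - 1) / 8" .
    have pos: "0 < L * real n ^ (CARD('d) - 1)" using L0 n by simp
    have "prob {\<omega>\<in>space M. L * real n ^ (CARD('d) - 1) < ?D \<omega>}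
        \<le> prob {\<omega>\<in>space M. L * real n ^ (CARD('d) - 1) \<le> ?D \<omega>}"
      using int by (intro finite_measure_mono) auto
    also have "\<dots> \<le> expectation ?D / (L * real n ^ (CARD('d) - 1))"
      by (rule integral_Markov_inequality_measure[OF int, where A = "{}"])
         (use pos in \<open>auto intro!: AE_I2 sum_nonneg mult_nonneg_nonneg tau_nonneg\<close>)
    also have "\<dots> \<le> 1 / 8" using E pos by (simp add: pos_divide_le_eq)
    finally show ?thesis by (simp add: shell_conductance_1)
  qed
  then show ?thesis using L0 by blast
next
  case False
  then have d: "CARD('d) = 1" using assms by simp
  have "\<forall>\<^sub>F K in at_top. F K < 1 / 64" by (rule order_tendstoD(2)[OF tail_tendsto_0]) simp
  then have "\<forall>\<^sub>F K in at_top. F K < 1 / 64 \<and> 1 \<le> K"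
    using eventually_ge_at_top[of 1] by eventually_elim simp
  then obtain K where K: "F K < 1 / 64" "1 \<le> K" by (auto simp: eventually_at_top_linorder)
  have "prob {\<omega>\<in>space M. 4 * K\<^sup>2 * real n ^ (CARD('d) - 1) < shell_conductance 1 (\<lambda>x. \<tau> x \<omega>) 0 k} \<le> 1 / 8"
    for n k
  proof -
    let ?E = "shell_edges (0 :: int ^ 'd) k"
    let ?V = "fst ` ?E \<union> snd ` ?E"
    have fin: "finite ?E" by (rule card_shell_edges_le)
    have cE: "card ?E \<le> 4" using card_shell_edges_le(2)[of "0 :: int ^ 'd" k] by (simp add: d)
    have cV: "card ?V \<le> 8"
      using card_Un_le[of "fst ` ?E" "snd ` ?E"] card_image_le[OF fin, of fst] card_image_le[OF fin, of snd] cE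
      by linarith
    have "prob {\<omega>\<in>space M. 4 * K\<^sup>2 * real n ^ (CARD('d) - 1) < shell_conductance 1 (\<lambda>x. \<tau> x \<omega>) 0 k}
        \<le> prob {\<omega>\<in>space M. \<exists>x\<in>?V. K < \<tau> x \<omega>}"
    proof (rule finite_measure_mono)
      show "{\<omega>\<in>space M. 4 * K\<^sup>2 * real n ^ (CARD('d) - 1) < shell_conductance 1 (\<lambda>x. \<tau> x \<omega>) 0 k}
        \<subseteq> {\<omega>\<in>space M. \<exists>x\<in>?V. K < \<tau> x \<omega>}"
      proof
        fix \<omega> assume w: "\<omega> \<in> {\<omega>\<in>space M. 4 * K\<^sup>2 * real n ^ (CARD('d) - 1) < shell_conductance 1 (\<lambda>x. \<tau> x \<omega>) 0 k}"
        show "\<omega> \<in> {\<omega>\<in>space M. \<exists>x\<in>?V. K < \<tau> x \<omega>}"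
        proof (rule ccontr)
          assume "\<omega> \<notin> {\<omega>\<in>space M. \<exists>x\<in>?V. K < \<tau> x \<omega>}"
          then have le: "\<tau> x \<omega> \<le> K" if "x \<in> ?V" for x using w that by force
          have "(\<Sum>(x, y)\<in>?E. \<tau> x \<omega> * \<tau> y \<omega>) \<le> (\<Sum>q\<in>?E. K * K)"
            unfolding case_prod_unfold
            by (intro sum_mono mult_mono le) (use K tau_nonneg in auto)
          also have "\<dots> \<le> 4 * (K * K)" using cE by (simp add: mult_right_mono)
          finally show False using w by (simp add: shell_conductance_1 d power2_eq_square)
        qed
      qed
      show "{\<omega>\<in>space M. \<exists>x\<in>?V. K < \<tau> x \<omega>} \<in> sets M"
        by (rule sets.sets_Collect_finite_Ex) (use fin in auto)
    qed
    also have "\<dots> \<le> real (card ?V) * F K" by (rule prob_max_gt_le) (use fin in auto)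
    also have "\<dots> \<le> 8 * (1 / 64)" using cV K tail_nonneg by (intro mult_mono) auto
    finally show ?thesis by simp
  qed
  then show ?thesis using K by (intro exI[of _ "4 * K\<^sup>2"]) auto
qed

text \<open>Between \<open>n / 2\<close> and \<open>n\<close> only shells with even index are used, because the conductances of
  consecutive shells share sites while those at distance 2 are independent. Each is bad with
  probability at most \<open>1 / 8\<close>, so that more than half of them are good up to an exponentially small
  probability.\<close>

lemma eigenvalue_upper_shells:
  assumes "CARD('d) = 1 \<or> 1 < \<alpha>"
  shows "\<exists>C>0. \<forall>n\<ge>4. \<exists>E\<in>sets M. prob E \<le> exp (- (real n / 32)) \<and>
    (\<forall>a\<in>{0..1}. \<forall>\<omega>\<in>space M - E. \<forall>S. S \<subseteq> lattice_box (n div 2) \<and> S \<noteq> {} \<longrightarrow>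
       eigenvalue a n \<omega> \<le> C * real n ^ CARD('d) / (real n)\<^sup>2 / (\<Sum>x\<in>S. \<tau> x \<omega>))"
proof -
  obtain L where L: "0 < L" and tight: "\<And>n k. 1 \<le> n \<Longrightarrow> k \<le> n \<Longrightarrow>
    prob {\<omega>\<in>space M. L * real n ^ (CARD('d) - 1) < shell_conductance 1 (\<lambda>x. \<tau> x \<omega>) 0 k} \<le> 1 / 8"
    using shell_conductance_tight[OF assms] by blast
  have main: "\<exists>E\<in>sets M. prob E \<le> exp (- (real n / 32)) \<and>
    (\<forall>a\<in>{0..1}. \<forall>\<omega>\<in>space M - E. \<forall>S. S \<subseteq> lattice_box (n div 2) \<and> S \<noteq> {} \<longrightarrow>
       eigenvalue a n \<omega> \<le> 16 * L * real n ^ CARD('d) / (real n)\<^sup>2 / (\<Sum>x\<in>S. \<tau> x \<omega>))"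
    if n: "4 \<le> n" for n
  proof -
    define b where "b = L * real n ^ (CARD('d) - 1)"
    \<comment> \<open>for these \<open>j\<close> the shell with index \<open>2 j\<close> lies between \<open>n / 2\<close> and \<open>n\<close>\<close>
    define J where "J = {n div 4 + 1..n div 2}"
    have cJ: "real n / 8 \<le> real (card J)"
    proof -
      have "n \<le> 8 * card J" using n unfolding J_def by simp
      then show ?thesis by linarith
    qed
    \<comment> \<open>the sites that the conductance of the shell with index \<open>2 j\<close> depends on\<close>
    define N where "N j = {x :: int ^ 'd. sup_norm x = 2 * j \<or> sup_norm x = Suc (2 * j)}" for j
    define E where "E j = shell_edges (0 :: int ^ 'd) (2 * j)" for j
    have finE: "finite (E j)" for j unfolding E_def by (rule card_shell_edges_le)
    have EN: "x \<in> N j" "y \<in> N j" if "(x, y) \<in> E j" for x y j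
      using that by (auto simp: E_def N_def shell_edges_def)
    define Y where "Y j f = (if b < (\<Sum>(x, y)\<in>E j. f x * f y) then 1 else 0 :: real)" for j f
    let ?X = "\<lambda>j \<omega>. Y j (restrict (\<lambda>x. \<tau> x \<omega>) (N j))"
    have X: "?X j \<omega> = (if b < shell_conductance 1 (\<lambda>x. \<tau> x \<omega>) 0 (2 * j) then 1 else 0)" for j \<omega>
    proof -
      have "(\<Sum>(x, y)\<in>E j. restrict (\<lambda>x. \<tau> x \<omega>) (N j) x * restrict (\<lambda>x. \<tau> x \<omega>) (N j) y)
          = (\<Sum>(x, y)\<in>E j. \<tau> x \<omega> * \<tau> y \<omega>)"
        by (rule sum.cong) (use EN in auto)
      then show ?thesis by (simp add: Y_def shell_conductance_1 E_def)
    qed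
    have "disjoint_family_on N J"
      unfolding disjoint_family_on_def
    proof (intro ballI impI)
      fix i j :: nat assume "i \<noteq> j"
      then have "2 * i \<noteq> 2 * j" "2 * i \<noteq> Suc (2 * j)" "Suc (2 * i) \<noteq> 2 * j" by presburger+
      then show "N i \<inter> N j = {}" by (auto simp: N_def)
    qed
    then have "indep_vars (\<lambda>j. PiM (N j) (\<lambda>_. borel)) (\<lambda>j \<omega>. restrict (\<lambda>x. \<tau> x \<omega>) (N j)) J"
      by (intro indep_vars_restrict[OF indep]) auto
    then have ind: "indep_vars (\<lambda>_. borel) ?X J"
    proof (rule indep_vars_compose2)
      fix j
      have "(\<lambda>f. \<Sum>q\<in>E j. f (fst q) * f (snd q)) \<in> borel_measurable (PiM (N j) (\<lambda>_. borel :: real measure))"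
      proof (intro borel_measurable_sum borel_measurable_times)
        fix q assume "q \<in> E j"
        then have "fst q \<in> N j" "snd q \<in> N j" using EN[of "fst q" "snd q" j] by auto
        then show "(\<lambda>f. f (fst q)) \<in> borel_measurable (PiM (N j) (\<lambda>_. borel :: real measure))"
            "(\<lambda>f. f (snd q)) \<in> borel_measurable (PiM (N j) (\<lambda>_. borel :: real measure))"
          by (auto intro: measurable_component_singleton)
      qed
      then show "Y j \<in> measurable (PiM (N j) (\<lambda>_. borel)) borel"
        unfolding Y_def case_prod_unfold by measurable
    qed
    define bad where "bad = {\<omega>\<in>space M. real (card J) / 2 \<le> (\<Sum>j\<in>J. ?X j \<omega>)}"
    have Xm: "?X j \<in> borel_measurable M" if "j \<in> J" for j using ind that by (auto simp: indep_vars_def)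
    have bad_sets: "bad \<in> sets M"
      unfolding bad_def using Xm by measurable
    have EX: "expectation (?X j) \<le> 1 / 8" if j: "j \<in> J" for j
    proof -
      let ?A = "{\<omega>\<in>space M. b < shell_conductance 1 (\<lambda>x. \<tau> x \<omega>) 0 (2 * j)}"
      have "expectation (?X j) = expectation (indicator ?A)"
        unfolding X by (intro Bochner_Integration.integral_cong) (auto simp: indicator_def)
      also have "\<dots> = prob ?A" unfolding shell_conductance_1 case_prod_unfold by simp
      also have "\<dots> \<le> 1 / 8" unfolding b_def using n j by (intro tight) (auto simp: J_def)
      finally show ?thesis .
    qed
    have "prob bad \<le> exp ((2 * (\<Sum>j\<in>J. expectation (?X j)) - real (card J) / 2) / 1)"
      unfolding bad_def by (rule prob_sum_ge_le_exp[OF _ ind]) (auto simp: J_def X)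
    also have "\<dots> \<le> exp (- (real n / 32))"
    proof -
      have "(\<Sum>j\<in>J. expectation (?X j)) \<le> (\<Sum>j\<in>J. 1 / 8)" by (intro sum_mono EX)
      also have "\<dots> = real (card J) / 8" by simp
      finally show ?thesis using cJ by simp
    qed
    finally have pb: "prob bad \<le> exp (- (real n / 32))" .
    have good: "eigenvalue a n \<omega> \<le> 16 * L * real n ^ CARD('d) / (real n)\<^sup>2 / (\<Sum>x\<in>S. \<tau> x \<omega>)"
      if a: "a \<in> {0..1}" and w: "\<omega> \<in> space M - bad" and S: "S \<subseteq> lattice_box (n div 2)" "S \<noteq> {}" for a \<omega> S
    proof -
      define J' where "J' = {j\<in>J. ?X j \<omega> = 0}"
      have finJ: "finite J" by (simp add: J_def)
      have sumX: "(\<Sum>j\<in>J. ?X j \<omega>) = real (card J) - real (card J')"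
      proof -
        have "(\<Sum>j\<in>J. ?X j \<omega>) = (\<Sum>j\<in>J. 1 - (if j \<in> J' then 1 else 0))"
          by (rule sum.cong) (auto simp: J'_def X)
        also have "\<dots> = real (card J) - (\<Sum>j\<in>J. if j \<in> J' then 1 else 0)" by (simp add: sum_subtractf)
        also have "(\<Sum>j\<in>J. if j \<in> J' then 1 else 0 :: real) = (\<Sum>j\<in>J'. 1)"
          using finJ by (intro sum.mono_neutral_cong_right) (auto simp: J'_def)
        also have "real (card J) - (\<Sum>j\<in>J'. 1) = real (card J) - real (card J')" by simp
        finally show ?thesis .
      qed
      have "(\<Sum>j\<in>J. ?X j \<omega>) < real (card J) / 2" using w by (auto simp: bad_def)
      then have cJ': "real n / 16 < real (card J')" using sumX cJ by linarith
      define G where "G = (\<lambda>j. 2 * j) ` J'"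
      have cG: "card G = card J'" unfolding G_def by (rule card_image) (auto simp: inj_on_def)
      have G0: "G \<noteq> {}" using cJ' by (auto simp: G_def)
      have "eigenvalue a n \<omega> \<le> b / real (card G) / (\<Sum>x\<in>S. \<tau> x \<omega>)"
        unfolding eigenvalue_def
      proof (rule principal_eigenvalue_le_good_shells[where m = "n div 2", OF tau_ge_1 _ G0 _ _ S])
        show "G \<subseteq> {n div 2..n}" by (auto simp: G_def J'_def J_def)
        fix k assume "k \<in> G"
        then obtain j where j: "k = 2 * j" "?X j \<omega> = 0" by (auto simp: G_def J'_def)
        then have "shell_conductance 1 (\<lambda>x. \<tau> x \<omega>) 0 k \<le> b"
          unfolding X by (auto split: if_splits)
        then show "shell_conductance a (\<lambda>x. \<tau> x \<omega>) 0 k \<le> b"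
          using shell_conductance_le_1[OF a, of \<omega> 0 k] by simp
      qed simp
      also have "\<dots> \<le> b / (real n / 16) / (\<Sum>x\<in>S. \<tau> x \<omega>)"
      proof (intro divide_right_mono divide_left_mono)
        show "0 \<le> (\<Sum>x\<in>S. \<tau> x \<omega>)" by (intro sum_nonneg tau_nonneg)
        show "0 \<le> b" using L by (simp add: b_def)
        show "0 < real (card G) * (real n / 16)" using cJ' n cG by (intro mult_pos_pos) auto
      qed (use cJ' cG in simp)
      also have "b / (real n / 16) = 16 * L * real n ^ CARD('d) / (real n)\<^sup>2"
      proof -
        have "real n ^ CARD('d) = real n * real n ^ (CARD('d) - 1)"
          by (metis power_minus_mult mult.commute zero_less_card_finite)
        then show ?thesis using n by (simp add: b_def power2_eq_square)
      qed
      finally show ?thesis .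
    qed
    show ?thesis using bad_sets pb good by blast
  qed
  show ?thesis using L main by (intro exI[of _ "16 * L"]) simp
qed

end

section \<open>Almost sure behaviour\<close>

text \<open>The losses \<open>1 / (j + 1)\<close> in the exponent form a countable family, so that the hypotheses can be
  checked on a countable intersection of almost sure events.\<close>

lemma log_ratio_tendsto:
  fixes e :: "nat \<Rightarrow> real"
  assumes low: "\<And>j. \<exists>c>0. \<forall>\<^sub>F n in sequentially. c * real n powr (- (L + 1 / real (Suc j))) \<le> e n"
    and up: "\<And>j. \<exists>C. \<forall>\<^sub>F n in sequentially. e n \<le> C * real n powr (- (L - 1 / real (Suc j)))"
  shows "(\<lambda>n. - (ln (e n) / ln (real n))) \<longlonglongrightarrow> L"
proof (rule tendstoI)
  fix r :: real assume r: "0 < r"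
  obtain j :: nat where j: "1 / real (Suc j) < r / 2" using nat_approx_posE[of "r / 2"] r by auto
  obtain c where c: "0 < c" "\<forall>\<^sub>F n in sequentially. c * real n powr (- (L + 1 / real (Suc j))) \<le> e n"
    using low by blast
  obtain C' where "\<forall>\<^sub>F n in sequentially. e n \<le> C' * real n powr (- (L - 1 / real (Suc j)))"
    using up by blast
  define C where "C = max 1 C'"
  have C: "0 < C" by (simp add: C_def)
  have upC: "\<forall>\<^sub>F n in sequentially. e n \<le> C * real n powr (- (L - 1 / real (Suc j)))"
    using \<open>\<forall>\<^sub>F n in sequentially. e n \<le> C' * real n powr (- (L - 1 / real (Suc j)))\<close>
  proof eventually_elim
    case (elim n)
    have "C' * real n powr (- (L - 1 / real (Suc j))) \<le> C * real n powr (- (L - 1 / real (Suc j)))"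
      by (intro mult_right_mono) (auto simp: C_def)
    then show ?case using elim by simp
  qed
  have lnlim: "filterlim (\<lambda>n. ln (real n)) at_top sequentially"
    by (rule filterlim_compose[OF ln_at_top filterlim_real_sequentially])
  have small: "\<forall>\<^sub>F n in sequentially. \<bar>x / ln (real n)\<bar> < r / 2" for x :: real
  proof -
    have "(\<lambda>n. x / ln (real n)) \<longlonglongrightarrow> 0"
      by (rule real_tendsto_divide_at_top[OF tendsto_const lnlim])
    from tendstoD[OF this, of "r / 2"] show ?thesis using r by (simp add: dist_real_def)
  qed
  show "\<forall>\<^sub>F n in sequentially. dist (- (ln (e n) / ln (real n))) L < r"
    using c(2) upC small[of "ln c"] small[of "ln C"] eventually_ge_at_top[of 2]
  proof eventually_elim
    case (elim n)
    have n: "1 < real n" "0 < ln (real n)" using elim(5) by auto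
    have e0: "0 < e n" using elim(1) c(1) n(1) by (intro less_le_trans[OF _ elim(1)]) simp
    have "ln (c * real n powr (- (L + 1 / real (Suc j)))) \<le> ln (e n)"
      using elim(1) c(1) n(1) by (intro ln_mono) auto
    then have "ln c - (L + 1 / real (Suc j)) * ln (real n) \<le> ln (e n)"
      using c(1) n(1) by (simp add: ln_mult ln_powr algebra_simps)
    then have "(ln c - (L + 1 / real (Suc j)) * ln (real n)) / ln (real n) \<le> ln (e n) / ln (real n)"
      using n(2) by (intro divide_right_mono) auto
    then have 1: "ln c / ln (real n) - (L + 1 / real (Suc j)) \<le> ln (e n) / ln (real n)"
      using n(2) by (simp add: diff_divide_distrib)
    have "ln (e n) \<le> ln (C * real n powr (- (L - 1 / real (Suc j))))"
      using elim(2) e0 by (intro ln_mono) auto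
    then have "ln (e n) \<le> ln C - (L - 1 / real (Suc j)) * ln (real n)"
      using C n(1) by (simp add: ln_mult ln_powr algebra_simps)
    then have "ln (e n) / ln (real n) \<le> (ln C - (L - 1 / real (Suc j)) * ln (real n)) / ln (real n)"
      using n(2) by (intro divide_right_mono) auto
    then have 2: "ln (e n) / ln (real n) \<le> ln C / ln (real n) - (L - 1 / real (Suc j))"
      using n(2) by (simp add: diff_divide_distrib)
    show ?case using 1 2 elim(3,4) j unfolding dist_real_def by linarith
  qed
qed

lemma summable_exp_powr:
  assumes "0 < c" "0 < \<theta>"
  shows "summable (\<lambda>n. exp (- (c * real n powr \<theta>)))"
proof (rule summable_comparison_test_ev)
  have "((\<lambda>n. exp (- (c * real n powr \<theta>)) * real n ^ 2) \<longlongrightarrow> 0) sequentially"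
    using assms by real_asymp
  then have "\<forall>\<^sub>F n in sequentially. exp (- (c * real n powr \<theta>)) * real n ^ 2 < 1"
    by (rule order_tendstoD) simp
  then show "\<forall>\<^sub>F n in sequentially. norm (exp (- (c * real n powr \<theta>))) \<le> inverse (real n ^ 2)"
    using eventually_ge_at_top[of 1]
  proof eventually_elim
    case (elim n)
    have "0 < real n ^ 2" using elim(2) by simp
    then show ?case using elim(1) by (simp add: field_simps)
  qed
  show "summable (\<lambda>n. inverse (real n ^ 2))"
    by (rule inverse_power_summable) simp
qed

context trap_environment
begin

lemma prob_between_ge:
  fixes X :: "'w \<Rightarrow> real"
  assumes [measurable]: "X \<in> borel_measurable M"
    and "prob {\<omega>\<in>space M. X \<omega> < \<eta>} \<le> \<epsilon> / 2" "prob {\<omega>\<in>space M. K < X \<omega>} \<le> \<epsilon> / 2"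
  shows "1 - \<epsilon> \<le> prob {\<omega>\<in>space M. \<eta> \<le> X \<omega> \<and> X \<omega> \<le> K}"
proof -
  have eq: "{\<omega>\<in>space M. \<eta> \<le> X \<omega> \<and> X \<omega> \<le> K}
      = space M - ({\<omega>\<in>space M. X \<omega> < \<eta>} \<union> {\<omega>\<in>space M. K < X \<omega>})" by auto
  have "prob ({\<omega>\<in>space M. X \<omega> < \<eta>} \<union> {\<omega>\<in>space M. K < X \<omega>}) \<le> \<epsilon>"
    using measure_Un_le[of "{\<omega>\<in>space M. X \<omega> < \<eta>}" M "{\<omega>\<in>space M. K < X \<omega>}"] assms by simp
  then show ?thesis unfolding eq by (subst prob_compl) auto
qed

lemma card_half_box_ge: "real n ^ CARD('d) \<le> real (card (lattice_box (n div 2) :: (int ^ 'd) set))"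
  unfolding card_box by (intro power_mono) auto

text \<open>The assumption on \<open>\<alpha>\<close> says that the trap exponent at \<open>\<alpha>\<close> is less than 2, which persists for some
  \<open>p < \<alpha>\<close>; the lower bound is then of order \<open>n\<^sup>-\<^sup>2\<close>. For the upper bound the test function is 1 on
  the box of radius \<open>n / 2\<close>, whose mass is at least \<open>n\<^sup>d\<close> because \<open>\<tau> \<ge> 1\<close>.\<close>

theorem eigenvalue_diffusive_bounds:
  assumes reg: "(CARD('d) \<ge> 2 \<and> \<alpha> > real CARD('d) / 2) \<or> (CARD('d) = 1 \<and> \<alpha> > 1)"
  shows "\<exists>k1>0. \<exists>k2>0. \<forall>a\<in>{0..1}. AE \<omega> in M. \<forall>\<^sub>F n in sequentially.
    k1 / (real n)\<^sup>2 \<le> eigenvalue a n \<omega> \<and> eigenvalue a n \<omega> \<le> k2 / (real n)\<^sup>2"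
proof -
  \<comment> \<open>the trap exponent is 2 exactly at \<open>p0\<close>\<close>
  define p0 where "p0 = (if CARD('d) = 1 then 1 else real CARD('d) / 2)"
  define p where "p = (p0 + \<alpha>) / 2"
  have p0: "1 \<le> p0" "p0 < \<alpha>" using reg by (auto simp: p0_def)
  then have p: "0 < p" "p < \<alpha>" "p \<noteq> 1" "p0 < p" by (auto simp: p_def)
  have "trap_exponent p < 2"
  proof (cases "CARD('d) = 1")
    case True
    then show ?thesis using p p0 by (simp add: trap_exponent_def)
  next
    case False
    then have "real CARD('d) < 2 * p" using p(4) by (simp add: p0_def)
    then show ?thesis using False p(1) by (simp add: trap_exponent_def divide_less_eq)
  qed
  then obtain c where c: "0 < c" and low: "\<And>a. 0 \<le> a \<Longrightarrow> AE \<omega> in M. \<forall>\<^sub>F n in sequentially.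
    c / ((real n)\<^sup>2 + real n powr (trap_exponent p + (2 - trap_exponent p))) \<le> eigenvalue a n \<omega>"
    using eigenvalue_lower_AE[OF p(1-3), of "2 - trap_exponent p"] by auto
  have "CARD('d) = 1 \<or> 1 < \<alpha>" using reg by auto
  then obtain C where C: "0 < C" and up: "\<And>n. 4 \<le> n \<Longrightarrow> \<exists>E\<in>sets M. prob E \<le> exp (- (real n / 32)) \<and>
    (\<forall>a\<in>{0..1}. \<forall>\<omega>\<in>space M - E. \<forall>S. S \<subseteq> lattice_box (n div 2) \<and> S \<noteq> {} \<longrightarrow>
       eigenvalue a n \<omega> \<le> C * real n ^ CARD('d) / (real n)\<^sup>2 / (\<Sum>x\<in>S. \<tau> x \<omega>))"
    using eigenvalue_upper_shells by blast
  have "AE \<omega> in M. \<forall>\<^sub>F n in sequentially.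
    c / 2 / (real n)\<^sup>2 \<le> eigenvalue a n \<omega> \<and> eigenvalue a n \<omega> \<le> C / (real n)\<^sup>2" if a: "a \<in> {0..1}" for a
  proof -
    have bound: "prob {\<omega>\<in>space M. C / (real n)\<^sup>2 < eigenvalue a n \<omega>} \<le> exp (- (1 / 32 * real n powr 1))"
      if n: "4 \<le> n" for n
    proof -
      let ?B = "lattice_box (n div 2) :: (int ^ 'd) set"
      obtain E where E: "E \<in> sets M" "prob E \<le> exp (- (real n / 32))"
        "\<And>\<omega>. \<omega> \<in> space M - E \<Longrightarrow> eigenvalue a n \<omega> \<le> C * real n ^ CARD('d) / (real n)\<^sup>2 / (\<Sum>x\<in>?B. \<tau> x \<omega>)"
      proof -
        have "(0 :: int ^ 'd) \<in> ?B" by (simp add: lattice_box_def)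
        then have ne: "?B \<noteq> {}" by blast
        obtain E where E: "E \<in> sets M" "prob E \<le> exp (- (real n / 32))"
          and H: "\<forall>a\<in>{0..1}. \<forall>\<omega>\<in>space M - E. \<forall>S. S \<subseteq> lattice_box (n div 2) \<and> S \<noteq> {} \<longrightarrow>
            eigenvalue a n \<omega> \<le> C * real n ^ CARD('d) / (real n)\<^sup>2 / (\<Sum>x\<in>S. \<tau> x \<omega>)"
          using up[OF n] by blast
        have "eigenvalue a n \<omega> \<le> C * real n ^ CARD('d) / (real n)\<^sup>2 / (\<Sum>x\<in>?B. \<tau> x \<omega>)"
          if "\<omega> \<in> space M - E" for \<omega>
          using bspec[OF bspec[OF H a] that] ne by simp
        then show ?thesis by (rule that[OF E])
      qed
      have "prob {\<omega>\<in>space M. C / (real n)\<^sup>2 < eigenvalue a n \<omega>} \<le> prob E"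
      proof (rule finite_measure_mono[OF _ E(1)], rule subsetI, rule ccontr)
        fix \<omega> assume w: "\<omega> \<in> {\<omega>\<in>space M. C / (real n)\<^sup>2 < eigenvalue a n \<omega>}" "\<omega> \<notin> E"
        have nd: "0 < real n ^ CARD('d)" using n by simp
        have "real (card ?B) \<le> (\<Sum>x\<in>?B. \<tau> x \<omega>)"
          using sum_mono[of ?B "\<lambda>_. 1" "\<lambda>x. \<tau> x \<omega>"] tau_ge_1 by simp
        then have "real n ^ CARD('d) \<le> (\<Sum>x\<in>?B. \<tau> x \<omega>)"
          by (rule order_trans[OF card_half_box_ge])
        then have "C * real n ^ CARD('d) / (real n)\<^sup>2 / (\<Sum>x\<in>?B. \<tau> x \<omega>)
            \<le> C * real n ^ CARD('d) / (real n)\<^sup>2 / real n ^ CARD('d)"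
          using C nd total_mass_pos[of \<omega> "n div 2"] by (intro divide_left_mono mult_pos_pos) auto
        also have "\<dots> = C / (real n)\<^sup>2" using nd by simp
        finally show False using E(3)[of \<omega>] w by auto
      qed
      then show ?thesis using E(2) n by simp
    qed
    have "AE \<omega> in M. \<forall>\<^sub>F n in sequentially. \<not> C / (real n)\<^sup>2 < eigenvalue a n \<omega>"
    proof (rule AE_eventually_of_summable)
      show "summable (\<lambda>n. prob {\<omega>\<in>space M. C / (real n)\<^sup>2 < eigenvalue a n \<omega>})"
      proof (rule summable_comparison_test_ev)
        show "\<forall>\<^sub>F n in sequentially. norm (prob {\<omega>\<in>space M. C / (real n)\<^sup>2 < eigenvalue a n \<omega>})
            \<le> exp (- (1 / 32 * real n powr 1))"
          using eventually_ge_at_top[of 4] by eventually_elim (use bound in simp)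
      qed (rule summable_exp_powr, auto)
    qed measurable
    moreover have "AE \<omega> in M. \<forall>\<^sub>F n in sequentially. c / (2 * (real n)\<^sup>2) \<le> eigenvalue a n \<omega>"
    proof -
      have eq: "(real n)\<^sup>2 + real n powr (trap_exponent p + (2 - trap_exponent p)) = 2 * (real n)\<^sup>2" for n
        by simp
      show ?thesis using low[of a] a unfolding eq by simp
    qed
    ultimately show ?thesis
    proof eventually_elim
      case (elim \<omega>)
      then show ?case by eventually_elim (simp add: not_less)
    qed
  qed
  then show ?thesis using c C by (intro exI[of _ "c / 2"] conjI exI[of _ C]) auto
qed

text \<open>The order of the energy needed to localise a test function at a deep trap. The value 1 is not
  optimal in dimension 2 for \<open>a = 0\<close>, where \<open>1 / ln n\<close> can be reached.\<close>

definition trap_energy :: "nat \<Rightarrow> real" where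
  "trap_energy n = (if CARD('d) = 1 then 1 / real n else 1)"

lemma eigenvalue_upper_prob:
  "\<exists>C>0. \<exists>c>0. \<forall>n\<ge>5. \<forall>a\<in>{0..1}. \<forall>m>0.
    prob {\<omega>\<in>space M. C * trap_energy n / m < eigenvalue a n \<omega>}
      \<le> exp (- (real n / 32)) + exp (- (c * (real n ^ CARD('d) * F m)))"
proof (cases "CARD('d) = 1")
  case False
  obtain C c where "0 < C" "0 < c" and pr: "\<And>n a m. 5 \<le> n \<Longrightarrow> a \<in> {0..1} \<Longrightarrow> 0 < m \<Longrightarrow>
    prob {\<omega>\<in>space M. C / m < eigenvalue a n \<omega>} \<le> exp (- (c * (real n ^ CARD('d) * F m)))"
    using eigenvalue_upper_isolated_prob by blast
  moreover have "prob {\<omega>\<in>space M. C * trap_energy n / m < eigenvalue a n \<omega>}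
      \<le> exp (- (real n / 32)) + exp (- (c * (real n ^ CARD('d) * F m)))"
    if "5 \<le> n" "a \<in> {0..1}" "0 < m" for n a m
    using pr[OF that] False by (simp add: trap_energy_def add_increasing)
  ultimately show ?thesis by blast
next
  case True
  obtain C where C: "0 < C" and up: "\<And>n. 4 \<le> n \<Longrightarrow> \<exists>E\<in>sets M. prob E \<le> exp (- (real n / 32)) \<and>
    (\<forall>a\<in>{0..1}. \<forall>\<omega>\<in>space M - E. \<forall>S. S \<subseteq> lattice_box (n div 2) \<and> S \<noteq> {} \<longrightarrow>
       eigenvalue a n \<omega> \<le> C * real n ^ CARD('d) / (real n)\<^sup>2 / (\<Sum>x\<in>S. \<tau> x \<omega>))"
    using eigenvalue_upper_shells True by blast
  have "prob {\<omega>\<in>space M. C * trap_energy n / m < eigenvalue a n \<omega>}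
      \<le> exp (- (real n / 32)) + exp (- (1 * (real n ^ CARD('d) * F m)))"
    if n: "5 \<le> n" and a: "a \<in> {0..1}" and m: "0 < m" for n a m
  proof -
    let ?B = "lattice_box (n div 2) :: (int ^ 'd) set"
    have n4: "4 \<le> n" using n by simp
    obtain E where E: "E \<in> sets M" "prob E \<le> exp (- (real n / 32))"
      and H: "\<forall>a\<in>{0..1}. \<forall>\<omega>\<in>space M - E. \<forall>S. S \<subseteq> lattice_box (n div 2) \<and> S \<noteq> {} \<longrightarrow>
        eigenvalue a n \<omega> \<le> C * real n ^ CARD('d) / (real n)\<^sup>2 / (\<Sum>x\<in>S. \<tau> x \<omega>)"
      using up[OF n4] by blast
    let ?N = "{\<omega>\<in>space M. \<forall>x\<in>?B. \<tau> x \<omega> \<le> m}"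
    have Ns: "?N \<in> sets M" by (rule sets.sets_Collect_finite_All) auto
    have "prob {\<omega>\<in>space M. C * trap_energy n / m < eigenvalue a n \<omega>} \<le> prob (E \<union> ?N)"
    proof (rule finite_measure_mono, rule subsetI, rule ccontr)
      fix \<omega> assume w: "\<omega> \<in> {\<omega>\<in>space M. C * trap_energy n / m < eigenvalue a n \<omega>}" "\<omega> \<notin> E \<union> ?N"
      then obtain x where x: "x \<in> ?B" "m < \<tau> x \<omega>" by (auto simp: not_le)
      have wE: "\<omega> \<in> space M - E" using w by simp
      have "eigenvalue a n \<omega> \<le> C * real n ^ CARD('d) / (real n)\<^sup>2 / (\<Sum>x\<in>{x}. \<tau> x \<omega>)"
        using spec[OF bspec[OF bspec[OF H a] wE], of "{x}"] x(1) by simp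
      also have "\<dots> = C * trap_energy n / \<tau> x \<omega>"
        using True n by (simp add: trap_energy_def power2_eq_square)
      also have "\<dots> \<le> C * trap_energy n / m"
        using x m C by (intro divide_left_mono) (auto simp: trap_energy_def)
      finally show False using w by simp
    qed (use E Ns in auto)
    also have "\<dots> \<le> prob E + prob ?N" by (rule measure_Un_le[OF E(1) Ns])
    also have "prob ?N \<le> exp (- (real (card ?B) * F m))" by (rule prob_max_le_le) simp
    also have "\<dots> \<le> exp (- (1 * (real n ^ CARD('d) * F m)))"
      using mult_right_mono[OF card_half_box_ge[of n] tail_nonneg[of m]] by simp
    finally show ?thesis using E(2) by simp
  qed
  then show ?thesis using C by (intro exI[of _ C] conjI exI[of _ "1::real"]) auto
qed

lemma trap_energy_pos: "1 \<le> n \<Longrightarrow> 0 < trap_energy n"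
  by (simp add: trap_energy_def)

text \<open>Below the typical maximum by a factor \<open>n\<^sup>-\<^sup>\<epsilon>\<close>, a box contains polynomially many deeper traps on
  average.\<close>

lemma box_tail_lower:
  assumes "0 < \<epsilon>" "\<epsilon> < real CARD('d) / \<alpha>"
  obtains c \<theta> where "0 < c" "0 < \<theta>"
    "\<And>n. 1 \<le> n \<Longrightarrow> c * real n powr \<theta> \<le> real n ^ CARD('d) * F (real n powr (real CARD('d) / \<alpha> - \<epsilon>))"
proof -
  define D where "D = real CARD('d)"
  have D: "1 \<le> D" by (simp add: D_def Suc_leI)
  define \<beta> where "\<beta> = D / \<alpha> - \<epsilon>"
  have b: "0 < \<beta>" using assms by (simp add: \<beta>_def D_def)
  have "\<beta> * \<alpha> < D" using alpha_pos assms(1) by (simp add: \<beta>_def field_simps)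
  then have "\<alpha> < D / \<beta>" using b by (simp add: field_simps)
  then obtain p where p: "\<alpha> < p" "p < D / \<beta>" using dense by blast
  obtain c where c: "0 < c" "\<And>t. 1 \<le> t \<Longrightarrow> c * t powr (- p) \<le> F t"
    using tail_lower_bound[OF p(1)] by blast
  show ?thesis
  proof (rule that[OF c(1), of "D - \<beta> * p"])
    show "0 < D - \<beta> * p" using p(2) b by (simp add: field_simps)
    fix n :: nat assume n: "1 \<le> n"
    have m: "1 \<le> real n powr \<beta>" using n b by (intro ge_one_powr_ge_zero) auto
    have "c * real n powr (D - \<beta> * p) = real n powr D * (c * (real n powr \<beta>) powr (- p))"
    proof -
      have "(real n powr \<beta>) powr (- p) = real n powr (\<beta> * (- p))" by (rule powr_powr)
      moreover have "real n powr (D - \<beta> * p) = real n powr D * real n powr (\<beta> * (- p))"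
        unfolding powr_add[symmetric] by simp
      ultimately show ?thesis by simp
    qed
    also have "\<dots> \<le> real n powr D * F (real n powr \<beta>)"
      using c(2)[OF m] by (intro mult_left_mono) auto
    also have "real n powr D = real n ^ CARD('d)" using n by (simp add: D_def powr_realpow)
    finally show "c * real n powr (D - \<beta> * p) \<le> real n ^ CARD('d) * F (real n powr (real CARD('d) / \<alpha> - \<epsilon>))"
      by (simp add: \<beta>_def D_def)
  qed
qed

lemma eigenvalue_upper_AE:
  assumes e: "0 < \<epsilon>" "\<epsilon> < real CARD('d) / \<alpha>" and a: "a \<in> {0..1}"
  shows "\<exists>C. AE \<omega> in M. \<forall>\<^sub>F n in sequentially.
    eigenvalue a n \<omega> \<le> C * real n powr (- (trap_exponent \<alpha> - \<epsilon>))"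
proof -
  obtain C c where C: "0 < C" "0 < c" and pr: "\<And>n a m. 5 \<le> n \<Longrightarrow> a \<in> {0..1} \<Longrightarrow> 0 < m \<Longrightarrow>
    prob {\<omega>\<in>space M. C * trap_energy n / m < eigenvalue a n \<omega>}
      \<le> exp (- (real n / 32)) + exp (- (c * (real n ^ CARD('d) * F m)))"
    using eigenvalue_upper_prob by blast
  define \<beta> where "\<beta> = real CARD('d) / \<alpha> - \<epsilon>"
  obtain c' \<theta> where c': "0 < c'" "0 < \<theta>"
    "\<And>n. 1 \<le> n \<Longrightarrow> c' * real n powr \<theta> \<le> real n ^ CARD('d) * F (real n powr \<beta>)"
    using box_tail_lower[OF e] unfolding \<beta>_def by blast
  let ?P = "\<lambda>n \<omega>. C * trap_energy n / real n powr \<beta> < eigenvalue a n \<omega>"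
  have "AE \<omega> in M. \<forall>\<^sub>F n in sequentially. \<not> ?P n \<omega>"
  proof (rule AE_eventually_of_summable)
    show "summable (\<lambda>n. prob {\<omega>\<in>space M. ?P n \<omega>})"
    proof (rule summable_comparison_test_ev)
      show "\<forall>\<^sub>F n in sequentially. norm (prob {\<omega>\<in>space M. ?P n \<omega>})
          \<le> exp (- (1 / 32 * real n powr 1)) + exp (- (c * c' * real n powr \<theta>))"
        using eventually_ge_at_top[of 5]
      proof eventually_elim
        case (elim n)
        have "c * (c' * real n powr \<theta>) \<le> c * (real n ^ CARD('d) * F (real n powr \<beta>))"
          using c'(3)[of n] elim C by (intro mult_left_mono) auto
        then have E: "exp (- (c * (real n ^ CARD('d) * F (real n powr \<beta>)))) \<le> exp (- (c * c' * real n powr \<theta>))"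
          by (simp add: mult.assoc)
        have "prob {\<omega>\<in>space M. ?P n \<omega>} \<le> exp (- (real n / 32)) + exp (- (c * c' * real n powr \<theta>))"
          by (rule order_trans[OF pr[OF elim a] add_left_mono[OF E]]) (use elim in simp)
        then show ?case by simp
      qed
      show "summable (\<lambda>n. exp (- (1 / 32 * real n powr 1)) + exp (- (c * c' * real n powr \<theta>)))"
        by (intro summable_add summable_exp_powr) (use C c' in auto)
    qed
  qed measurable
  then have "AE \<omega> in M. \<forall>\<^sub>F n in sequentially.
      eigenvalue a n \<omega> \<le> C * real n powr (- (trap_exponent \<alpha> - \<epsilon>))"
  proof eventually_elim
    case (elim \<omega>)
    then show ?case using eventually_ge_at_top[of 1]
    proof eventually_elim
      case (elim n)
      have "trap_energy n / real n powr \<beta> = real n powr (- (trap_exponent \<alpha> - \<epsilon>))"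
      proof (cases "CARD('d) = 1")
        case True
        have "real n powr (- (trap_exponent \<alpha> - \<epsilon>)) = real n powr (- 1) * real n powr (- \<beta>)"
        proof -
          have "- (trap_exponent \<alpha> - \<epsilon>) = - 1 + - \<beta>" using True by (simp add: trap_exponent_def \<beta>_def)
          then show ?thesis by (simp only: powr_add)
        qed
        then show ?thesis using True elim(2) by (simp add: trap_energy_def powr_minus_divide)
      next
        case False
        have "real n powr (- (trap_exponent \<alpha> - \<epsilon>)) = real n powr (- \<beta>)"
          using False by (simp add: trap_exponent_def \<beta>_def)
        then show ?thesis using False by (simp add: trap_energy_def powr_minus_divide)
      qed
      then have "C * trap_energy n / real n powr \<beta> = C * real n powr (- (trap_exponent \<alpha> - \<epsilon>))"
        by (metis times_divide_eq_right)
      then show ?case using elim(1) by simp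
    qed
  qed
  then show ?thesis by blast
qed

text \<open>One solves \<open>d / p = d / \<alpha> + t\<close> for \<open>p\<close>; two candidates for \<open>t\<close> are needed as one of them might
  give the excluded value \<open>p = 1\<close>.\<close>

lemma exists_close_moment:
  assumes "0 < \<epsilon>"
  obtains p \<delta> where "0 < p" "p < \<alpha>" "p \<noteq> 1" "0 < \<delta>" "trap_exponent p + \<delta> = trap_exponent \<alpha> + \<epsilon>"
proof -
  define D where "D = real CARD('d)"
  have D: "0 < D" by (simp add: D_def)
  have pos: "0 < D / \<alpha> + t" if "0 \<le> t" for t using D alpha_pos that by (intro add_pos_nonneg) auto
  have key: "0 < D / (D / \<alpha> + t)" "D / (D / \<alpha> + t) < \<alpha>" "D / (D / (D / \<alpha> + t)) = D / \<alpha> + t"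
    if "0 < t" for t
  proof -
    show "0 < D / (D / \<alpha> + t)" using D pos[of t] that by simp
    have "D < \<alpha> * (D / \<alpha> + t)" using alpha_pos that by (simp add: distrib_left)
    then show "D / (D / \<alpha> + t) < \<alpha>" using pos[of t] that by (simp add: pos_divide_less_eq mult.commute)
    show "D / (D / (D / \<alpha> + t)) = D / \<alpha> + t" using D by simp
  qed
  define t where "t = (if D / (D / \<alpha> + \<epsilon> / 2) \<noteq> 1 then \<epsilon> / 2 else \<epsilon> / 4)"
  have t: "0 < t" "t < \<epsilon>" using assms by (auto simp: t_def)
  have "D / (D / \<alpha> + t) \<noteq> 1"
  proof (cases "D / (D / \<alpha> + \<epsilon> / 2) \<noteq> 1")
    case True
    then show ?thesis by (simp add: t_def)
  next
    case False
    have p2: "0 < D / \<alpha> + \<epsilon> / 2" "0 < D / \<alpha> + \<epsilon> / 4" using pos assms by auto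
    have "D = D / \<alpha> + \<epsilon> / 2" using False p2 by (simp add: divide_eq_1_iff)
    then have "D \<noteq> D / \<alpha> + \<epsilon> / 4" using assms by simp
    then show ?thesis using False p2 by (simp add: t_def divide_eq_1_iff)
  qed
  then show ?thesis
    using key[OF t(1)] t
    by (intro that[of "D / (D / \<alpha> + t)" "\<epsilon> - t"]) (auto simp: trap_exponent_def D_def)
qed

text \<open>If the trap exponent is less than 2, the diffusive bounds apply. Otherwise the upper bound comes from
  the deepest trap. In both cases moments of order \<open>p\<close> close to \<open>\<alpha>\<close> give the lower bound up to an
  arbitrarily small loss in the exponent.\<close>

theorem eigenvalue_exponent:
  assumes a: "a \<in> {0..1}"
  shows "AE \<omega> in M. (\<lambda>n. - (ln (eigenvalue a n \<omega>) / ln (real n))) \<longlonglongrightarrow> max 2 (trap_exponent \<alpha>)"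
proof -
  define L where "L = max 2 (trap_exponent \<alpha>)"
  have low: "\<exists>c>0. AE \<omega> in M. \<forall>\<^sub>F n in sequentially. c * real n powr (- (L + \<epsilon>)) \<le> eigenvalue a n \<omega>"
    if e: "0 < \<epsilon>" for \<epsilon>
  proof -
    obtain p \<delta> where p: "0 < p" "p < \<alpha>" "p \<noteq> 1" "0 < \<delta>" "trap_exponent p + \<delta> = trap_exponent \<alpha> + \<epsilon>"
      using exists_close_moment[OF e] by blast
    obtain c where c: "0 < c" "AE \<omega> in M. \<forall>\<^sub>F n in sequentially.
      c / ((real n)\<^sup>2 + real n powr (trap_exponent \<alpha> + \<epsilon>)) \<le> eigenvalue a n \<omega>"
      using eigenvalue_lower_AE[OF p(1-4)] a unfolding p(5) by auto
    have "AE \<omega> in M. \<forall>\<^sub>F n in sequentially. c / 2 * real n powr (- (L + \<epsilon>)) \<le> eigenvalue a n \<omega>"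
      using c(2)
    proof eventually_elim
      case (elim \<omega>)
      then show ?case using eventually_ge_at_top[of 1]
      proof eventually_elim
        case (elim n)
        have n1: "1 \<le> real n" using elim(2) by simp
        have "(real n)\<^sup>2 = real n powr 2" using n1 by simp
        also have "\<dots> \<le> real n powr (L + \<epsilon>)" using e n1 by (intro powr_mono) (auto simp: L_def)
        finally have "(real n)\<^sup>2 + real n powr (trap_exponent \<alpha> + \<epsilon>) \<le> 2 * real n powr (L + \<epsilon>)"
          using powr_mono[of "trap_exponent \<alpha> + \<epsilon>" "L + \<epsilon>" "real n"] n1 by (simp add: L_def)
        moreover have "0 < (real n)\<^sup>2 + real n powr (trap_exponent \<alpha> + \<epsilon>)"
          using n1 by (intro add_pos_nonneg) auto
        ultimately have "c / (2 * real n powr (L + \<epsilon>)) \<le> c / ((real n)\<^sup>2 + real n powr (trap_exponent \<alpha> + \<epsilon>))"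
          using c(1) n1 by (intro divide_left_mono mult_pos_pos) auto
        moreover have "c / (2 * real n powr (L + \<epsilon>)) = c / 2 * real n powr (- (L + \<epsilon>))"
          by (simp only: powr_minus_divide) simp
        ultimately show ?case using elim(1) by linarith
      qed
    qed
    then show ?thesis using c(1) by (intro exI[of _ "c / 2"]) simp
  qed
  have up: "\<exists>C. AE \<omega> in M. \<forall>\<^sub>F n in sequentially. eigenvalue a n \<omega> \<le> C * real n powr (- (L - \<epsilon>))"
    if e: "0 < \<epsilon>" for \<epsilon>
  proof (cases "trap_exponent \<alpha> < 2")
    case True
    have reg: "(CARD('d) \<ge> 2 \<and> \<alpha> > real CARD('d) / 2) \<or> (CARD('d) = 1 \<and> \<alpha> > 1)"
    proof (cases "CARD('d) = 1")
      case T: True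
      then show ?thesis using True alpha_pos by (simp add: trap_exponent_def divide_less_eq)
    next
      case F: False
      then have "2 \<le> CARD('d)" using zero_less_card_finite[where 'a = 'd] by linarith
      moreover have "real CARD('d) < 2 * \<alpha>"
        using True F alpha_pos by (simp add: trap_exponent_def divide_less_eq)
      ultimately show ?thesis by simp
    qed
    obtain k2 where k2: "0 < k2" "AE \<omega> in M. \<forall>\<^sub>F n in sequentially. eigenvalue a n \<omega> \<le> k2 / (real n)\<^sup>2"
    proof -
      obtain k1 k2 where k: "0 < k2" "AE \<omega> in M. \<forall>\<^sub>F n in sequentially.
          k1 / (real n)\<^sup>2 \<le> eigenvalue a n \<omega> \<and> eigenvalue a n \<omega> \<le> k2 / (real n)\<^sup>2"
        using eigenvalue_diffusive_bounds[OF reg] a by blast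
      from k(2) have "AE \<omega> in M. \<forall>\<^sub>F n in sequentially. eigenvalue a n \<omega> \<le> k2 / (real n)\<^sup>2"
      proof eventually_elim
        case (elim \<omega>)
        then show ?case by eventually_elim simp
      qed
      then show ?thesis using that k(1) by blast
    qed
    from k2(2) have "AE \<omega> in M. \<forall>\<^sub>F n in sequentially. eigenvalue a n \<omega> \<le> k2 * real n powr (- (L - \<epsilon>))"
    proof eventually_elim
      case (elim \<omega>)
      then show ?case using eventually_ge_at_top[of 1]
      proof eventually_elim
        case (elim n)
        have "k2 / (real n)\<^sup>2 = k2 * real n powr (- 2)" using elim(2) by (simp add: powr_minus_divide)
        also have "\<dots> \<le> k2 * real n powr (- (L - \<epsilon>))"
          using k2(1) elim(2) e True by (intro mult_left_mono powr_mono) (auto simp: L_def)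
        finally show ?case using elim(1) by simp
      qed
    qed
    then show ?thesis by blast
  next
    case False
    define \<epsilon>' where "\<epsilon>' = min \<epsilon> (real CARD('d) / \<alpha> / 2)"
    have Da: "0 < real CARD('d) / \<alpha>" using alpha_pos by simp
    then have e': "0 < \<epsilon>'" "\<epsilon>' < real CARD('d) / \<alpha>" using e by (auto simp: \<epsilon>'_def min_less_iff_disj)
    obtain C' where C': "AE \<omega> in M. \<forall>\<^sub>F n in sequentially.
      eigenvalue a n \<omega> \<le> C' * real n powr (- (trap_exponent \<alpha> - \<epsilon>'))"
      using eigenvalue_upper_AE[OF e' a] by blast
    from C' have "AE \<omega> in M. \<forall>\<^sub>F n in sequentially. eigenvalue a n \<omega> \<le> max 0 C' * real n powr (- (L - \<epsilon>))"
    proof eventually_elim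
      case (elim \<omega>)
      then show ?case using eventually_ge_at_top[of 1]
      proof eventually_elim
        case (elim n)
        have "C' * real n powr (- (trap_exponent \<alpha> - \<epsilon>')) \<le> max 0 C' * real n powr (- (L - \<epsilon>))"
          using elim(2) False by (intro mult_mono powr_mono) (auto simp: L_def \<epsilon>'_def)
        then show ?case using elim(1) by simp
      qed
    qed
    then show ?thesis by blast
  qed
  have "\<exists>c. \<forall>j. 0 < c j \<and> (AE \<omega> in M. \<forall>\<^sub>F n in sequentially.
      c j * real n powr (- (L + 1 / real (Suc j))) \<le> eigenvalue a n \<omega>)"
    by (rule choice) (use low in auto)
  then obtain c where c: "\<And>j. 0 < c j" "\<And>j. AE \<omega> in M. \<forall>\<^sub>F n in sequentially.
      c j * real n powr (- (L + 1 / real (Suc j))) \<le> eigenvalue a n \<omega>" by blast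
  have "\<exists>C. \<forall>j. (AE \<omega> in M. \<forall>\<^sub>F n in sequentially.
      eigenvalue a n \<omega> \<le> C j * real n powr (- (L - 1 / real (Suc j))))"
    by (rule choice) (use up in auto)
  then obtain C where C: "\<And>j. AE \<omega> in M. \<forall>\<^sub>F n in sequentially.
      eigenvalue a n \<omega> \<le> C j * real n powr (- (L - 1 / real (Suc j)))" by blast
  have "AE \<omega> in M. \<forall>j. \<forall>\<^sub>F n in sequentially. c j * real n powr (- (L + 1 / real (Suc j))) \<le> eigenvalue a n \<omega>"
    unfolding AE_all_countable using c(2) by blast
  moreover have "AE \<omega> in M. \<forall>j. \<forall>\<^sub>F n in sequentially.
      eigenvalue a n \<omega> \<le> C j * real n powr (- (L - 1 / real (Suc j)))"
    unfolding AE_all_countable using C by blast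
  ultimately have "AE \<omega> in M. (\<lambda>n. - (ln (eigenvalue a n \<omega>) / ln (real n))) \<longlonglongrightarrow> L"
  proof eventually_elim
    case (elim \<omega>)
    show ?case by (rule log_ratio_tendsto) (use elim c(1) in blast)+
  qed
  then show ?thesis by (simp add: L_def)
qed

section \<open>Tightness from above\<close>

lemma filterlim_box_volume: "filterlim (\<lambda>n. real n ^ CARD('d)) at_top sequentially"
  by (rule filterlim_pow_at_top[OF _ filterlim_real_sequentially]) simp

lemma exp_tail_quantile_small:
  assumes "0 < \<epsilon>" "0 < c"
  shows "\<exists>\<eta>>0. \<forall>\<^sub>F n in sequentially. exp (- (c * (real n ^ CARD('d) * F (\<eta> * quantile (real n ^ CARD('d)))))) \<le> \<epsilon>"
proof -
  have "((\<lambda>\<eta>. exp (- (c * ((2 * \<eta>) powr (- \<alpha>) / 2)))) \<longlongrightarrow> 0) (at_right 0)"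
    using alpha_pos assms(2) by real_asymp
  then have "\<forall>\<^sub>F \<eta> in at_right 0. exp (- (c * ((2 * \<eta>) powr (- \<alpha>) / 2))) < \<epsilon>"
    by (rule order_tendstoD) (use assms in simp)
  then have "\<forall>\<^sub>F \<eta> in at_right 0. exp (- (c * ((2 * \<eta>) powr (- \<alpha>) / 2))) < \<epsilon> \<and> 0 < \<eta>"
    using eventually_at_right_less[of 0] by eventually_elim simp
  then obtain \<eta> where \<eta>: "exp (- (c * ((2 * \<eta>) powr (- \<alpha>) / 2))) < \<epsilon>" "0 < \<eta>"
    using eventually_happens'[OF trivial_limit_at_right_real] by blast
  have "\<forall>\<^sub>F n in sequentially. (2 * \<eta>) powr (- \<alpha>) / 2 \<le> real n ^ CARD('d) * F (\<eta> * quantile (real n ^ CARD('d)))"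
    by (rule eventually_compose_filterlim[OF tail_quantile_lower[OF \<eta>(2)] filterlim_box_volume])
  then have "\<forall>\<^sub>F n in sequentially. exp (- (c * (real n ^ CARD('d) * F (\<eta> * quantile (real n ^ CARD('d)))))) \<le> \<epsilon>"
  proof eventually_elim
    case (elim n)
    have "c * ((2 * \<eta>) powr (- \<alpha>) / 2) \<le> c * (real n ^ CARD('d) * F (\<eta> * quantile (real n ^ CARD('d))))"
      using elim assms(2) by (intro mult_left_mono) auto
    then have "exp (- (c * (real n ^ CARD('d) * F (\<eta> * quantile (real n ^ CARD('d))))))
        \<le> exp (- (c * ((2 * \<eta>) powr (- \<alpha>) / 2)))" by simp
    then show ?case using \<eta>(1) by linarith
  qed
  then show ?thesis using \<eta>(2) by blast
qed

theorem eigenvalue_upper_tight: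
  assumes e: "0 < \<epsilon>" and a: "a \<in> {0..1}"
  shows "\<exists>K>0. \<forall>\<^sub>F n in sequentially.
    prob {\<omega>\<in>space M. K < quantile (real n ^ CARD('d)) / trap_energy n * eigenvalue a n \<omega>} \<le> \<epsilon>"
proof -
  obtain C c where C: "0 < C" "0 < c" and pr: "\<And>n a m. 5 \<le> n \<Longrightarrow> a \<in> {0..1} \<Longrightarrow> 0 < m \<Longrightarrow>
    prob {\<omega>\<in>space M. C * trap_energy n / m < eigenvalue a n \<omega>}
      \<le> exp (- (real n / 32)) + exp (- (c * (real n ^ CARD('d) * F m)))"
    using eigenvalue_upper_prob by blast
  obtain \<eta> where \<eta>: "0 < \<eta>" "\<forall>\<^sub>F n in sequentially.
      exp (- (c * (real n ^ CARD('d) * F (\<eta> * quantile (real n ^ CARD('d)))))) \<le> \<epsilon> / 2"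
    using exp_tail_quantile_small[of "\<epsilon> / 2" c] e C by auto
  have "((\<lambda>n. exp (- (real n / 32))) \<longlongrightarrow> 0) sequentially" by real_asymp
  then have small: "\<forall>\<^sub>F n in sequentially. exp (- (real n / 32)) < \<epsilon> / 2"
    by (rule order_tendstoD) (use e in simp)
  have "\<forall>\<^sub>F n in sequentially.
    prob {\<omega>\<in>space M. C / \<eta> < quantile (real n ^ CARD('d)) / trap_energy n * eigenvalue a n \<omega>} \<le> \<epsilon>"
    using \<eta>(2) small eventually_ge_at_top[of 5]
  proof eventually_elim
    case (elim n)
    have x1: "1 < real n ^ CARD('d)" using elim(3) by (intro one_less_power) auto
    have q: "0 < quantile (real n ^ CARD('d))" using quantile_ge_1[OF x1] by simp
    have t: "0 < trap_energy n" using elim(3) by (intro trap_energy_pos) simp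
    have "C / \<eta> < quantile (real n ^ CARD('d)) / trap_energy n * eigenvalue a n \<omega>
        \<longleftrightarrow> C * trap_energy n / (\<eta> * quantile (real n ^ CARD('d))) < eigenvalue a n \<omega>" for \<omega>
      using q t \<eta>(1) by (simp add: field_simps)
    then show ?case
      using pr[OF elim(3) a, of "\<eta> * quantile (real n ^ CARD('d))"] q \<eta>(1) elim(1,2) by simp
  qed
  then show ?thesis using C(1) \<eta>(1) by (intro exI[of _ "C / \<eta>"]) simp
qed

theorem eigenvalue_planar_upper_tight:
  assumes e: "0 < \<epsilon>" and d: "CARD('d) = 2"
  shows "\<exists>K>0. \<forall>\<^sub>F n in sequentially.
    prob {\<omega>\<in>space M. K < ln (real n) * quantile ((real n)\<^sup>2) * eigenvalue 0 n \<omega>} \<le> \<epsilon>"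
proof -
  obtain \<eta> where \<eta>: "0 < \<eta>" "\<forall>\<^sub>F n in sequentially.
      exp (- (1 * (real n ^ CARD('d) * F (\<eta> * quantile (real n ^ CARD('d)))))) \<le> \<epsilon>"
    using exp_tail_quantile_small[of \<epsilon> 1] e by auto
  have "\<forall>\<^sub>F n in sequentially.
    prob {\<omega>\<in>space M. 64 / \<eta> < ln (real n) * quantile ((real n)\<^sup>2) * eigenvalue 0 n \<omega>} \<le> \<epsilon>"
    using \<eta>(2) eventually_ge_at_top[of 4]
  proof eventually_elim
    case (elim n)
    let ?B = "lattice_box (n div 2) :: (int ^ 'd) set"
    have x1: "1 < real n ^ CARD('d)" using elim(2) by (intro one_less_power) auto
    have q: "0 < quantile ((real n)\<^sup>2)" using quantile_ge_1[OF x1] by (simp add: d)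
    have l: "0 < ln (real n)" using elim(2) by simp
    define m where "m = \<eta> * quantile ((real n)\<^sup>2)"
    have m: "0 < m" using q \<eta>(1) by (simp add: m_def)
    have "prob {\<omega>\<in>space M. 64 / \<eta> < ln (real n) * quantile ((real n)\<^sup>2) * eigenvalue 0 n \<omega>}
        \<le> prob {\<omega>\<in>space M. \<forall>x\<in>?B. \<tau> x \<omega> \<le> m}"
    proof (rule finite_measure_mono)
      show "{\<omega>\<in>space M. 64 / \<eta> < ln (real n) * quantile ((real n)\<^sup>2) * eigenvalue 0 n \<omega>}
          \<subseteq> {\<omega>\<in>space M. \<forall>x\<in>?B. \<tau> x \<omega> \<le> m}"
      proof (rule subsetI, rule ccontr)
        fix \<omega> assume w: "\<omega> \<in> {\<omega>\<in>space M. 64 / \<eta> < ln (real n) * quantile ((real n)\<^sup>2) * eigenvalue 0 n \<omega>}"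
          "\<omega> \<notin> {\<omega>\<in>space M. \<forall>x\<in>?B. \<tau> x \<omega> \<le> m}"
        then obtain x where x: "x \<in> ?B" "m < \<tau> x \<omega>" by (auto simp: not_le)
        have "eigenvalue 0 n \<omega> \<le> 64 / ln (real n) / \<tau> x \<omega>"
          unfolding eigenvalue_def
          by (rule principal_eigenvalue_le_planar_trap[OF tau_ge_1 d elim(2) x(1)])
        also have "\<dots> \<le> 64 / ln (real n) / m" using x(2) m l by (intro divide_left_mono) auto
        finally have "ln (real n) * quantile ((real n)\<^sup>2) * eigenvalue 0 n \<omega>
            \<le> ln (real n) * quantile ((real n)\<^sup>2) * (64 / ln (real n) / m)"
          using l q by (intro mult_left_mono) auto
        also have "\<dots> = 64 / \<eta>" using l q \<eta>(1) by (simp add: m_def)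
        finally show False using w by simp
      qed
      show "{\<omega>\<in>space M. \<forall>x\<in>?B. \<tau> x \<omega> \<le> m} \<in> sets M" by (rule sets.sets_Collect_finite_All) auto
    qed
    also have "\<dots> \<le> exp (- (real (card ?B) * F m))" by (rule prob_max_le_le) simp
    also have "\<dots> \<le> exp (- (1 * (real n ^ CARD('d) * F m)))"
      using mult_right_mono[OF card_half_box_ge[of n] tail_nonneg[of m]] by simp
    also have "\<dots> \<le> \<epsilon>" using elim(1) by (simp add: m_def d)
    finally show ?case .
  qed
  then show ?thesis using \<eta>(1) by (intro exI[of _ "64 / \<eta>"]) simp
qed

end

section \<open>The theorem for environments bounded below almost surely\<close>

lemma (in prob_space) prob_cong_AE:
  assumes "AE \<omega> in M. X \<omega> = Y \<omega>" and [measurable]: "X \<in> borel_measurable M" "Y \<in> borel_measurable M"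
    and [measurable]: "Measurable.pred borel P"
  shows "prob {\<omega>\<in>space M. P (X \<omega> :: real)} = prob {\<omega>\<in>space M. P (Y \<omega>)}"
proof (rule measure_eq_AE)
  show "AE \<omega> in M. \<omega> \<in> {\<omega>\<in>space M. P (X \<omega>)} \<longleftrightarrow> \<omega> \<in> {\<omega>\<in>space M. P (Y \<omega>)}"
    using assms(1) by eventually_elim simp
qed measurable

text \<open>Replacing the traps by their maximum with 1 changes them only on a null set and does not change
  the law or the tail.\<close>

lemma trap_environment_max_1:
  fixes \<tau> :: "int ^ 'd \<Rightarrow> 'w \<Rightarrow> real"
  assumes "prob_space M"
    and ind: "prob_space.indep_vars M (\<lambda>_. borel) \<tau> UNIV"
    and ident: "\<forall>x. distr M borel (\<tau> x) = distr M borel (\<tau> 0)"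
    and ge: "AE \<omega> in M. \<tau> 0 \<omega> \<ge> 1"
    and alpha: "\<alpha> > 0" and rv: "regularly_varying (tail_prob M (\<tau> 0)) (- \<alpha>)"
  shows "trap_environment M (\<lambda>x \<omega>. max 1 (\<tau> x \<omega>)) \<alpha>"
    and "tail_prob M (\<lambda>\<omega>. max 1 (\<tau> 0 \<omega>)) = tail_prob M (\<tau> 0)"
    and "AE \<omega> in M. \<forall>x. \<tau> x \<omega> = max 1 (\<tau> x \<omega>)"
proof -
  interpret prob_space M by fact
  have rvt [measurable]: "\<tau> x \<in> borel_measurable M" for x using ind by (auto simp: indep_vars_def)
  have ge': "AE \<omega> in M. \<tau> x \<omega> \<ge> 1" for x
  proof -
    have "AE t in distr M borel (\<tau> 0). t \<ge> 1"
      using ge by (subst AE_distr_iff) auto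
    then have "AE t in distr M borel (\<tau> x). t \<ge> 1" using ident by metis
    then show ?thesis by (subst (asm) AE_distr_iff) auto
  qed
  then have "AE \<omega> in M. \<forall>x. \<tau> x \<omega> \<ge> 1" unfolding AE_all_countable by blast
  then show eq: "AE \<omega> in M. \<forall>x. \<tau> x \<omega> = max 1 (\<tau> x \<omega>)"
    by eventually_elim (auto simp: max_def)
  show tail: "tail_prob M (\<lambda>\<omega>. max 1 (\<tau> 0 \<omega>)) = tail_prob M (\<tau> 0)"
  proof
    fix y
    show "tail_prob M (\<lambda>\<omega>. max 1 (\<tau> 0 \<omega>)) y = tail_prob M (\<tau> 0) y"
      unfolding tail_prob_def
    proof (rule measure_eq_AE)
      show "AE \<omega> in M. \<omega> \<in> {\<omega>\<in>space M. y < max 1 (\<tau> 0 \<omega>)} \<longleftrightarrow> \<omega> \<in> {\<omega>\<in>space M. y < \<tau> 0 \<omega>}"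
        using eq by eventually_elim auto
    qed measurable
  qed
  have distr_max: "distr M borel (\<lambda>\<omega>. max 1 (\<tau> x \<omega>)) = distr (distr M borel (\<tau> x)) borel (max 1)" for x
    by (subst distr_distr) (auto simp: comp_def)
  show "trap_environment M (\<lambda>x \<omega>. max 1 (\<tau> x \<omega>)) \<alpha>"
  proof unfold_locales
    show "indep_vars (\<lambda>_. borel) (\<lambda>x \<omega>. max 1 (\<tau> x \<omega>)) UNIV"
      by (rule indep_vars_compose2[OF ind]) measurable
    show "distr M borel (\<lambda>\<omega>. max 1 (\<tau> x \<omega>)) = distr M borel (\<lambda>\<omega>. max 1 (\<tau> 0 \<omega>))" for x
      unfolding distr_max using ident by metis
    show "regularly_varying (tail_prob M (\<lambda>\<omega>. max 1 (\<tau> 0 \<omega>))) (- \<alpha>)" unfolding tail by (rule rv)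
  qed (use alpha in auto)
qed

theorem theorem1p1:
  fixes M :: "'w measure"
    and \<tau> :: "int ^ 'd \<Rightarrow> 'w \<Rightarrow> real"
    and a \<alpha> :: real
    and F h :: "real \<Rightarrow> real"
    and ev ev0 :: "nat \<Rightarrow> 'w \<Rightarrow> real"
  defines "F \<equiv> tail_prob M (\<tau> 0)"
    and "h \<equiv> tail_quantile F"
    and "ev \<equiv> (\<lambda>n \<omega>. principal_dirichlet_eigenvalue a (\<lambda>x. \<tau> x \<omega>) n)"
    and "ev0 \<equiv> (\<lambda>n \<omega>. principal_dirichlet_eigenvalue 0 (\<lambda>x. \<tau> x \<omega>) n)"
  assumes "prob_space M"
    and "prob_space.indep_vars M (\<lambda>_. borel) \<tau> UNIV"
    and "\<forall>x. distr M borel (\<tau> x) = distr M borel (\<tau> 0)"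
    and "AE \<omega> in M. \<tau> 0 \<omega> \<ge> 1"
    and "a \<in> {0..1}" and "\<alpha> > 0"
    and "regularly_varying F (- \<alpha>)"
  shows
    "(AE \<omega> in M. (\<lambda>n. - (ln (ev n \<omega>) / ln (real n))) \<longlonglongrightarrow>
        (if CARD('d) = 1 then max 2 (1 + 1 / \<alpha>) else max 2 (real CARD('d) / \<alpha>)))
    \<and> ((CARD('d) \<ge> 2 \<and> \<alpha> > real CARD('d) / 2) \<or> (CARD('d) = 1 \<and> \<alpha> > 1) \<longrightarrow>
        (\<exists>k1>0. \<exists>k2>0. AE \<omega> in M. \<forall>\<^sub>F n in sequentially.
          k1 / (real n)\<^sup>2 \<le> ev n \<omega> \<and> ev n \<omega> \<le> k2 / (real n)\<^sup>2))
    \<and> (\<alpha> < 1 \<and> CARD('d) \<noteq> 2 \<longrightarrow>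
        (let an = (\<lambda>n. if CARD('d) = 1 then real n * h (real n) else h (real n ^ CARD('d))) in
         \<forall>\<epsilon>>0. \<exists>\<eta>>0. \<exists>K>0. \<forall>\<^sub>F n in sequentially.
           \<P>(\<omega> in M. \<eta> \<le> an n * ev n \<omega> \<and> an n * ev n \<omega> \<le> K) \<ge> 1 - \<epsilon>))
    \<and> (CARD('d) = 2 \<and> \<alpha> < 1 \<longrightarrow>
        (let an = (\<lambda>n. ln (real n) * h ((real n)\<^sup>2)) in
         \<forall>\<epsilon>>0. \<exists>\<eta>>0. \<exists>K>0. \<forall>\<^sub>F n in sequentially.
           \<P>(\<omega> in M. \<eta> \<le> an n * ev0 n \<omega> \<and> an n * ev0 n \<omega> \<le> K) \<ge> 1 - \<epsilon> \<and>
           \<P>(\<omega> in M. \<eta> \<le> an n * ev n \<omega> \<and> an n * ev n \<omega> \<le> ln (real n) * K) \<ge> 1 - \<epsilon>))"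
proof -
  note env = trap_environment_max_1[OF assms(5-8,10) assms(11)[unfolded F_def]]
  interpret trap_environment M "\<lambda>x \<omega>. max 1 (\<tau> x \<omega>)" \<alpha> by (rule env(1))
  have rvt: "\<tau> x \<in> borel_measurable M" for x using assms(6) by (auto simp: indep_vars_def)
  have h: "h = quantile" unfolding h_def F_def env(2)[symmetric] quantile_def ..
  have a: "a \<in> {0..1}" "0 \<le> a" using assms(9) by auto
  have ev_AE: "AE \<omega> in M. \<forall>n. ev n \<omega> = eigenvalue a n \<omega> \<and> ev0 n \<omega> = eigenvalue 0 n \<omega>"
    using env(3)
  proof eventually_elim
    case (elim \<omega>)
    then have "(\<lambda>x. \<tau> x \<omega>) = (\<lambda>x. max 1 (\<tau> x \<omega>))" by blast
    then show ?case unfolding ev_def ev0_def eigenvalue_def by metis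
  qed
  have evm: "ev n \<in> borel_measurable M" "ev0 n \<in> borel_measurable M" for n
    unfolding ev_def ev0_def by (rule principal_eigenvalue_measurable[OF rvt])+
  have prob_ev: "prob {\<omega>\<in>space M. l \<le> s * ev n \<omega> \<and> s * ev n \<omega> \<le> u}
      = prob {\<omega>\<in>space M. l \<le> s * eigenvalue a n \<omega> \<and> s * eigenvalue a n \<omega> \<le> u}" for l s u n
    by (rule prob_cong_AE[OF _ evm(1)], use ev_AE in \<open>eventually_elim, blast\<close>) measurable
  have prob_ev0: "prob {\<omega>\<in>space M. l \<le> s * ev0 n \<omega> \<and> s * ev0 n \<omega> \<le> u}
      = prob {\<omega>\<in>space M. l \<le> s * eigenvalue 0 n \<omega> \<and> s * eigenvalue 0 n \<omega> \<le> u}" for l s u n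
    by (rule prob_cong_AE[OF _ evm(2)], use ev_AE in \<open>eventually_elim, blast\<close>) measurable
  have 1: "AE \<omega> in M. (\<lambda>n. - (ln (ev n \<omega>) / ln (real n))) \<longlonglongrightarrow>
        (if CARD('d) = 1 then max 2 (1 + 1 / \<alpha>) else max 2 (real CARD('d) / \<alpha>))"
  proof -
    have L: "(if CARD('d) = 1 then max 2 (1 + 1 / \<alpha>) else max 2 (real CARD('d) / \<alpha>)) = max 2 (trap_exponent \<alpha>)"
      by (simp add: trap_exponent_def add.commute)
    show ?thesis unfolding L using eigenvalue_exponent[OF a(1)] ev_AE
      by eventually_elim simp
  qed
  have 2: "\<exists>k1>0. \<exists>k2>0. AE \<omega> in M. \<forall>\<^sub>F n in sequentially.
          k1 / (real n)\<^sup>2 \<le> ev n \<omega> \<and> ev n \<omega> \<le> k2 / (real n)\<^sup>2"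
    if reg: "(CARD('d) \<ge> 2 \<and> \<alpha> > real CARD('d) / 2) \<or> (CARD('d) = 1 \<and> \<alpha> > 1)"
  proof -
    obtain k1 k2 where k: "0 < k1" "0 < k2" "AE \<omega> in M. \<forall>\<^sub>F n in sequentially.
        k1 / (real n)\<^sup>2 \<le> eigenvalue a n \<omega> \<and> eigenvalue a n \<omega> \<le> k2 / (real n)\<^sup>2"
      using eigenvalue_diffusive_bounds[OF reg] a(1) by blast
    have "AE \<omega> in M. \<forall>\<^sub>F n in sequentially. k1 / (real n)\<^sup>2 \<le> ev n \<omega> \<and> ev n \<omega> \<le> k2 / (real n)\<^sup>2"
      using k(3) ev_AE by eventually_elim simp
    then show ?thesis using k(1,2) by blast
  qed
  have tight: "\<exists>\<eta>>0. \<exists>K>0. \<forall>\<^sub>F n in sequentially.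
      prob {\<omega>\<in>space M. green_bound CARD('d) n * quantile (real n ^ CARD('d)) * eigenvalue b n \<omega> < \<eta>} \<le> \<epsilon> / 2
      \<and> prob {\<omega>\<in>space M. K < quantile (real n ^ CARD('d)) / trap_energy n * eigenvalue b n \<omega>} \<le> \<epsilon> / 2"
    if b: "\<alpha> < 1" "0 < \<epsilon>" "b \<in> {0..1}" for \<epsilon> b
  proof -
    obtain \<eta> where \<eta>: "0 < \<eta>" "\<forall>\<^sub>F n in sequentially.
      prob {\<omega>\<in>space M. green_bound CARD('d) n * quantile (real n ^ CARD('d)) * eigenvalue b n \<omega> < \<eta>} \<le> \<epsilon> / 2"
      using eigenvalue_lower_tight[OF b(1), of "\<epsilon> / 2" b] b by auto
    obtain K where K: "0 < K" "\<forall>\<^sub>F n in sequentially.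
      prob {\<omega>\<in>space M. K < quantile (real n ^ CARD('d)) / trap_energy n * eigenvalue b n \<omega>} \<le> \<epsilon> / 2"
      using eigenvalue_upper_tight[of "\<epsilon> / 2" b] b by auto
    show ?thesis using \<eta>(1) K(1) eventually_conj[OF \<eta>(2) K(2)] by blast
  qed
  have 3: "let an = (\<lambda>n. if CARD('d) = 1 then real n * h (real n) else h (real n ^ CARD('d))) in
         \<forall>\<epsilon>>0. \<exists>\<eta>>0. \<exists>K>0. \<forall>\<^sub>F n in sequentially.
           prob {\<omega>\<in>space M. \<eta> \<le> an n * ev n \<omega> \<and> an n * ev n \<omega> \<le> K} \<ge> 1 - \<epsilon>"
    if c: "\<alpha> < 1 \<and> CARD('d) \<noteq> 2"
    unfolding Let_def prob_ev
  proof (intro allI impI)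
    let ?an = "\<lambda>n. if CARD('d) = 1 then real n * h (real n) else h (real n ^ CARD('d))"
    fix \<epsilon> :: real assume e: "0 < \<epsilon>"
    obtain \<eta> K where p: "0 < \<eta>" "0 < K" and t: "\<forall>\<^sub>F n in sequentially.
      prob {\<omega>\<in>space M. green_bound CARD('d) n * quantile (real n ^ CARD('d)) * eigenvalue a n \<omega> < \<eta>} \<le> \<epsilon> / 2
      \<and> prob {\<omega>\<in>space M. K < quantile (real n ^ CARD('d)) / trap_energy n * eigenvalue a n \<omega>} \<le> \<epsilon> / 2"
      using tight[of \<epsilon> a] c e a(1) by blast
    have an: "green_bound CARD('d) n * quantile (real n ^ CARD('d)) = ?an n"
      "quantile (real n ^ CARD('d)) / trap_energy n = ?an n" for n
      using c by (auto simp: green_bound_def trap_energy_def h)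
    have "\<forall>\<^sub>F n in sequentially.
      prob {\<omega>\<in>space M. \<eta> \<le> ?an n * eigenvalue a n \<omega> \<and> ?an n * eigenvalue a n \<omega> \<le> K} \<ge> 1 - \<epsilon>"
      using t unfolding an
    proof eventually_elim
      case (elim n)
      show ?case
        by (rule prob_between_ge[where X = "\<lambda>\<omega>. ?an n * eigenvalue a n \<omega>"])
           (use elim in \<open>auto intro!: borel_measurable_times eigenvalue_measurable\<close>)
    qed
    then show "\<exists>\<eta>>0. \<exists>K>0. \<forall>\<^sub>F n in sequentially.
      prob {\<omega>\<in>space M. \<eta> \<le> ?an n * eigenvalue a n \<omega> \<and> ?an n * eigenvalue a n \<omega> \<le> K} \<ge> 1 - \<epsilon>"
      using p by blast
  qed
  have 4: "let an = (\<lambda>n. ln (real n) * h ((real n)\<^sup>2)) in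
         \<forall>\<epsilon>>0. \<exists>\<eta>>0. \<exists>K>0. \<forall>\<^sub>F n in sequentially.
           prob {\<omega>\<in>space M. \<eta> \<le> an n * ev0 n \<omega> \<and> an n * ev0 n \<omega> \<le> K} \<ge> 1 - \<epsilon> \<and>
           prob {\<omega>\<in>space M. \<eta> \<le> an n * ev n \<omega> \<and> an n * ev n \<omega> \<le> ln (real n) * K} \<ge> 1 - \<epsilon>"
    if c: "CARD('d) = 2 \<and> \<alpha> < 1"
    unfolding Let_def prob_ev prob_ev0
  proof (intro allI impI)
    let ?an = "\<lambda>n. ln (real n) * h ((real n)\<^sup>2)"
    fix \<epsilon> :: real assume e: "0 < \<epsilon>"
    have d: "CARD('d) = 2" using c by simp
    have gb: "green_bound CARD('d) n * quantile (real n ^ CARD('d)) = ?an n" for n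
      using d by (simp add: green_bound_def h)
    have te: "quantile (real n ^ CARD('d)) / trap_energy n = h ((real n)\<^sup>2)" for n
      using d by (simp add: trap_energy_def h)
    obtain \<eta>1 K1 where p1: "0 < \<eta>1" "0 < K1" and t1: "\<forall>\<^sub>F n in sequentially.
      prob {\<omega>\<in>space M. ?an n * eigenvalue a n \<omega> < \<eta>1} \<le> \<epsilon> / 2
      \<and> prob {\<omega>\<in>space M. K1 < h ((real n)\<^sup>2) * eigenvalue a n \<omega>} \<le> \<epsilon> / 2"
      using tight[of \<epsilon> a] c e a(1) unfolding gb te by blast
    obtain \<eta>0 K where p0: "0 < \<eta>0" and t0: "\<forall>\<^sub>F n in sequentially.
      prob {\<omega>\<in>space M. ?an n * eigenvalue 0 n \<omega> < \<eta>0} \<le> \<epsilon> / 2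
      \<and> prob {\<omega>\<in>space M. K < h ((real n)\<^sup>2) * eigenvalue 0 n \<omega>} \<le> \<epsilon> / 2"
      using tight[of \<epsilon> 0] c e unfolding gb te by auto
    obtain K0 where K0: "0 < K0" and u0: "\<forall>\<^sub>F n in sequentially.
      prob {\<omega>\<in>space M. K0 < ?an n * eigenvalue 0 n \<omega>} \<le> \<epsilon> / 2"
      using eigenvalue_planar_upper_tight[of "\<epsilon> / 2"] e d unfolding h by auto
    define \<eta> where "\<eta> = min \<eta>0 \<eta>1"
    define K2 where "K2 = max K0 K1"
    have "\<forall>\<^sub>F n in sequentially.
      prob {\<omega>\<in>space M. \<eta> \<le> ?an n * eigenvalue 0 n \<omega> \<and> ?an n * eigenvalue 0 n \<omega> \<le> K2} \<ge> 1 - \<epsilon> \<and>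
      prob {\<omega>\<in>space M. \<eta> \<le> ?an n * eigenvalue a n \<omega> \<and> ?an n * eigenvalue a n \<omega> \<le> ln (real n) * K2} \<ge> 1 - \<epsilon>"
      using t0 t1 u0 eventually_ge_at_top[of 2]
    proof eventually_elim
      case (elim n)
      have l: "0 < ln (real n)" using elim(4) by simp
      have m0: "(\<lambda>\<omega>. ?an n * eigenvalue b n \<omega>) \<in> borel_measurable M" for b by measurable
      have low0: "prob {\<omega>\<in>space M. ?an n * eigenvalue 0 n \<omega> < \<eta>} \<le> \<epsilon> / 2"
      proof -
        have "prob {\<omega>\<in>space M. ?an n * eigenvalue 0 n \<omega> < \<eta>} \<le> prob {\<omega>\<in>space M. ?an n * eigenvalue 0 n \<omega> < \<eta>0}"
          by (intro finite_measure_mono) (auto simp: \<eta>_def)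
        then show ?thesis using elim(1) by simp
      qed
      have low1: "prob {\<omega>\<in>space M. ?an n * eigenvalue a n \<omega> < \<eta>} \<le> \<epsilon> / 2"
      proof -
        have "prob {\<omega>\<in>space M. ?an n * eigenvalue a n \<omega> < \<eta>} \<le> prob {\<omega>\<in>space M. ?an n * eigenvalue a n \<omega> < \<eta>1}"
          by (intro finite_measure_mono) (auto simp: \<eta>_def)
        then show ?thesis using elim(2) by simp
      qed
      have up0: "prob {\<omega>\<in>space M. K2 < ?an n * eigenvalue 0 n \<omega>} \<le> \<epsilon> / 2"
      proof -
        have "prob {\<omega>\<in>space M. K2 < ?an n * eigenvalue 0 n \<omega>} \<le> prob {\<omega>\<in>space M. K0 < ?an n * eigenvalue 0 n \<omega>}"
          by (intro finite_measure_mono) (auto simp: K2_def)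
        then show ?thesis using elim(3) by simp
      qed
      have up1: "prob {\<omega>\<in>space M. ln (real n) * K2 < ?an n * eigenvalue a n \<omega>} \<le> \<epsilon> / 2"
      proof -
        have "{\<omega>\<in>space M. ln (real n) * K2 < ?an n * eigenvalue a n \<omega>}
            \<subseteq> {\<omega>\<in>space M. K1 < h ((real n)\<^sup>2) * eigenvalue a n \<omega>}"
          using l by (auto simp: K2_def mult.assoc)
        then have "prob {\<omega>\<in>space M. ln (real n) * K2 < ?an n * eigenvalue a n \<omega>}
            \<le> prob {\<omega>\<in>space M. K1 < h ((real n)\<^sup>2) * eigenvalue a n \<omega>}"
          by (rule finite_measure_mono) measurable
        then show ?thesis using elim(2) by simp
      qed
      show ?case
        using prob_between_ge[OF m0 low0 up0] prob_between_ge[OF m0 low1 up1] by blast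
    qed
    moreover have "0 < \<eta>" "0 < K2" using p0 p1 K0 by (auto simp: \<eta>_def K2_def)
    ultimately show "\<exists>\<eta>>0. \<exists>K>0. \<forall>\<^sub>F n in sequentially.
      prob {\<omega>\<in>space M. \<eta> \<le> ?an n * eigenvalue 0 n \<omega> \<and> ?an n * eigenvalue 0 n \<omega> \<le> K} \<ge> 1 - \<epsilon> \<and>
      prob {\<omega>\<in>space M. \<eta> \<le> ?an n * eigenvalue a n \<omega> \<and> ?an n * eigenvalue a n \<omega> \<le> ln (real n) * K} \<ge> 1 - \<epsilon>"
      by blast
  qed
  show ?thesis using 1 2 3 4 by blast
qed

end
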